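(* Let $f \in \mathbb{R}[x]$, $x=(x_1,\dots,x_n)$, and let $G \in \mathcal{S}^m\mathbb{R}[x]$ be an $m\times m$ symmetric polynomial matrix. Consider the polynomial matrix optimization problem $$\min f(x) \quad \text{s.t.} \quad G(x)\succeq 0, \qquad (\mathrm{P})$$ with optimal value $f_{\min}$. Suppose the quadratic module $\mathrm{QM}[G]$ is Archimedean. If the nondegeneracy condition, the strict complementarity condition and the second order sufficient condition hold at every minimizer of $(\mathrm{P})$, then the matrix Moment-SOS hierarchy has finite convergence, i.e., there exists $N>0$ such that $f_{k,sos}=f_{k,mom}=f_{\min}$ for all $k\ge N$. Furthermore, $f-f_{\min}\in \mathrm{QM}[G]$.
   Context: A minimizer means a global minimizer of $(\mathrm{P})$. $\Sigma[x]$ denotes the set of sums of squares of polynomials. The quadratic module generated by $G$ is $\mathrm{QM}[G]=\{\sigma+\sum_{t=1}^r v_t^TGv_t : \sigma\in\Sigma[x],\ v_t\in\mathbb{R}[x]^m,\ r\in\mathbb{N}\}\subseteq \mathbb{R}[x]$; it is Archimedean if $R-\|x\|^2\in \mathrm{QM}[G]$ for some $R>0$. Its truncation $\mathrm{QM}[G]_{2k}$ consists of those elements with $\deg\sigma\le 2k$ and $\deg(v_t^TGv_t)\le 2k$ for all $t$. The SOS bound of order $k$ is $f_{k,sos}=\max\{\gamma: f-\gamma\in \mathrm{QM}[G]_{2k}\}$. For $y\in\mathbb{R}^{\mathbb{N}^n_{2k}}$ (where $\mathbb{N}^n_{2k}=\{\alpha\in\mathbb{N}^n:|\alpha|\le 2k\}$)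 the Riesz functional is $\mathscr{L}_y(\sum_\alpha p_\alpha x^\alpha)=\sum_\alpha p_\alpha y_\alpha$ on $\mathbb{R}[x]_{2k}$. The moment bound of order $k$ is $f_{k,mom}=\min\{\mathscr{L}_y(f): \mathscr{L}_y(1)=1,\ \mathscr{L}_y(p)\ge 0\ \forall p\in \mathrm{QM}[G]_{2k}\}$. Optimality conditions at a feasible point $u$: $\nabla G(u)[d]=\sum_{i=1}^n d_i\,\partial G/\partial x_i(u)$ for $d\in\mathbb{R}^n$, with adjoint $\nabla G(u)^*[X]=(\langle \partial G/\partial x_1(u),X\rangle,\dots,\langle \partial G/\partial x_n(u),X\rangle)^T$, $\langle W,Y\rangle=\mathrm{tr}(WY^T)$. Let $E$ be a matrix whose columns form a basis of $\ker G(u)$. The nondegeneracy condition (NDC) at $u$ is $\mathrm{Im}\,\nabla G(u)+\{N\in\mathcal{S}^m: E^TNE=0\}=\mathcal{S}^m$. If $u$ is a local minimizer satisfying NDC, there is a unique $\Lambda\in\mathcal{S}^m$ with $\nabla f(u)-\nabla G(u)^*[\Lambda]=0$, $\Lambda\succeq0$, $\langle\Lambda,G(u)\rangle=0$. The strict complementarity condition (SCC) holds at $u$ if $\mathrm{rank}\,G(u)+\mathrm{rank}\,\Lambda=m$. With $L(x,\Lambda)=f(x)-\langle\Lambda,G(x)\rangle$, $H(x,Q)_{ij}=2\langle Q,\ \partial_{x_i}G(x)\,G(x)^{\dagger}\,\partial_{x_j}G(x)\rangle$ ($\dagger$ = Moore–Penrose inverse, Hessian $\nabla^2$ in $x$)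 and $\mathcal{N}(u)=\{h\in\mathbb{R}^n:\sum_i h_i E^T\partial_{x_i}G(u)E=0\}$, the second order sufficient condition (SOSC) holds at $u$ if $h^T(\nabla^2L(u,\Lambda)+H(u,\Lambda))h>0$ for all $0\ne h\in\mathcal{N}(u)$. *)

theory Defs
  imports "HOL-Analysis.Analysis"
begin

definition mono :: "('n::finite \<Rightarrow> nat) \<Rightarrow> real^'n \<Rightarrow> real" where
  "mono \<alpha> x = (\<Prod>i\<in>UNIV. (x $ i) ^ (\<alpha> i))"

definition expts :: "nat \<Rightarrow> ('n::finite \<Rightarrow> nat) set" where
  "expts d = {\<alpha>. sum \<alpha> UNIV \<le> d}"

definition poly_deg_le :: "nat \<Rightarrow> (real^'n::finite \<Rightarrow> real) \<Rightarrow> bool" where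
  "poly_deg_le d p \<longleftrightarrow> (\<exists>c. p = (\<lambda>x. \<Sum>\<alpha>\<in>expts d. c \<alpha> * mono \<alpha> x))"

definition is_poly :: "(real^'n::finite \<Rightarrow> real) \<Rightarrow> bool" where
  "is_poly p \<longleftrightarrow> (\<exists>d. poly_deg_le d p)"

definition polyvec :: "(real^'n::finite \<Rightarrow> real^'m) \<Rightarrow> bool" where
  "polyvec v \<longleftrightarrow> (\<forall>a. is_poly (\<lambda>x. v x $ a))"

definition polymat :: "(real^'n::finite \<Rightarrow> real^'m^'m) \<Rightarrow> bool" where
  "polymat G \<longleftrightarrow> (\<forall>a b. is_poly (\<lambda>x. G x $ a $ b))"

definition symmat :: "real^'m^'m \<Rightarrow> bool" where
  "symmat X \<longleftrightarrow> transpose X = X"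

definition psd :: "real^'m^'m \<Rightarrow> bool" where
  "psd X \<longleftrightarrow> symmat X \<and> (\<forall>v. v \<bullet> (X *v v) \<ge> 0)"

definition sos :: "(real^'n::finite \<Rightarrow> real) \<Rightarrow> bool" where
  "sos \<sigma> \<longleftrightarrow> (\<exists>qs. (\<forall>q\<in>set qs. is_poly q) \<and> \<sigma> = (\<lambda>x. \<Sum>q\<leftarrow>qs. (q x)^2))"

definition QM :: "(real^'n::finite \<Rightarrow> real^'m^'m) \<Rightarrow> (real^'n \<Rightarrow> real) \<Rightarrow> bool" where
  "QM G p \<longleftrightarrow> (\<exists>\<sigma> vs. sos \<sigma> \<and> (\<forall>v\<in>set vs. polyvec v) \<and>
      p = (\<lambda>x. \<sigma> x + (\<Sum>v\<leftarrow>vs. v x \<bullet> (G x *v v x))))"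

definition QMk :: "nat \<Rightarrow> (real^'n::finite \<Rightarrow> real^'m^'m) \<Rightarrow> (real^'n \<Rightarrow> real) \<Rightarrow> bool" where
  "QMk k G p \<longleftrightarrow> (\<exists>\<sigma> vs. sos \<sigma> \<and> poly_deg_le (2*k) \<sigma> \<and>
      (\<forall>v\<in>set vs. polyvec v \<and> poly_deg_le (2*k) (\<lambda>x. v x \<bullet> (G x *v v x))) \<and>
      p = (\<lambda>x. \<sigma> x + (\<Sum>v\<leftarrow>vs. v x \<bullet> (G x *v v x))))"

definition archimedean :: "(real^'n::finite \<Rightarrow> real^'m^'m) \<Rightarrow> bool" where
  "archimedean G \<longleftrightarrow> (\<exists>R>0. QM G (\<lambda>x. R - (norm x)^2))"

definition f_sos :: "nat \<Rightarrow> (real^'n::finite \<Rightarrow> real) \<Rightarrow> (real^'n \<Rightarrow> real^'m^'m) \<Rightarrow> ereal" where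
  "f_sos k f G = Sup (ereal ` {\<gamma>. QMk k G (\<lambda>x. f x - \<gamma>)})"

text \<open>Coefficients (w.r.t. monomials of degree \<le> 2k) and the Riesz functional;
  a truncated moment vector y is given by its values on expts (2k).\<close>
definition coeffs :: "nat \<Rightarrow> (real^'n::finite \<Rightarrow> real) \<Rightarrow> ('n \<Rightarrow> nat) \<Rightarrow> real" where
  "coeffs k p = (SOME c. p = (\<lambda>x. \<Sum>\<alpha>\<in>expts (2*k). c \<alpha> * mono \<alpha> x))"

definition riesz :: "nat \<Rightarrow> (('n::finite \<Rightarrow> nat) \<Rightarrow> real) \<Rightarrow> (real^'n \<Rightarrow> real) \<Rightarrow> real" where
  "riesz k y p = (\<Sum>\<alpha>\<in>expts (2*k). coeffs k p \<alpha> * y \<alpha>)"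

definition f_mom :: "nat \<Rightarrow> (real^'n::finite \<Rightarrow> real) \<Rightarrow> (real^'n \<Rightarrow> real^'m^'m) \<Rightarrow> ereal" where
  "f_mom k f G = Inf {ereal (riesz k y f) | y. riesz k y (\<lambda>_. 1) = 1 \<and>
                      (\<forall>p. QMk k G p \<longrightarrow> riesz k y p \<ge> 0)}"

definition feasible :: "(real^'n::finite \<Rightarrow> real^'m^'m) \<Rightarrow> (real^'n) set" where
  "feasible G = {x. psd (G x)}"

definition fmin :: "(real^'n::finite \<Rightarrow> real) \<Rightarrow> (real^'n \<Rightarrow> real^'m^'m) \<Rightarrow> real" where
  "fmin f G = Inf (f ` feasible G)"

definition minimizer :: "(real^'n::finite \<Rightarrow> real) \<Rightarrow> (real^'n \<Rightarrow> real^'m^'m) \<Rightarrow> real^'n \<Rightarrow> bool" where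
  "minimizer f G u \<longleftrightarrow> u \<in> feasible G \<and> (\<forall>x\<in>feasible G. f u \<le> f x)"

definition partial :: "(real^'n::finite \<Rightarrow> real) \<Rightarrow> 'n \<Rightarrow> real^'n \<Rightarrow> real" where
  "partial p i u = deriv (\<lambda>t. p (u + t *\<^sub>R axis i 1)) 0"

definition grad :: "(real^'n::finite \<Rightarrow> real) \<Rightarrow> real^'n \<Rightarrow> real^'n" where
  "grad p u = (\<chi> i. partial p i u)"

definition hess :: "(real^'n::finite \<Rightarrow> real) \<Rightarrow> real^'n \<Rightarrow> real^'n^'n" where
  "hess p u = (\<chi> i j. partial (\<lambda>x. partial p i x) j u)"

definition dG :: "(real^'n::finite \<Rightarrow> real^'m^'m) \<Rightarrow> 'n \<Rightarrow> real^'n \<Rightarrow> real^'m^'m" where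
  "dG G i u = (\<chi> a b. partial (\<lambda>x. G x $ a $ b) i u)"

definition DG :: "(real^'n::finite \<Rightarrow> real^'m^'m) \<Rightarrow> real^'n \<Rightarrow> real^'n \<Rightarrow> real^'m^'m" where
  "DG G u d = (\<Sum>i\<in>UNIV. (d $ i) *\<^sub>R dG G i u)"

definition matinner :: "real^'m^'m \<Rightarrow> real^'m^'m \<Rightarrow> real" where
  "matinner W Y = (\<Sum>a\<in>UNIV. \<Sum>b\<in>UNIV. W $ a $ b * Y $ a $ b)"

definition DG_adj :: "(real^'n::finite \<Rightarrow> real^'m^'m) \<Rightarrow> real^'n \<Rightarrow> real^'m^'m \<Rightarrow> real^'n" where
  "DG_adj G u X = (\<chi> i. matinner (dG G i u) X)"

text \<open>The columns of E, given as a list es, form a basis of ker G(u).\<close>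
definition ker_basis :: "real^'m^'m \<Rightarrow> (real^'m) list \<Rightarrow> bool" where
  "ker_basis A es \<longleftrightarrow> distinct es \<and> independent (set es) \<and> span (set es) = {v. A *v v = 0}"

definition EtNE_zero :: "(real^'m) list \<Rightarrow> real^'m^'m \<Rightarrow> bool" where
  "EtNE_zero es N \<longleftrightarrow> (\<forall>e1\<in>set es. \<forall>e2\<in>set es. e1 \<bullet> (N *v e2) = 0)"

definition NDC :: "(real^'n::finite \<Rightarrow> real^'m^'m) \<Rightarrow> real^'n \<Rightarrow> bool" where
  "NDC G u \<longleftrightarrow> (\<forall>es. ker_basis (G u) es \<longrightarrow>
     {A + B | A B. A \<in> range (DG G u) \<and> symmat B \<and> EtNE_zero es B} = {X. symmat X})"

definition KKT :: "(real^'n::finite \<Rightarrow> real) \<Rightarrow> (real^'n \<Rightarrow> real^'m^'m) \<Rightarrow> real^'n \<Rightarrow> real^'m^'m \<Rightarrow> bool" where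
  "KKT f G u \<Lambda> \<longleftrightarrow> symmat \<Lambda> \<and> grad f u - DG_adj G u \<Lambda> = 0 \<and> psd \<Lambda> \<and> matinner \<Lambda> (G u) = 0"

text \<open>The (unique, under NDC) Lagrange multiplier.\<close>
definition mult :: "(real^'n::finite \<Rightarrow> real) \<Rightarrow> (real^'n \<Rightarrow> real^'m^'m) \<Rightarrow> real^'n \<Rightarrow> real^'m^'m" where
  "mult f G u = (THE \<Lambda>. KKT f G u \<Lambda>)"

definition SCC :: "(real^'n::finite \<Rightarrow> real) \<Rightarrow> (real^'n \<Rightarrow> real^'m^'m) \<Rightarrow> real^'n \<Rightarrow> bool" where
  "SCC f G u \<longleftrightarrow> rank (G u) + rank (mult f G u) = CARD('m)"

definition pinv :: "real^'m^'m \<Rightarrow> real^'m^'m" where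
  "pinv A = (THE X. A ** X ** A = A \<and> X ** A ** X = X \<and>
                    transpose (A ** X) = A ** X \<and> transpose (X ** A) = X ** A)"

definition Hterm :: "(real^'n::finite \<Rightarrow> real^'m^'m) \<Rightarrow> real^'n \<Rightarrow> real^'m^'m \<Rightarrow> real^'n^'n" where
  "Hterm G x Q = (\<chi> i j. 2 * matinner Q (dG G i x ** pinv (G x) ** dG G j x))"

definition Lag :: "(real^'n::finite \<Rightarrow> real) \<Rightarrow> (real^'n \<Rightarrow> real^'m^'m) \<Rightarrow> real^'m^'m \<Rightarrow> real^'n \<Rightarrow> real" where
  "Lag f G \<Lambda> x = f x - matinner \<Lambda> (G x)"

definition crit_cone :: "(real^'n::finite \<Rightarrow> real^'m^'m) \<Rightarrow> real^'n \<Rightarrow> (real^'m) list \<Rightarrow> (real^'n) set" where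
  "crit_cone G u es = {h. EtNE_zero es (DG G u h)}"

definition SOSC :: "(real^'n::finite \<Rightarrow> real) \<Rightarrow> (real^'n \<Rightarrow> real^'m^'m) \<Rightarrow> real^'n \<Rightarrow> bool" where
  "SOSC f G u \<longleftrightarrow> (\<forall>es. ker_basis (G u) es \<longrightarrow>
     (\<forall>h\<in>crit_cone G u es. h \<noteq> 0 \<longrightarrow>
        h \<bullet> ((hess (Lag f G (mult f G u)) u + Hterm G u (mult f G u)) *v h) > 0))"

end

theory Submission
  imports Defs
begin

text \<open>Call a polynomial \<open>F\<close> regular at a zero \<open>u\<close> if \<open>F x \<ge> c |x - u|\<^sup>2\<close> for all \<open>x\<close> near \<open>u\<close>,
  feasible or not. Let \<open>F = f - f\<^sub>m\<^sub>i\<^sub>n\<close>. At a minimizer \<open>u\<close> write the multiplier as a sum of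
  \<open>v v\<^sup>T\<close>; second order perturbations of the vectors \<open>v\<close> give a sum \<open>g\<close> of terms \<open>w\<^sup>T G w\<close> such that
  \<open>F - g\<close> is regular at \<open>u\<close> (this uses SOSC and SCC). Since \<open>g\<close> is nonnegative on the feasible set,
  minimizers are isolated, hence finite in number. Damping the certificates \<open>g\<close> by high even powers of
  polynomials peaking at \<open>u\<close> and subtracting them, we may assume that \<open>F\<close> itself is regular at all its
  feasible zeros. Then \<open>F\<close> is, near \<open>u\<close>, a sum of squares of linear forms vanishing at \<open>u\<close> with positive
  coefficients; the same damping makes this global with coefficients that are nonnegative on the
  feasible set, regular at their zeros, and have one zero less. By induction on the number of zeros
  everything reduces to Putinar's theorem, which is obtained from Bernstein expansions on a box.\<close>

section \<open>Polynomial functions\<close>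

text \<open>Putinar's theorem needs strict positivity, while \<open>f - fmin\<close> vanishes at the
  minimizers. A local certificate \<open>g\<close> cannot be subtracted as it stands, since
  \<open>F - g\<close> may be negative at feasible points far from \<open>u\<close>. Even powers
  \<open>E^(2k)\<close> of a polynomial with \<open>E u = 1\<close> and \<open>|E| < 1\<close> at
  all other feasible points solve this: they are squares, so \<open>E^(2k) g\<close> stays in the
  quadratic module; they tend to zero away from \<open>u\<close>; and \<open>1 - E^(2k)\<close> is
  divisible by \<open>|x - u|^2\<close>, so damping alters a function vanishing at \<open>u\<close>
  only to third order there, which quadratic growth absorbs. Making \<open>E\<close> vanish at the
  remaining zeros protects the growth there in the same way. Growth is demanded on a full
  neighbourhood because it then forces a vanishing gradient and a positive definite quadratic part,
  after which the constraints no longer enter the local analysis. SCC is what makes the multiplier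
  vectors span \<open>ker G(u)\<close>, so that the penalty built from them vanishes only on the
  critical cone.\<close>

lemma finite_expts: "finite (expts d :: ('n::finite \<Rightarrow> nat) set)"
proof (rule finite_subset)
  show "(expts d :: ('n \<Rightarrow> nat) set) \<subseteq> PiE UNIV (\<lambda>_. {..d})"
    by (force simp: expts_def PiE_def Pi_def intro: order_trans[OF member_le_sum])
  show "finite (PiE UNIV (\<lambda>_. {..d}) :: ('n \<Rightarrow> nat) set)"
    by (intro finite_PiE) auto
qed

lemma expts_mono: "d \<le> e \<Longrightarrow> expts d \<subseteq> expts e"
  by (auto simp: expts_def)

lemma poly_deg_le_sumI:
  fixes c :: "('n::finite \<Rightarrow> nat) \<Rightarrow> real"
  assumes "T \<subseteq> expts d"
  shows "poly_deg_le d (\<lambda>x. \<Sum>\<alpha>\<in>T. c \<alpha> * mono \<alpha> x)"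
proof -
  have "(\<Sum>\<alpha>\<in>T. c \<alpha> * mono \<alpha> x) = (\<Sum>\<alpha>\<in>expts d. (if \<alpha> \<in> T then c \<alpha> else 0) * mono \<alpha> x)" for x
    by (rule sum.mono_neutral_cong_left) (use assms finite_expts in auto)
  then show ?thesis
    unfolding poly_deg_le_def by (intro exI[of _ "\<lambda>\<alpha>. if \<alpha> \<in> T then c \<alpha> else 0"]) simp
qed

lemma poly_deg_le_mono:
  assumes "poly_deg_le d p" "d \<le> e"
  shows "poly_deg_le e p"
  using assms poly_deg_le_sumI[OF expts_mono] unfolding poly_deg_le_def[of d] by blast

lemma poly_deg_le_lincomb:
  assumes "poly_deg_le d p" "poly_deg_le d q"
  shows "poly_deg_le d (\<lambda>x. a * p x + b * q x)"
proof -
  obtain c c' where "p = (\<lambda>x. \<Sum>\<alpha>\<in>expts d. c \<alpha> * mono \<alpha> x)" "q = (\<lambda>x. \<Sum>\<alpha>\<in>expts d. c' \<alpha> * mono \<alpha> x)"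
    using assms unfolding poly_deg_le_def by blast
  then have "(\<lambda>x. a * p x + b * q x) = (\<lambda>x. \<Sum>\<alpha>\<in>expts d. (a * c \<alpha> + b * c' \<alpha>) * mono \<alpha> x)"
    by (simp add: sum_distrib_left sum.distrib algebra_simps)
  then show ?thesis
    unfolding poly_deg_le_def by (rule exI[of _ "\<lambda>\<alpha>. a * c \<alpha> + b * c' \<alpha>"])
qed

lemma poly_deg_le_add:
  assumes "poly_deg_le d p" "poly_deg_le d q"
  shows "poly_deg_le d (\<lambda>x. p x + q x)"
  using poly_deg_le_lincomb[OF assms, of 1 1] by simp

lemma poly_deg_le_const: "poly_deg_le d (\<lambda>x. c)"
  using poly_deg_le_sumI[of "{\<lambda>_. 0}" d "\<lambda>_. c"] by (simp add: expts_def mono_def)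

lemma poly_deg_le_sum_list:
  assumes "\<And>v. v \<in> set vs \<Longrightarrow> poly_deg_le d (p v)"
  shows "poly_deg_le d (\<lambda>x. \<Sum>v\<leftarrow>vs. p v x)"
  using assms by (induction vs) (auto intro: poly_deg_le_const poly_deg_le_add)

lemma is_poly_add:
  assumes "is_poly p" "is_poly q"
  shows "is_poly (\<lambda>x. p x + q x)"
proof -
  obtain d e where "poly_deg_le d p" "poly_deg_le e q"
    using assms unfolding is_poly_def by blast
  then have "poly_deg_le (max d e) (\<lambda>x. p x + q x)"
    by (intro poly_deg_le_add) (auto intro: poly_deg_le_mono)
  then show ?thesis
    unfolding is_poly_def by blast
qed

lemma is_poly_const: "is_poly (\<lambda>x. c)"
  unfolding is_poly_def using poly_deg_le_const by blast

lemma is_poly_sum: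
  assumes "\<And>i. i \<in> I \<Longrightarrow> is_poly (p i)"
  shows "is_poly (\<lambda>x. \<Sum>i\<in>I. p i x)"
  using assms by (induction I rule: infinite_finite_induct) (auto intro: is_poly_const is_poly_add)

lemma is_poly_monomial: "is_poly (\<lambda>x. c * mono \<alpha> x)"
  using poly_deg_le_sumI[of "{\<alpha>}" "sum \<alpha> UNIV" "\<lambda>_. c"]
  unfolding is_poly_def by (auto simp: expts_def)

lemma mono_mult: "mono \<alpha> x * mono \<beta> x = mono (\<lambda>i. \<alpha> i + \<beta> i) x"
  by (simp add: mono_def power_add prod.distrib)

lemma is_poly_mult:
  assumes "is_poly p" "is_poly q"
  shows "is_poly (\<lambda>x. p x * q x)"
proof -
  obtain d e c c' where "p = (\<lambda>x. \<Sum>\<alpha>\<in>expts d. c \<alpha> * mono \<alpha> x)" "q = (\<lambda>x. \<Sum>\<beta>\<in>expts e. c' \<beta> * mono \<beta> x)"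
    using assms unfolding is_poly_def poly_deg_le_def by blast
  then have "(\<lambda>x. p x * q x) = (\<lambda>x. \<Sum>\<alpha>\<in>expts d. \<Sum>\<beta>\<in>expts e. (c \<alpha> * c' \<beta>) * mono (\<lambda>i. \<alpha> i + \<beta> i) x)"
    by (simp only: sum_product mono_mult[symmetric]) (simp add: mult_ac)
  then show ?thesis
    by (auto intro!: is_poly_sum is_poly_monomial)
qed

lemma is_poly_component: "is_poly (\<lambda>x. x $ i)"
proof -
  have "mono (\<lambda>j. if j = i then 1 else 0) x = x $ i" for x :: "real^'a"
    unfolding mono_def by (subst prod.remove[of _ i]) (auto intro: prod.neutral)
  then show ?thesis
    using is_poly_monomial[of 1 "\<lambda>j. if j = i then 1 else 0"] by simp
qed

lemma linear_vec_expansion: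
  fixes f :: "real^'n::finite \<Rightarrow> real"
  assumes "linear f"
  shows "f x = (\<Sum>i\<in>UNIV. x $ i * f (axis i 1))"
proof -
  have "(\<Sum>i\<in>UNIV. x $ i *\<^sub>R axis i 1) = x"
    using basis_expansion[of x] unfolding scalar_mult_eq_scaleR .
  moreover have "f (\<Sum>i\<in>UNIV. x $ i *\<^sub>R axis i 1) = (\<Sum>i\<in>UNIV. x $ i * f (axis i 1))"
    by (simp add: linear_sum[OF assms] linear_cmul[OF assms])
  ultimately show ?thesis by simp
qed

text \<open>Passing to an inductively defined class gives structural induction, and makes the
  closure and continuity results of that class available for coefficient expansions.\<close>

lemma is_poly_iff: "is_poly p \<longleftrightarrow> real_polynomial_function p"
proof
  assume "is_poly p"
  then obtain d c where "p = (\<lambda>x. \<Sum>\<alpha>\<in>expts d. c \<alpha> * mono \<alpha> x)"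
    unfolding is_poly_def poly_deg_le_def by blast
  moreover have "real_polynomial_function (\<lambda>x::real^'a. x $ i)" for i
    by (intro real_polynomial_function.intros(1) bounded_linear_vec_nth)
  ultimately show "real_polynomial_function p"
    unfolding mono_def
    by (auto intro!: real_polynomial_function_sum finite_expts real_polynomial_function.intros(4)
        real_polynomial_function_prod real_polynomial_function_power intro: real_polynomial_function.intros(2))
next
  assume "real_polynomial_function p"
  then show "is_poly p"
  proof induction
    case (linear f)
    have "f x = (\<Sum>i\<in>UNIV. x $ i * f (axis i 1))" for x
      by (rule linear_vec_expansion[OF bounded_linear.linear[OF linear]])
    then have eq: "f = (\<lambda>x. \<Sum>i\<in>UNIV. x $ i * f (axis i 1))" by blast
    show ?case
      by (subst eq) (intro is_poly_sum is_poly_mult is_poly_component is_poly_const)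
  next
    case (const c)
    show ?case by (rule is_poly_const)
  next
    case (add f g)
    show ?case by (rule is_poly_add[OF add.IH])
  next
    case (mult f g)
    show ?case by (rule is_poly_mult[OF mult.IH])
  qed
qed

lemma is_poly_minus: "is_poly p \<Longrightarrow> is_poly (\<lambda>x. - p x)"
  and is_poly_diff: "is_poly p \<Longrightarrow> is_poly q \<Longrightarrow> is_poly (\<lambda>x. p x - q x)"
  and is_poly_power: "is_poly p \<Longrightarrow> is_poly (\<lambda>x. p x ^ k)"
  and is_poly_divide: "is_poly p \<Longrightarrow> is_poly (\<lambda>x. p x / c)"
  by (auto simp: is_poly_iff)

lemma is_poly_prod:
  assumes "\<And>i. i \<in> I \<Longrightarrow> is_poly (p i)"
  shows "is_poly (\<lambda>x. \<Prod>i\<in>I. p i x)"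
  using assms by (induction I rule: infinite_finite_induct) (auto intro: is_poly_const is_poly_mult)

lemma is_poly_sum_list:
  assumes "\<And>v. v \<in> set vs \<Longrightarrow> is_poly (p v)"
  shows "is_poly (\<lambda>x. \<Sum>v\<leftarrow>vs. p v x)"
  using assms by (induction vs) (auto intro: is_poly_const is_poly_add)

lemmas is_poly_intros = is_poly_const is_poly_component is_poly_add is_poly_mult is_poly_minus
  is_poly_diff is_poly_power is_poly_divide is_poly_sum is_poly_prod is_poly_sum_list

lemma is_poly_inner_diff: "is_poly (\<lambda>x. (x - u) \<bullet> (x - u))"
  unfolding inner_vec_def inner_real_def vector_minus_component by (intro is_poly_intros)

lemma is_poly_norm_diff_sq: "is_poly (\<lambda>x. (norm (x - u))\<^sup>2)"
  unfolding power2_norm_eq_inner by (rule is_poly_inner_diff)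

lemma is_poly_continuous: "is_poly p \<Longrightarrow> continuous_on S p"
  unfolding is_poly_iff real_polynomial_function_eq
  by (rule continuous_on_polymonial_function)

lemma is_poly_bounded_on_compact:
  assumes "is_poly p" "compact S"
  obtains C where "C > 0" "\<And>x. x \<in> S \<Longrightarrow> \<bar>p x\<bar> \<le> C"
proof -
  have "bounded (p ` S)"
    using assms by (intro compact_imp_bounded compact_continuous_image is_poly_continuous)
  then obtain C where "C > 0" "\<forall>y\<in>p ` S. norm y \<le> C"
    unfolding bounded_pos by blast
  then show ?thesis
    using that by auto
qed

text \<open>A first order expansion with polynomial factors and no calculus; products are handled by
  \<open>f g - f(u) g(u) = (f - f(u)) g + f(u) (g - g(u))\<close>. Applied twice it yields a second
  order expansion with polynomial coefficients.\<close>

lemma is_poly_hadamard: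
  fixes p :: "real^'n::finite \<Rightarrow> real"
  assumes "is_poly p"
  obtains q where "\<And>i. is_poly (q i)" "\<And>x. p x = p u + (\<Sum>i\<in>UNIV. (x $ i - u $ i) * q i x)"
proof -
  have "real_polynomial_function p"
    using assms by (simp add: is_poly_iff)
  then have "\<exists>q. (\<forall>i. is_poly (q i)) \<and> (\<forall>x. p x = p u + (\<Sum>i\<in>UNIV. (x $ i - u $ i) * q i x))"
  proof induction
    case (linear f)
    have "f x = f u + (\<Sum>i\<in>UNIV. (x $ i - u $ i) * f (axis i 1))" for x
      using linear_vec_expansion[OF bounded_linear.linear[OF linear], of "x - u"]
        linear_diff[OF bounded_linear.linear[OF linear], of x u] by simp
    then show ?case
      by (intro exI[of _ "\<lambda>i x. f (axis i 1)"] conjI allI is_poly_const)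
  next
    case (const c)
    then show ?case
      by (intro exI[of _ "\<lambda>i x. 0"]) (auto intro: is_poly_const)
  next
    case (add f g)
    then obtain q r where q: "\<forall>i. is_poly (q i)" "\<forall>i. is_poly (r i)"
      and f: "\<And>x. f x = f u + (\<Sum>i\<in>UNIV. (x $ i - u $ i) * q i x)"
      and g: "\<And>x. g x = g u + (\<Sum>i\<in>UNIV. (x $ i - u $ i) * r i x)" by blast
    have eq: "f x + g x = f u + g u + (\<Sum>i\<in>UNIV. (x $ i - u $ i) * (q i x + r i x))" for x
      using f[of x] g[of x] by (simp add: distrib_left sum.distrib)
    show ?case
      by (intro exI[of _ "\<lambda>i x. q i x + r i x"] conjI allI is_poly_add eq q[rule_format])
  next
    case (mult f g)
    then obtain q r where q: "\<forall>i. is_poly (q i)" "\<forall>i. is_poly (r i)"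
      and f: "\<And>x. f x = f u + (\<Sum>i\<in>UNIV. (x $ i - u $ i) * q i x)"
      and g: "\<And>x. g x = g u + (\<Sum>i\<in>UNIV. (x $ i - u $ i) * r i x)" by blast
    have eq: "f x * g x = f u * g u + (\<Sum>i\<in>UNIV. (x $ i - u $ i) * (q i x * g x + f u * r i x))" for x
    proof -
      have "f x * g x = f u * g u + (f x - f u) * g x + f u * (g x - g u)"
        by (simp add: algebra_simps)
      also have "f x - f u = (\<Sum>i\<in>UNIV. (x $ i - u $ i) * q i x)"
        using f[of x] by simp
      also have "g x - g u = (\<Sum>i\<in>UNIV. (x $ i - u $ i) * r i x)"
        using g[of x] by simp
      finally show ?thesis
        by (simp only: distrib_left sum.distrib sum_distrib_left sum_distrib_right add.assoc) (simp add: mult_ac)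
    qed
    have "is_poly g"
      using mult by (simp add: is_poly_iff)
    show ?case
      by (intro exI[of _ "\<lambda>i x. q i x * g x + f u * r i x"] conjI allI is_poly_intros eq
          q[rule_format] \<open>is_poly g\<close>)
  qed
  then show ?thesis
    using that by blast
qed

section \<open>Uniqueness of coefficients and the Riesz functional\<close>

lemma sum_monomials_eq_0:
  fixes c :: "('n::finite \<Rightarrow> nat) \<Rightarrow> real"
  assumes "finite I" "finite T"
    and "\<And>x :: 'n \<Rightarrow> real. (\<Sum>\<alpha>\<in>T. c \<alpha> * (\<Prod>i\<in>I. x i ^ \<alpha> i)) = 0"
    and "\<And>\<alpha> \<beta>. \<alpha> \<in> T \<Longrightarrow> \<beta> \<in> T \<Longrightarrow> (\<And>i. i \<in> I \<Longrightarrow> \<alpha> i = \<beta> i) \<Longrightarrow> \<alpha> = \<beta>"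
    and "\<alpha> \<in> T"
  shows "c \<alpha> = 0"
  using assms
proof (induction I arbitrary: T \<alpha> rule: finite_induct)
  case empty
  then have "T = {\<alpha>}" by blast
  then show ?case using empty by simp
next
  case (insert j I)
  define n where "n = Max ((\<lambda>\<beta>. \<beta> j) ` T)"
  have n: "\<beta> j \<le> n" if "\<beta> \<in> T" for \<beta>
    using that insert.prems by (auto simp: n_def)
  define Tk where "Tk k = {\<beta> \<in> T. \<beta> j = k}" for k
  \<comment> \<open>With all variables but \<open>x j = z\<close> frozen, the sum is a univariate
    polynomial in \<open>z\<close> that vanishes identically. Its coefficients, collected over
    \<open>Tk k\<close>, therefore vanish for every choice of the other variables.\<close>
  have coef: "(\<Sum>\<beta>\<in>Tk k. c \<beta> * (\<Prod>i\<in>I. x i ^ \<beta> i)) = 0" if "k \<le> n" for k x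
  proof -
    have "(\<Sum>k\<le>n. (\<Sum>\<beta>\<in>Tk k. c \<beta> * (\<Prod>i\<in>I. x i ^ \<beta> i)) * z ^ k) = 0" for z
    proof -
      have "0 = (\<Sum>\<beta>\<in>T. c \<beta> * (\<Prod>i\<in>insert j I. (x(j := z)) i ^ \<beta> i))"
        using insert.prems(2) by metis
      also have "\<dots> = (\<Sum>\<beta>\<in>T. c \<beta> * ((\<Prod>i\<in>I. x i ^ \<beta> i) * z ^ \<beta> j))"
      proof (rule sum.cong[OF refl])
        fix \<beta>
        have "(\<Prod>i\<in>I. (x(j := z)) i ^ \<beta> i) = (\<Prod>i\<in>I. x i ^ \<beta> i)"
          using insert.hyps by (intro prod.cong) auto
        then show "c \<beta> * (\<Prod>i\<in>insert j I. (x(j := z)) i ^ \<beta> i) = c \<beta> * ((\<Prod>i\<in>I. x i ^ \<beta> i) * z ^ \<beta> j)"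
          using insert.hyps by simp
      qed
      also have "\<dots> = (\<Sum>k\<le>n. \<Sum>\<beta>\<in>Tk k. c \<beta> * ((\<Prod>i\<in>I. x i ^ \<beta> i) * z ^ \<beta> j))"
        unfolding Tk_def by (rule sum.group[symmetric]) (use insert.prems n in auto)
      also have "\<dots> = (\<Sum>k\<le>n. (\<Sum>\<beta>\<in>Tk k. c \<beta> * (\<Prod>i\<in>I. x i ^ \<beta> i)) * z ^ k)"
        by (intro sum.cong refl, subst sum_distrib_right) (auto simp: Tk_def mult_ac intro!: sum.cong)
      finally show ?thesis by simp
    qed
    then show ?thesis
      using polyfun_eq_0[of "\<lambda>k. \<Sum>\<beta>\<in>Tk k. c \<beta> * (\<Prod>i\<in>I. x i ^ \<beta> i)" n] that by blast
  qed
  show ?case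
  proof (rule insert.IH[of "Tk (\<alpha> j)"])
    show "finite (Tk (\<alpha> j))" "\<alpha> \<in> Tk (\<alpha> j)"
      using insert.prems by (auto simp: Tk_def)
    show "(\<Sum>\<beta>\<in>Tk (\<alpha> j). c \<beta> * (\<Prod>i\<in>I. x i ^ \<beta> i)) = 0" for x
      using coef n insert.prems by blast
    show "\<beta> = \<gamma>" if "\<beta> \<in> Tk (\<alpha> j)" "\<gamma> \<in> Tk (\<alpha> j)" "\<And>i. i \<in> I \<Longrightarrow> \<beta> i = \<gamma> i" for \<beta> \<gamma>
      by (rule insert.prems(3)) (use that in \<open>auto simp: Tk_def\<close>)
  qed
qed

text \<open>\<open>coeffs\<close> is defined by choice; linear independence of monomial functions
  makes the choice unique, and this is where linearity of \<open>riesz\<close> comes from.\<close>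

lemma coeffs_unique:
  fixes c :: "('n::finite \<Rightarrow> nat) \<Rightarrow> real"
  assumes "p = (\<lambda>x. \<Sum>\<alpha>\<in>expts (2*k). c \<alpha> * mono \<alpha> x)" "\<alpha> \<in> expts (2*k)"
  shows "coeffs k p \<alpha> = c \<alpha>"
proof -
  have "p = (\<lambda>x. \<Sum>\<alpha>\<in>expts (2*k). coeffs k p \<alpha> * mono \<alpha> x)"
    unfolding coeffs_def using someI[of "\<lambda>c. p = (\<lambda>x. \<Sum>\<alpha>\<in>expts (2*k). c \<alpha> * mono \<alpha> x)", OF assms(1)] .
  from trans[OF sym[OF fun_cong[OF this]] fun_cong[OF assms(1)]]
  have eq: "(\<Sum>\<alpha>\<in>expts (2*k). coeffs k p \<alpha> * mono \<alpha> x) = (\<Sum>\<alpha>\<in>expts (2*k). c \<alpha> * mono \<alpha> x)" for x .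
  have "(\<Sum>\<alpha>\<in>expts (2*k). (coeffs k p \<alpha> - c \<alpha>) * (\<Prod>i\<in>UNIV. x i ^ \<alpha> i)) = 0" for x :: "'n \<Rightarrow> real"
    using eq[of "\<chi> i. x i"] by (simp add: mono_def algebra_simps sum_subtractf)
  then have "coeffs k p \<alpha> - c \<alpha> = 0"
    by (intro sum_monomials_eq_0[of UNIV "expts (2*k)" "\<lambda>\<alpha>. coeffs k p \<alpha> - c \<alpha>"])
      (auto simp: finite_expts assms(2))
  then show ?thesis by simp
qed

lemma riesz_eq:
  assumes "p = (\<lambda>x. \<Sum>\<alpha>\<in>expts (2*k). c \<alpha> * mono \<alpha> x)"
  shows "riesz k y p = (\<Sum>\<alpha>\<in>expts (2*k). c \<alpha> * y \<alpha>)"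
  unfolding riesz_def using coeffs_unique[OF assms] by (intro sum.cong) auto

text \<open>These are the moments of the Dirac measure at \<open>u\<close>: point evaluation is a
  Riesz functional.\<close>

lemma riesz_mono:
  assumes "poly_deg_le (2*k) p"
  shows "riesz k (\<lambda>\<alpha>. mono \<alpha> u) p = p u"
proof -
  obtain c where c: "p = (\<lambda>x. \<Sum>\<alpha>\<in>expts (2*k). c \<alpha> * mono \<alpha> x)"
    using assms unfolding poly_deg_le_def by blast
  from riesz_eq[OF c] fun_cong[OF c] show ?thesis by (rule trans[OF _ sym])
qed

lemma riesz_diff_const:
  fixes p :: "real^'n::finite \<Rightarrow> real"
  assumes "poly_deg_le (2*k) p"
  shows "riesz k y (\<lambda>x. p x - a) = riesz k y p - a * riesz k y (\<lambda>_. 1)"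
proof -
  obtain c where c: "p = (\<lambda>x. \<Sum>\<alpha>\<in>expts (2*k). c \<alpha> * mono \<alpha> x)"
    using assms unfolding poly_deg_le_def by blast
  obtain e where e: "(\<lambda>_::real^'n. 1) = (\<lambda>x. \<Sum>\<alpha>\<in>expts (2*k). e \<alpha> * mono \<alpha> x)"
    using poly_deg_le_const unfolding poly_deg_le_def by blast
  have "(\<Sum>\<alpha>\<in>expts (2*k). e \<alpha> * mono \<alpha> x) = 1" for x :: "real^'n"
    using fun_cong[OF e, of x] by simp
  then have "(\<lambda>x. p x - a) = (\<lambda>x. \<Sum>\<alpha>\<in>expts (2*k). (c \<alpha> - a * e \<alpha>) * mono \<alpha> x)"
    by (simp add: c left_diff_distrib sum_subtractf mult.assoc sum_distrib_left[symmetric])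
  from riesz_eq[OF this] riesz_eq[OF c] riesz_eq[OF e] show ?thesis
    by (simp add: left_diff_distrib sum_subtractf mult.assoc sum_distrib_left[symmetric])
qed

section \<open>Quadratic modules and positivity on boxes\<close>

lemma sos_square: "is_poly q \<Longrightarrow> sos (\<lambda>x. (q x)\<^sup>2)"
  unfolding sos_def by (intro exI[of _ "[q]"]) simp

lemma sos_0: "sos (\<lambda>x. 0)"
  unfolding sos_def by (intro exI[of _ "[]"]) simp

lemma sos_const: "c \<ge> 0 \<Longrightarrow> sos (\<lambda>x. c)"
  using sos_square[of "\<lambda>x. sqrt c"] by (simp add: is_poly_const)

lemma sos_add:
  assumes "sos \<sigma>" "sos \<tau>"
  shows "sos (\<lambda>x. \<sigma> x + \<tau> x)"
proof -
  obtain qs rs where "\<forall>q\<in>set qs. is_poly q" "\<forall>q\<in>set rs. is_poly q"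
    and "\<sigma> = (\<lambda>x. \<Sum>q\<leftarrow>qs. (q x)^2)" "\<tau> = (\<lambda>x. \<Sum>q\<leftarrow>rs. (q x)^2)"
    using assms unfolding sos_def by blast
  then show ?thesis
    unfolding sos_def by (intro exI[of _ "qs @ rs"]) auto
qed

lemma sos_square_mult:
  assumes "is_poly p" "sos \<sigma>"
  shows "sos (\<lambda>x. (p x)\<^sup>2 * \<sigma> x)"
proof -
  obtain qs where "\<forall>q\<in>set qs. is_poly q" "\<sigma> = (\<lambda>x. \<Sum>q\<leftarrow>qs. (q x)^2)"
    using assms unfolding sos_def by blast
  then show ?thesis
    unfolding sos_def using assms(1)
    by (intro exI[of _ "map (\<lambda>q x. p x * q x) qs"])
      (auto simp: o_def power_mult_distrib sum_list_const_mult intro: is_poly_mult)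
qed

lemma sos_induct [consumes 1, case_names zero square_add]:
  assumes "sos \<sigma>" "P (\<lambda>x. 0)"
    and step: "\<And>q \<sigma>. is_poly q \<Longrightarrow> sos \<sigma> \<Longrightarrow> P \<sigma> \<Longrightarrow> P (\<lambda>x. (q x)\<^sup>2 + \<sigma> x)"
  shows "P \<sigma>"
proof -
  obtain qs where "\<forall>q\<in>set qs. is_poly q" and \<sigma>: "\<sigma> = (\<lambda>x. \<Sum>q\<leftarrow>qs. (q x)^2)"
    using assms unfolding sos_def by blast
  then have "P (\<lambda>x. \<Sum>q\<leftarrow>qs. (q x)^2) \<and> sos (\<lambda>x. \<Sum>q\<leftarrow>qs. (q x)^2)"
  proof (induction qs arbitrary: \<sigma>)
    case Nil
    then show ?case using assms sos_0 by simp
  next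
    case (Cons q qs)
    then have "P (\<lambda>x. \<Sum>q\<leftarrow>qs. (q x)^2)" "sos (\<lambda>x. \<Sum>q\<leftarrow>qs. (q x)^2)" "is_poly q"
      by auto
    then show ?case
      by (auto intro: step sos_add sos_square)
  qed
  then show ?thesis using \<sigma> by simp
qed

lemma sos_mult:
  assumes "sos \<sigma>" "sos \<tau>"
  shows "sos (\<lambda>x. \<sigma> x * \<tau> x)"
  using assms(1)
proof (induction rule: sos_induct)
  case zero
  then show ?case by (simp add: sos_0)
next
  case (square_add q \<sigma>)
  then show ?case
    by (simp add: distrib_right sos_add sos_square_mult assms(2))
qed

lemma sos_nonneg: "sos \<sigma> \<Longrightarrow> \<sigma> x \<ge> 0"
  by (induction rule: sos_induct) auto

lemma sos_is_poly: "sos \<sigma> \<Longrightarrow> is_poly \<sigma>"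
  by (induction rule: sos_induct) (auto intro: is_poly_intros)

lemma sos_sum: "(\<And>i. i \<in> I \<Longrightarrow> sos (\<sigma> i)) \<Longrightarrow> sos (\<lambda>x. \<Sum>i\<in>I. \<sigma> i x)"
  by (induction I rule: infinite_finite_induct) (auto intro: sos_0 sos_add)

lemma is_poly_quad:
  assumes "polymat G" "polyvec v"
  shows "is_poly (\<lambda>x. v x \<bullet> (G x *v v x))"
  using assms unfolding polymat_def polyvec_def inner_vec_def matrix_vector_mult_def
  by (auto intro!: is_poly_intros)

lemma QM_sos: "sos \<sigma> \<Longrightarrow> QM G \<sigma>"
  unfolding QM_def by (intro exI[of _ \<sigma>] exI[of _ "[]"]) simp

lemma QM_quad: "polyvec v \<Longrightarrow> QM G (\<lambda>x. v x \<bullet> (G x *v v x))"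
  unfolding QM_def by (intro exI[of _ "\<lambda>x. 0"] exI[of _ "[v]"]) (simp add: sos_0)

lemma QM_add:
  assumes "QM G p" "QM G q"
  shows "QM G (\<lambda>x. p x + q x)"
proof -
  obtain \<sigma> \<tau> vs ws where "sos \<sigma>" "sos \<tau>" "\<forall>v\<in>set vs. polyvec v" "\<forall>v\<in>set ws. polyvec v"
    "p = (\<lambda>x. \<sigma> x + (\<Sum>v\<leftarrow>vs. v x \<bullet> (G x *v v x)))"
    "q = (\<lambda>x. \<tau> x + (\<Sum>v\<leftarrow>ws. v x \<bullet> (G x *v v x)))"
    using assms unfolding QM_def by blast
  then show ?thesis
    unfolding QM_def by (intro exI[of _ "\<lambda>x. \<sigma> x + \<tau> x"] exI[of _ "vs @ ws"]) (auto simp: sos_add)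
qed

lemma QM_square_mult:
  assumes "is_poly p" "QM G q"
  shows "QM G (\<lambda>x. (p x)\<^sup>2 * q x)"
proof -
  obtain \<sigma> vs where *: "sos \<sigma>" "\<forall>v\<in>set vs. polyvec v"
    and q: "q = (\<lambda>x. \<sigma> x + (\<Sum>v\<leftarrow>vs. v x \<bullet> (G x *v v x)))"
    using assms unfolding QM_def by blast
  have "(p x *\<^sub>R v x) \<bullet> (G x *v (p x *\<^sub>R v x)) = (p x)\<^sup>2 * (v x \<bullet> (G x *v v x))" for v and x
    by (simp add: matrix_vector_mult_scaleR power2_eq_square)
  then show ?thesis
    unfolding QM_def q using * assms(1)
    by (intro exI[of _ "\<lambda>x. (p x)\<^sup>2 * \<sigma> x"] exI[of _ "map (\<lambda>v x. p x *\<^sub>R v x) vs"])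
      (auto simp: sos_square_mult o_def distrib_left sum_list_const_mult polyvec_def intro: is_poly_mult)
qed

lemma QM_sos_mult:
  assumes "sos \<sigma>" "QM G p"
  shows "QM G (\<lambda>x. \<sigma> x * p x)"
  using assms(1)
proof (induction rule: sos_induct)
  case zero
  then show ?case by (simp add: QM_sos sos_0)
next
  case (square_add q \<sigma>)
  then show ?case
    by (simp add: distrib_right QM_add QM_square_mult assms(2))
qed

lemma QM_cmult: "c \<ge> 0 \<Longrightarrow> QM G p \<Longrightarrow> QM G (\<lambda>x. c * p x)"
  by (rule QM_sos_mult[OF sos_const])

lemma QM_sum: "(\<And>i. i \<in> I \<Longrightarrow> QM G (p i)) \<Longrightarrow> QM G (\<lambda>x. \<Sum>i\<in>I. p i x)"
  by (induction I rule: infinite_finite_induct) (auto intro: QM_sos sos_0 QM_add)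

lemma QM_is_poly:
  assumes "polymat G" "QM G p"
  shows "is_poly p"
proof -
  obtain \<sigma> vs where *: "sos \<sigma>" "\<forall>v\<in>set vs. polyvec v"
    and p: "p = (\<lambda>x. \<sigma> x + (\<Sum>v\<leftarrow>vs. v x \<bullet> (G x *v v x)))"
    using assms unfolding QM_def by blast
  show ?thesis
    unfolding p using assms(1) * by (intro is_poly_add is_poly_sum_list is_poly_quad sos_is_poly) auto
qed

lemma QM_nonneg:
  assumes "QM G p" "x \<in> feasible G"
  shows "p x \<ge> 0"
proof -
  obtain \<sigma> vs where *: "sos \<sigma>" and p: "p = (\<lambda>x. \<sigma> x + (\<Sum>v\<leftarrow>vs. v x \<bullet> (G x *v v x)))"
    using assms unfolding QM_def by blast
  have "0 \<le> (\<Sum>v\<leftarrow>vs. v x \<bullet> (G x *v v x))"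
    using assms(2) by (intro sum_list_nonneg) (auto simp: feasible_def psd_def)
  then show ?thesis
    using sos_nonneg[OF *, of x] by (simp add: p)
qed

lemma closed_feasible:
  assumes "polymat G" "\<forall>x. symmat (G x)"
  shows "closed (feasible G)"
proof -
  have "feasible G = (\<Inter>v. {x. v \<bullet> (G x *v v) \<ge> 0})"
    using assms(2) by (auto simp: feasible_def psd_def)
  moreover have "closed {x. v \<bullet> (G x *v v) \<ge> 0}" for v
    by (intro closed_Collect_le continuous_on_const is_poly_continuous is_poly_quad assms)
      (auto simp: polyvec_def is_poly_const)
  ultimately show ?thesis by auto
qed

text \<open>The certificate in the Archimedean condition is nonnegative at feasible points and so
  bounds their norm by \<open>sqrt R\<close>.\<close>

lemma compact_feasible:
  assumes "polymat G" "\<forall>x. symmat (G x)" "archimedean G"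
  shows "compact (feasible G)"
proof -
  obtain R where "QM G (\<lambda>x. R - (norm x)\<^sup>2)"
    using assms unfolding archimedean_def by blast
  then have "(norm x)\<^sup>2 \<le> R" if "x \<in> feasible G" for x
    using QM_nonneg that by fastforce
  then have "norm x \<le> sqrt R" if "x \<in> feasible G" for x
    using that real_le_rsqrt by blast
  then have "bounded (feasible G)"
    unfolding bounded_iff by blast
  with closed_feasible[OF assms(1,2)] show ?thesis
    by (simp add: compact_eq_bounded_closed)
qed

section \<open>Bernstein expansions with nonnegative coefficients\<close>

lemma bernstein_power:
  fixes y :: real
  assumes "j \<le> d"
  shows "y ^ j = (\<Sum>k\<le>d. real (k choose j) / real (d choose j) * (real (d choose k) * y ^ k * (1 - y) ^ (d - k)))"
proof -
  have "(\<Sum>k\<le>d. real (k choose j) * (real (d choose k) * y ^ k * (1 - y) ^ (d - k)))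
      = (\<Sum>k\<in>{j..d}. real (k choose j) * (real (d choose k) * y ^ k * (1 - y) ^ (d - k)))"
    by (rule sum.mono_neutral_right) auto
  also have "\<dots> = (\<Sum>i\<le>d - j. real ((i + j) choose j) * (real (d choose (i + j)) * y ^ (i + j) * (1 - y) ^ (d - (i + j))))"
    by (rule sum.reindex_bij_witness[of _ "\<lambda>i. i + j" "\<lambda>k. k - j"]) (use assms in auto)
  \<comment> \<open>The identity for \<open>(d choose k) * (k choose j)\<close> turns the sum into
    \<open>y^j\<close> times the binomial expansion of \<open>(y + (1 - y))^(d - j)\<close>, which
    is 1.\<close>
  also have "\<dots> = (\<Sum>i\<le>d - j. real (d choose j) * y ^ j * (real ((d - j) choose i) * y ^ i * (1 - y) ^ (d - j - i)))"
  proof (rule sum.cong[OF refl])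
    fix i assume "i \<in> {..d - j}"
    then have "(d choose (i + j)) * ((i + j) choose j) = (d choose j) * ((d - j) choose i)"
      using choose_mult[of j "i + j" d] assms by simp
    then have "real (d choose (i + j)) * real ((i + j) choose j) = real (d choose j) * real ((d - j) choose i)"
      by (metis of_nat_mult)
    moreover have "d - (i + j) = d - j - i" by simp
    ultimately show "real ((i + j) choose j) * (real (d choose (i + j)) * y ^ (i + j) * (1 - y) ^ (d - (i + j)))
      = real (d choose j) * y ^ j * (real ((d - j) choose i) * y ^ i * (1 - y) ^ (d - j - i))"
      by (simp add: power_add mult_ac)
  qed
  also have "\<dots> = real (d choose j) * y ^ j * (y + (1 - y)) ^ (d - j)"
    by (simp only: sum_distrib_left[symmetric] binomial_ring)
  finally have "real (d choose j) * y ^ j = (\<Sum>k\<le>d. real (k choose j) * (real (d choose k) * y ^ k * (1 - y) ^ (d - k)))"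
    by simp
  moreover have "real (d choose j) > 0"
    using assms by (simp add: zero_less_binomial)
  ultimately have "y ^ j = (\<Sum>k\<le>d. real (k choose j) * (real (d choose k) * y ^ k * (1 - y) ^ (d - k))) / real (d choose j)"
    by (simp add: field_simps)
  then show ?thesis
    by (simp add: sum_divide_distrib)
qed

lemma binomial_ratio_prod:
  assumes "j \<le> d"
  shows "real (k choose j) / real (d choose j) = (\<Prod>l<j. (real k - real l) / (real d - real l))"
proof -
  have *: "fact j * real (m choose j) = (\<Prod>l<j. real m - real l)" for m
    by (simp add: binomial_gbinomial gbinomial_prod_rev atLeast0LessThan)
  have "real (k choose j) / real (d choose j) = (fact j * real (k choose j)) / (fact j * real (d choose j))"
    by simp
  then show ?thesis
    by (simp add: * prod_dividef)
qed

text \<open>The ratio is a product of factors \<open>(k - l) / (d - l)\<close>. The assumption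
  \<open>2 * j \<le> d\<close> gives \<open>d - l \<ge> d / 2\<close>, which keeps each factor in
  \<open>[-1, 1]\<close> and within \<open>2 j / d\<close> of \<open>k / d\<close>; for factors of
  modulus at most 1 the errors of a product simply add up.\<close>

lemma binomial_ratio_approx:
  assumes "2 * j \<le> d" "k \<le> d" "0 < d"
  shows "\<bar>real (k choose j) / real (d choose j)\<bar> \<le> 1"
    and "\<bar>real (k choose j) / real (d choose j) - (real k / real d) ^ j\<bar> \<le> 2 * (real j)\<^sup>2 / real d"
proof -
  have factor: "\<bar>(real k - real l) / (real d - real l)\<bar> \<le> 1" if "l < j" for l
    using that assms by (simp add: abs_if field_simps)
  show "\<bar>real (k choose j) / real (d choose j)\<bar> \<le> 1"
    using assms factor by (subst binomial_ratio_prod) (auto simp: abs_prod intro!: prod_le_1)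
  have "\<bar>(real k - real l) / (real d - real l) - real k / real d\<bar> \<le> 2 * real j / real d" if "l < j" for l
  proof -
    have pos: "real d - real l > 0" "real d > 0" using that assms by auto
    have "(real k - real l) / (real d - real l) - real k / real d = real l * (real k - real d) / (real d * (real d - real l))"
      using pos by (simp add: field_simps)
    then have "\<bar>(real k - real l) / (real d - real l) - real k / real d\<bar> = real l * (real d - real k) / (real d * (real d - real l))"
      using pos assms by (simp add: abs_mult)
    also have "\<dots> \<le> real j * real d / (real d * (real d / 2))"
      using that assms pos by (intro frac_le mult_mono) auto
    finally show ?thesis using pos by (simp add: mult.commute)
  qed
  then have "(\<Sum>l<j. \<bar>(real k - real l) / (real d - real l) - real k / real d\<bar>) \<le> (\<Sum>l<j. 2 * real j / real d)"
    by (intro sum_mono) auto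
  moreover have "norm ((\<Prod>l<j. (real k - real l) / (real d - real l)) - (\<Prod>l<j. real k / real d))
      \<le> (\<Sum>l<j. norm ((real k - real l) / (real d - real l) - real k / real d))"
    using factor assms by (intro norm_prod_diff) auto
  ultimately show "\<bar>real (k choose j) / real (d choose j) - (real k / real d) ^ j\<bar> \<le> 2 * (real j)\<^sup>2 / real d"
    using assms by (subst binomial_ratio_prod) (auto simp: power2_eq_square mult_ac)
qed

lemma prod_binomial_ratio_approx:
  fixes \<alpha> \<kappa> :: "'n::finite \<Rightarrow> nat"
  assumes "\<alpha> \<in> expts D" "2 * D \<le> d" "\<And>i. \<kappa> i \<le> d" "0 < d"
  shows "\<bar>(\<Prod>i\<in>UNIV. real (\<kappa> i choose \<alpha> i) / real (d choose \<alpha> i)) - mono \<alpha> (\<chi> i. real (\<kappa> i) / real d)\<bar>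
      \<le> 2 * real CARD('n) * (real D)\<^sup>2 / real d"
proof -
  have le: "\<alpha> i \<le> D" for i
    using assms(1) member_le_sum[of i UNIV \<alpha>] by (simp add: expts_def)
  have "norm ((\<Prod>i\<in>UNIV. real (\<kappa> i choose \<alpha> i) / real (d choose \<alpha> i)) - (\<Prod>i\<in>UNIV. (real (\<kappa> i) / real d) ^ \<alpha> i))
    \<le> (\<Sum>i\<in>UNIV. norm (real (\<kappa> i choose \<alpha> i) / real (d choose \<alpha> i) - (real (\<kappa> i) / real d) ^ \<alpha> i))"
  proof (rule norm_prod_diff)
    show "norm (real (\<kappa> i choose \<alpha> i) / real (d choose \<alpha> i)) \<le> 1" for i
      using binomial_ratio_approx(1)[of "\<alpha> i" d "\<kappa> i"] le[of i] assms by simp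
    show "norm ((real (\<kappa> i) / real d) ^ \<alpha> i) \<le> 1" for i
      using assms by (simp add: power_abs power_le_one)
  qed
  also have "\<dots> \<le> (\<Sum>i\<in>(UNIV::'n set). 2 * (real D)\<^sup>2 / real d)"
  proof (rule sum_mono)
    fix i
    have "2 * (real (\<alpha> i))\<^sup>2 / real d \<le> 2 * (real D)\<^sup>2 / real d"
      using le[of i] by (intro divide_right_mono mult_left_mono power_mono) auto
    then show "norm (real (\<kappa> i choose \<alpha> i) / real (d choose \<alpha> i) - (real (\<kappa> i) / real d) ^ \<alpha> i) \<le> 2 * (real D)\<^sup>2 / real d"
      using binomial_ratio_approx(2)[of "\<alpha> i" d "\<kappa> i"] le[of i] assms by simp
  qed
  finally show ?thesis
    by (simp add: mono_def mult_ac)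
qed

text \<open>The Bernstein coefficients of degree \<open>d\<close> differ from the values of
  \<open>q\<close> on the grid \<open>\<kappa> / d\<close> by at most \<open>A / d\<close>. Those
  values are at least \<open>\<delta>\<close>, so \<open>d \<ge> A / \<delta>\<close> is
  enough.\<close>

lemma bernstein_nonneg_coefficients:
  fixes q :: "real^'n::finite \<Rightarrow> real"
  assumes "is_poly q" "\<delta> > 0" and pos: "\<And>y. (\<And>i. 0 \<le> y $ i \<and> y $ i \<le> 1) \<Longrightarrow> q y \<ge> \<delta>"
  obtains d b where "\<And>\<kappa>. \<kappa> \<in> PiE UNIV (\<lambda>_. {..d}) \<Longrightarrow> b \<kappa> \<ge> (0::real)"
    and "\<And>y. q y = (\<Sum>\<kappa>\<in>PiE UNIV (\<lambda>_. {..d}). b \<kappa> * (\<Prod>i\<in>UNIV. (y $ i) ^ \<kappa> i * (1 - y $ i) ^ (d - \<kappa> i)))"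
proof -
  obtain D c where q: "q = (\<lambda>x. \<Sum>\<alpha>\<in>expts D. c \<alpha> * mono \<alpha> x)"
    using assms(1) unfolding is_poly_def poly_deg_le_def by blast
  define A where "A = (\<Sum>\<alpha>\<in>expts D. \<bar>c \<alpha>\<bar>) * (2 * real CARD('n) * (real D)\<^sup>2)"
  obtain d :: nat where d: "2 * D \<le> d" "0 < d" "A / \<delta> \<le> d"
  proof -
    obtain d0 :: nat where "A / \<delta> \<le> d0" using real_arch_simple by blast
    then show ?thesis using that[of "2 * D + d0 + 1"] by simp
  qed
  \<comment> \<open>\<open>b0\<close> is the Bernstein coefficient proper; \<open>b\<close> also
    carries the binomial factors of the basis polynomials.\<close>
  define b0 where "b0 \<kappa> = (\<Sum>\<alpha>\<in>expts D. c \<alpha> * (\<Prod>i\<in>UNIV. real (\<kappa> i choose \<alpha> i) / real (d choose \<alpha> i)))" for \<kappa>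
  define b where "b \<kappa> = b0 \<kappa> * (\<Prod>i\<in>(UNIV::'n set). real (d choose \<kappa> i))" for \<kappa>
  have "b0 \<kappa> \<ge> 0" if "\<kappa> \<in> PiE UNIV (\<lambda>_. {..d})" for \<kappa>
  proof -
    have \<kappa>: "\<kappa> i \<le> d" for i using that by auto
    let ?y = "(\<chi> i. real (\<kappa> i) / real d) :: real^'n"
    have "\<bar>b0 \<kappa> - q ?y\<bar> = \<bar>\<Sum>\<alpha>\<in>expts D. c \<alpha> * ((\<Prod>i\<in>UNIV. real (\<kappa> i choose \<alpha> i) / real (d choose \<alpha> i)) - mono \<alpha> ?y)\<bar>"
      by (simp add: b0_def q right_diff_distrib sum_subtractf)
    also have "\<dots> \<le> (\<Sum>\<alpha>\<in>expts D. \<bar>c \<alpha>\<bar> * (2 * real CARD('n) * (real D)\<^sup>2 / real d))"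
      unfolding abs_mult[symmetric] using \<kappa> d
      by (intro order_trans[OF sum_abs] sum_mono, unfold abs_mult)
        (intro mult_left_mono prod_binomial_ratio_approx, auto)
    also have "\<dots> = A / real d"
      by (simp add: A_def sum_distrib_right sum_divide_distrib)
    also have "\<dots> \<le> \<delta>"
      using d assms(2) by (simp add: field_simps)
    finally have "\<bar>b0 \<kappa> - q ?y\<bar> \<le> \<delta>" .
    moreover have "q ?y \<ge> \<delta>"
      using \<kappa> d by (intro pos) auto
    ultimately show ?thesis by linarith
  qed
  then have b: "b \<kappa> \<ge> 0" if "\<kappa> \<in> PiE UNIV (\<lambda>_. {..d})" for \<kappa>
    using that unfolding b_def by (intro mult_nonneg_nonneg prod_nonneg) auto
  have "q y = (\<Sum>\<kappa>\<in>PiE UNIV (\<lambda>_. {..d}). b \<kappa> * (\<Prod>i\<in>UNIV. (y $ i) ^ \<kappa> i * (1 - y $ i) ^ (d - \<kappa> i)))" for y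
  proof -
    let ?r = "\<lambda>\<alpha> \<kappa>. (\<Prod>i\<in>(UNIV::'n set). real (\<kappa> i choose \<alpha> i) / real (d choose \<alpha> i))" and ?c = "\<lambda>\<kappa>. (\<Prod>i\<in>(UNIV::'n set). real (d choose \<kappa> i))" and ?b = "\<lambda>\<kappa>. (\<Prod>i\<in>UNIV. (y $ i) ^ \<kappa> i * (1 - y $ i) ^ (d - \<kappa> i))" and ?K = "PiE UNIV (\<lambda>_. {..d}) :: ('n \<Rightarrow> nat) set"
    have "mono \<alpha> y = (\<Sum>\<kappa>\<in>?K. ?r \<alpha> \<kappa> * (?c \<kappa> * ?b \<kappa>))"
      if "\<alpha> \<in> expts D" for \<alpha>
    proof -
      have le: "\<alpha> i \<le> d" for i
        using that d member_le_sum[of i UNIV \<alpha>] by (simp add: expts_def)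
      have "mono \<alpha> y = (\<Prod>i\<in>UNIV. \<Sum>k\<le>d. real (k choose \<alpha> i) / real (d choose \<alpha> i) * (real (d choose k) * (y $ i) ^ k * (1 - y $ i) ^ (d - k)))"
        unfolding mono_def by (intro prod.cong refl bernstein_power le)
      also have "\<dots> = (\<Sum>\<kappa>\<in>?K. \<Prod>i\<in>UNIV. real (\<kappa> i choose \<alpha> i) / real (d choose \<alpha> i) * (real (d choose \<kappa> i) * (y $ i) ^ \<kappa> i * (1 - y $ i) ^ (d - \<kappa> i)))"
        by (rule prod_sum_PiE) auto
      finally show ?thesis
        by (simp only: prod.distrib mult.assoc)
    qed
    then have "q y = (\<Sum>\<alpha>\<in>expts D. \<Sum>\<kappa>\<in>?K. c \<alpha> * (?r \<alpha> \<kappa> * (?c \<kappa> * ?b \<kappa>)))"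
      unfolding q sum_distrib_left[symmetric] by (intro sum.cong) auto
    also have "\<dots> = (\<Sum>\<kappa>\<in>?K. \<Sum>\<alpha>\<in>expts D. c \<alpha> * (?r \<alpha> \<kappa> * (?c \<kappa> * ?b \<kappa>)))"
      by (rule sum.swap)
    finally show ?thesis
      by (simp only: b_def b0_def sum_distrib_right mult.assoc)
  qed
  with b that show ?thesis by blast
qed

text \<open>After rescaling, the Bernstein basis on the box consists of products of the factors
  \<open>N + x $ i\<close> and \<open>N - x $ i\<close>. The class \<open>P\<close> is kept abstract
  because a quadratic module is in general not closed under products.\<close>

lemma poly_pos_on_box_in_cone:
  fixes p :: "real^'n::finite \<Rightarrow> real" and P :: "(real^'n \<Rightarrow> real) \<Rightarrow> bool"
  assumes "is_poly p" "N > 0" and pos: "\<And>x. (\<And>i. \<bar>x $ i\<bar> \<le> N) \<Longrightarrow> p x > 0"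
    and const: "\<And>c. c \<ge> 0 \<Longrightarrow> P (\<lambda>x. c)"
    and add: "\<And>p q. P p \<Longrightarrow> P q \<Longrightarrow> P (\<lambda>x. p x + q x)"
    and mult: "\<And>p q. P p \<Longrightarrow> P q \<Longrightarrow> P (\<lambda>x. p x * q x)"
    and lin: "\<And>i. P (\<lambda>x. N + x $ i)" "\<And>i. P (\<lambda>x. N - x $ i)"
  shows "P p"
proof -
  define T where "T y = (\<chi> i. 2 * N * y $ i - N)" for y :: "real^'n"
  define S where "S x = (\<chi> i. (x $ i + N) / (2 * N))" for x :: "real^'n"
  have TS: "T (S x) = x" for x
    using assms(2) by (simp add: T_def S_def vec_eq_iff)
  have poly: "is_poly (\<lambda>y. p (T y))"
  proof -
    obtain D c where q: "p = (\<lambda>x. \<Sum>\<alpha>\<in>expts D. c \<alpha> * mono \<alpha> x)"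
      using assms(1) unfolding is_poly_def poly_deg_le_def by blast
    show ?thesis
      unfolding q mono_def T_def by (simp, intro is_poly_intros)
  qed
  let ?B = "cbox (\<chi> i. 0) (\<chi> i. 1) :: (real^'n) set"
  have mem: "y \<in> ?B \<longleftrightarrow> (\<forall>i. 0 \<le> y $ i \<and> y $ i \<le> 1)" for y
    by (simp add: mem_box_cart)
  have posT: "p (T y) > 0" if "y \<in> ?B" for y
  proof (rule pos)
    fix i
    have "2 * N * y $ i \<le> 2 * N * 1" "2 * N * y $ i \<ge> 2 * N * 0"
      using that mem assms(2) by (auto intro!: mult_left_mono)
    then show "\<bar>T y $ i\<bar> \<le> N"
      by (simp add: T_def abs_le_iff)
  qed
  have "?B \<noteq> {}"
    using mem[of "\<chi> i. 0"] by auto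
  then obtain y0 where y0: "y0 \<in> ?B" "\<forall>y\<in>?B. p (T y0) \<le> p (T y)"
    using continuous_attains_inf[OF compact_cbox _ is_poly_continuous[OF poly]] by blast
  have "p (T y0) \<le> p (T y)" if "\<And>i. 0 \<le> y $ i \<and> y $ i \<le> 1" for y
    using y0(2) mem that by blast
  then show ?thesis
  proof (rule bernstein_nonneg_coefficients[OF poly posT[OF y0(1)]])
    fix d b
    assume b: "\<And>\<kappa>. \<kappa> \<in> PiE UNIV (\<lambda>_. {..d}) \<Longrightarrow> b \<kappa> \<ge> (0::real)"
      and rep: "\<And>y. p (T y) = (\<Sum>\<kappa>\<in>PiE UNIV (\<lambda>_. {..d}). b \<kappa> * (\<Prod>i\<in>UNIV. (y $ i) ^ \<kappa> i * (1 - y $ i) ^ (d - \<kappa> i)))"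
    have P_sum: "P (\<lambda>x. \<Sum>i\<in>I. h i x)" if "\<And>i. i \<in> I \<Longrightarrow> P (h i)" for I :: "('n \<Rightarrow> nat) set" and h
      using that by (induction I rule: infinite_finite_induct) (auto intro: const add)
    have P_prod: "P (\<lambda>x. \<Prod>i\<in>I. h i x)" if "\<And>i. i \<in> I \<Longrightarrow> P (h i)" for I :: "'n set" and h
      using that by (induction I rule: infinite_finite_induct) (auto intro: const mult)
    have P_power: "P (\<lambda>x. h x ^ k)" if "P h" for h k
      using that by (induction k) (auto intro: const mult)
    have "0 \<le> 1 / (2 * N)" using assms(2) by simp
    then have "P (\<lambda>x. 1 / (2 * N) * (N + x $ i))" "P (\<lambda>x. 1 / (2 * N) * (N - x $ i))" for i
      by (rule mult[OF const lin(1)], rule mult[OF const lin(2)])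
    moreover have "1 / (2 * N) * (N + x $ i) = S x $ i" "1 / (2 * N) * (N - x $ i) = 1 - S x $ i" for x i
      using assms(2) by (simp_all add: S_def field_simps)
    ultimately have "P (\<lambda>x. S x $ i)" "P (\<lambda>x. 1 - S x $ i)" for i
      by simp_all
    then have "P (\<lambda>x. \<Sum>\<kappa>\<in>PiE UNIV (\<lambda>_. {..d}). b \<kappa> * (\<Prod>i\<in>UNIV. (S x $ i) ^ \<kappa> i * (1 - S x $ i) ^ (d - \<kappa> i)))"
      using b by (intro P_sum mult const P_prod P_power)
    then show ?thesis
      by (simp add: rep[symmetric] TS)
  qed
qed

text \<open>With a single generator products are harmless: expressions
  \<open>\<sigma> + \<tau> (N^2 - |x|^2)\<close> multiply because the generator squared is a square.
  The box factors have this form, since \<open>2 N (N + s x_i)\<close> equals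
  \<open>(N + s x_i)^2\<close> plus the other \<open>x_j^2\<close> plus \<open>N^2 - |x|^2\<close>
  when \<open>s^2 = 1\<close>.\<close>

lemma pos_on_box_QM:
  fixes p :: "real^'n::finite \<Rightarrow> real"
  assumes "is_poly p" "N > 0" "\<And>x. (\<And>i. \<bar>x $ i\<bar> \<le> N) \<Longrightarrow> p x > 0"
    and QM: "QM G (\<lambda>x. N\<^sup>2 - (norm x)\<^sup>2)"
  shows "QM G p"
proof -
  define P :: "(real^'n \<Rightarrow> real) \<Rightarrow> bool"
    where "P q \<longleftrightarrow> (\<exists>\<sigma> \<tau>. sos \<sigma> \<and> sos \<tau> \<and> q = (\<lambda>x. \<sigma> x + \<tau> x * (N\<^sup>2 - (norm x)\<^sup>2)))" for q
  have sq: "sos (\<lambda>x::real^'n. (N\<^sup>2 - (norm x)\<^sup>2)\<^sup>2)"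
    using is_poly_norm_diff_sq[of 0] by (auto intro!: sos_square is_poly_diff is_poly_const)
  have half: "P (\<lambda>x. N + s * x $ i)" if "s\<^sup>2 = 1" for s i
  proof -
    have "N + s * x $ i = ((N + s * x $ i)\<^sup>2 + (\<Sum>j\<in>UNIV - {i}. (x $ j)\<^sup>2)) * (1 / (2 * N))
        + 1 / (2 * N) * (N\<^sup>2 - (norm x)\<^sup>2)" for x :: "real^'n"
    proof -
      have "(norm x)\<^sup>2 = (x $ i)\<^sup>2 + (\<Sum>j\<in>UNIV - {i}. (x $ j)\<^sup>2)"
        by (simp add: norm_eq_sqrt_inner inner_vec_def sum.remove power2_eq_square sum_nonneg)
      moreover have "(N + s * x $ i)\<^sup>2 = N\<^sup>2 + 2 * N * (s * x $ i) + (x $ i)\<^sup>2"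
        using that by (simp add: power2_sum power_mult_distrib)
      ultimately show ?thesis
        using assms(2) by (simp add: field_simps power2_eq_square)
    qed
    moreover have "sos (\<lambda>x::real^'n. ((N + s * x $ i)\<^sup>2 + (\<Sum>j\<in>UNIV - {i}. (x $ j)\<^sup>2)) * (1 / (2 * N)))"
      using assms(2) by (intro sos_mult sos_add sos_sum sos_square sos_const is_poly_intros) simp
    moreover have "sos (\<lambda>x::real^'n. 1 / (2 * N))"
      using assms(2) by (intro sos_const) simp
    ultimately show ?thesis
      unfolding P_def by blast
  qed
  have "P p"
  proof (rule poly_pos_on_box_in_cone[OF assms(1-3)])
    show "P (\<lambda>x. c)" if "c \<ge> 0" for c
      unfolding P_def using that by (rule_tac x = "\<lambda>x. c" in exI, rule_tac x = "\<lambda>x. 0" in exI) (auto simp: sos_const sos_0)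
    show "P (\<lambda>x. N + x $ i)" "P (\<lambda>x. N - x $ i)" for i
      using half[of 1 i] half[of "-1" i] by simp_all
    fix p q
    assume "P p" "P q"
    then obtain \<sigma> \<tau> \<sigma>' \<tau>' where *: "sos \<sigma>" "sos \<tau>" "sos \<sigma>'" "sos \<tau>'"
      "p = (\<lambda>x. \<sigma> x + \<tau> x * (N\<^sup>2 - (norm x)\<^sup>2))" "q = (\<lambda>x. \<sigma>' x + \<tau>' x * (N\<^sup>2 - (norm x)\<^sup>2))"
      unfolding P_def by blast
    show "P (\<lambda>x. p x + q x)"
      unfolding P_def by (rule exI[of _ "\<lambda>x. \<sigma> x + \<sigma>' x"], rule exI[of _ "\<lambda>x. \<tau> x + \<tau>' x"])
        (auto simp: * sos_add algebra_simps)
    show "P (\<lambda>x. p x * q x)"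
      unfolding P_def
      by (rule exI[of _ "\<lambda>x. \<sigma> x * \<sigma>' x + \<tau> x * \<tau>' x * (N\<^sup>2 - (norm x)\<^sup>2)\<^sup>2"],
          rule exI[of _ "\<lambda>x. \<sigma> x * \<tau>' x + \<tau> x * \<sigma>' x"], intro conjI sos_add sos_mult sq *(1-4))
        (auto simp: *(5,6) algebra_simps power2_eq_square)
  qed (use assms in auto)
  then obtain \<sigma> \<tau> where "sos \<sigma>" "sos \<tau>" "p = (\<lambda>x. \<sigma> x + \<tau> x * (N\<^sup>2 - (norm x)\<^sup>2))"
    unfolding P_def by blast
  then show ?thesis
    using QM_add[OF QM_sos QM_sos_mult[OF _ QM]] by blast
qed

section \<open>Putinar's theorem\<close>

text \<open>Bernoulli's inequality replaces \<open>1 + m s\<close> by \<open>(1 + s)^m\<close>, and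
  \<open>(1 + s)^m (1 - s)^m = (1 - s^2)^m \<le> 1\<close>.\<close>

lemma mult_power_one_minus_le:
  fixes s :: real
  assumes "0 \<le> s" "s \<le> 1" "m > 0"
  shows "s * (1 - s) ^ m \<le> 1 / m"
proof -
  have "(1 + real m * s) * (1 - s) ^ m \<le> (1 + s) ^ m * (1 - s) ^ m"
    using Bernoulli_inequality[of s m] assms by (intro mult_right_mono) auto
  also have "\<dots> = (1 - s\<^sup>2) ^ m"
    by (simp add: power_mult_distrib[symmetric] algebra_simps power2_eq_square)
  also have "\<dots> \<le> 1"
    using assms by (intro power_le_one) (auto simp: power_le_one)
  finally have "real m * s * (1 - s) ^ m \<le> 1 - (1 - s) ^ m"
    by (simp add: algebra_simps)
  also have "\<dots> \<le> 1"
    using assms by simp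
  finally show ?thesis
    using assms by (simp add: field_simps)
qed

text \<open>Where \<open>g \<ge> 0\<close> the square weight leaves at most \<open>c / k\<close>;
  where \<open>g < 0\<close> the weight is at least 1 and only makes the product more negative. Up
  to \<open>c / k\<close>, a square multiple of \<open>g\<close> thus lies below the negative part
  of \<open>g\<close>.\<close>

lemma damped_constraint_le:
  fixes g c :: real
  assumes "\<bar>g\<bar> \<le> c" "c > 0" "k > 0"
  shows "((1 - g / c) ^ k)\<^sup>2 * g \<le> min 0 g + c / k"
proof (cases "g \<ge> 0")
  case True
  have "g / c * (1 - g / c) ^ (2 * k) \<le> 1 / real (2 * k)"
    using assms True by (intro mult_power_one_minus_le) auto
  also have "\<dots> \<le> 1 / real k"
    using assms by (intro divide_left_mono) auto
  finally have "(1 - g / c) ^ (2 * k) * g \<le> c / k"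
    using assms by (simp add: field_simps)
  then show ?thesis
    using True by (simp add: power_mult[symmetric] mult.commute)
next
  case False
  have "((1 - g / c) ^ k)\<^sup>2 \<ge> 1"
    using assms False by (intro one_le_power) (simp add: field_simps)
  then have "((1 - g / c) ^ k)\<^sup>2 * g \<le> 1 * g"
    using False by (intro mult_right_mono_neg) auto
  moreover have "c / k \<ge> 0" using assms by simp
  moreover have "min 0 g = g" using False by simp
  ultimately show ?thesis by linarith
qed

text \<open>On the compact set where \<open>p \<le> 0\<close> the penalty \<open>\<mu>\<close> is
  bounded away from 0, so a large multiple of it outweighs the minimum of \<open>p\<close>. The
  lemma serves constraint violation in Putinar's theorem, feasible directions, and the passage from
  the critical cone to all directions.\<close>

lemma exact_penalty:
  fixes p \<mu> :: "'a::metric_space \<Rightarrow> real"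
  assumes "compact K" "continuous_on K p" "continuous_on K \<mu>"
    and \<mu>: "\<And>x. x \<in> K \<Longrightarrow> \<mu> x \<ge> 0" "\<And>x. x \<in> K \<Longrightarrow> \<mu> x = 0 \<Longrightarrow> p x > 0"
  obtains l \<delta> where "l \<ge> 0" "\<delta> > 0" "\<And>x. x \<in> K \<Longrightarrow> p x + l * \<mu> x \<ge> \<delta>"
proof (cases "K = {}")
  case True
  then show ?thesis using that[of 0 1] by simp
next
  case False
  have "\<exists>l\<ge>0. \<forall>x\<in>K. p x + l * \<mu> x > 0"
  proof (cases "\<exists>x\<in>K. p x \<le> 0")
    case True
    define T where "T = {x \<in> K. p x \<le> 0}"
    have "closedin (top_of_set K) T"
      unfolding T_def using continuous_closedin_preimage[OF assms(2), of "{..0}"] by (simp add: vimage_def Int_def)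
    then have T: "compact T" "T \<noteq> {}" "T \<subseteq> K"
      using closedin_compact[OF assms(1)] True by (auto simp: T_def)
    obtain x1 where x1: "x1 \<in> T" "\<forall>x\<in>T. \<mu> x1 \<le> \<mu> x"
      using continuous_attains_inf[OF T(1,2) continuous_on_subset[OF assms(3) T(3)]] by blast
    obtain x2 where x2: "x2 \<in> K" "\<forall>x\<in>K. p x2 \<le> p x"
      using continuous_attains_inf[OF assms(1) False assms(2)] by blast
    have m: "\<mu> x1 > 0" using x1 \<mu>(1)[of x1] \<mu>(2)[of x1] by (force simp: T_def)
    define l where "l = (\<bar>p x2\<bar> + 1) / \<mu> x1"
    have l: "l \<ge> 0" using m by (simp add: l_def)
    have "p x + l * \<mu> x > 0" if x: "x \<in> K" for x
    proof (cases "x \<in> T")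
      case True
      have "l * \<mu> x1 \<le> l * \<mu> x" using x1 True l by (intro mult_left_mono) auto
      moreover have "l * \<mu> x1 = \<bar>p x2\<bar> + 1" using m by (simp add: l_def)
      moreover have "p x2 \<le> p x" using x2 x by blast
      ultimately show ?thesis by linarith
    next
      case False
      then show ?thesis using x l \<mu>(1)[OF x] by (simp add: T_def add_pos_nonneg)
    qed
    with l show ?thesis by blast
  next
    case False
    then show ?thesis by (intro exI[of _ 0]) (auto simp: not_le)
  qed
  then obtain l where l: "l \<ge> 0" "\<And>x. x \<in> K \<Longrightarrow> p x + l * \<mu> x > 0" by blast
  have "continuous_on K (\<lambda>x. p x + l * \<mu> x)"
    by (intro continuous_intros assms)
  then obtain x0 where "x0 \<in> K" "\<forall>x\<in>K. p x0 + l * \<mu> x0 \<le> p x + l * \<mu> x"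
    using continuous_attains_inf[OF assms(1) False] by blast
  with l that show ?thesis by blast
qed

text \<open>By compactness, finitely many scalar constraints \<open>v \<bullet> (G x *v v)\<close>
  with constant \<open>v\<close> already exclude the points of the box where
  \<open>p \<le> 0\<close>. Subtracting damped multiples of them from \<open>p\<close> leaves a
  polynomial positive on the whole box, for which the ball constraint suffices.\<close>

theorem putinar:
  fixes p :: "real^'n::finite \<Rightarrow> real" and G :: "real^'n \<Rightarrow> real^'m::finite^'m"
  assumes "polymat G" "\<forall>x. symmat (G x)" "archimedean G"
    and "is_poly p" and pos: "\<And>x. x \<in> feasible G \<Longrightarrow> p x > 0"
  shows "QM G p"
proof -
  obtain R where R: "R > 0" "QM G (\<lambda>x. R - (norm x)\<^sup>2)"
    using assms unfolding archimedean_def by blast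
  define N where "N = sqrt R"
  have N: "N > 0" "N\<^sup>2 = R"
    using R by (auto simp: N_def)
  let ?B = "cbox (\<chi> i. - N) (\<chi> i. N) :: (real^'n) set"
  have mem: "x \<in> ?B \<longleftrightarrow> (\<forall>i. \<bar>x $ i\<bar> \<le> N)" for x
    by (auto simp: mem_box_cart abs_le_iff minus_le_iff)
  define g where "g v x = v \<bullet> (G x *v v)" for v :: "real^'m" and x
  have polyvec_const: "polyvec (\<lambda>x::real^'n. v)" for v :: "real^'m"
    by (simp add: polyvec_def is_poly_const)
  have g_poly: "is_poly (g v)" for v
    unfolding g_def by (rule is_poly_quad[OF assms(1) polyvec_const])
  have g_QM: "QM G (g v)" for v
    unfolding g_def by (rule QM_quad[OF polyvec_const])
  define K where "K = {x \<in> ?B. p x \<le> 0}"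
  have "compact K"
  proof -
    have "closed {x. p x \<le> 0}"
      using assms(4) by (intro closed_Collect_le is_poly_continuous continuous_on_const)
    moreover have "K = ?B \<inter> {x. p x \<le> 0}" by (auto simp: K_def)
    ultimately show ?thesis by (simp add: compact_Int_closed)
  qed
  have "\<exists>v. g v x < 0" if "x \<in> K" for x
  proof -
    have "x \<notin> feasible G" using pos[of x] that by (force simp: K_def)
    then show ?thesis
      using assms(2) by (auto simp: feasible_def psd_def g_def not_le)
  qed
  then have "K \<subseteq> (\<Union>v. {x. g v x < 0})" by blast
  moreover have "open {x. g v x < 0}" for v
    using g_poly by (intro open_Collect_less is_poly_continuous continuous_on_const)
  ultimately obtain V where V: "finite V" "K \<subseteq> (\<Union>v\<in>V. {x. g v x < 0})"
    using compactE_image[OF \<open>compact K\<close>, of UNIV "\<lambda>v. {x. g v x < 0}"] by auto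
  define \<mu> where "\<mu> x = (\<Sum>v\<in>V. - min 0 (g v x))" for x
  have "\<exists>l \<delta>. l \<ge> 0 \<and> \<delta> > 0 \<and> (\<forall>x\<in>?B. p x + l * \<mu> x \<ge> \<delta>)"
  proof (rule exact_penalty[of ?B p \<mu>])
    show "continuous_on ?B \<mu>"
      unfolding \<mu>_def by (intro continuous_intros is_poly_continuous g_poly)
    show "\<mu> x \<ge> 0" for x
      unfolding \<mu>_def by (intro sum_nonneg) auto
    show "p x > 0" if x: "x \<in> ?B" "\<mu> x = 0" for x
    proof (rule ccontr)
      assume "\<not> p x > 0"
      then obtain v where v: "v \<in> V" "g v x < 0" using V x by (auto simp: K_def)
      have "- min 0 (g v x) \<le> \<mu> x"
        unfolding \<mu>_def using V v by (intro member_le_sum) auto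
      then show False using v x by linarith
    qed
  qed (use is_poly_continuous[OF assms(4)] in auto)
  then obtain l \<delta> where l: "l \<ge> 0" and \<delta>: "\<delta> > 0" "\<And>x. x \<in> ?B \<Longrightarrow> p x + l * \<mu> x \<ge> \<delta>"
    by blast
  have "\<exists>C. C > 0 \<and> (\<forall>x\<in>?B. \<bar>g v x\<bar> \<le> C)" for v
    using is_poly_bounded_on_compact[OF g_poly[of v] compact_cbox] by metis
  then obtain C where C: "\<And>v. C v > 0" "\<And>v x. x \<in> ?B \<Longrightarrow> \<bar>g v x\<bar> \<le> C v"
    by metis
  define A where "A = (\<Sum>v\<in>V. C v)"
  \<comment> \<open>The damping errors add up to \<open>A / k\<close>; multiplied by
    \<open>l\<close> they have to stay below the margin \<open>\<delta>\<close>.\<close>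
  obtain k :: nat where k: "k > 0" "l * A / \<delta> < k"
  proof -
    obtain k0 :: nat where "l * A / \<delta> < k0" using reals_Archimedean2 by blast
    then show ?thesis using that[of "k0 + 1"] by simp
  qed
  define h where "h x = (\<Sum>v\<in>V. ((1 - g v x / C v) ^ k)\<^sup>2 * g v x)" for x
  have h_QM: "QM G h"
    unfolding h_def by (intro QM_sum QM_square_mult g_QM is_poly_intros g_poly)
  have h_le: "h x \<le> A / k - \<mu> x" if "x \<in> ?B" for x
  proof -
    have "h x \<le> (\<Sum>v\<in>V. min 0 (g v x) + C v / k)"
      unfolding h_def using C that k by (intro sum_mono damped_constraint_le) auto
    then show ?thesis
      by (simp add: \<mu>_def A_def sum.distrib sum_divide_distrib sum_negf)
  qed
  have "QM G (\<lambda>x. p x - l * h x)"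
  proof (rule pos_on_box_QM[OF _ N(1)])
    show "is_poly (\<lambda>x. p x - l * h x)"
      by (intro is_poly_intros assms(4) QM_is_poly[OF assms(1) h_QM])
    show "QM G (\<lambda>x. N\<^sup>2 - (norm x)\<^sup>2)" using R N by simp
    fix x :: "real^'n" assume "\<And>i. \<bar>x $ i\<bar> \<le> N"
    then have x: "x \<in> ?B" using mem by blast
    have "l * h x \<le> l * (A / k - \<mu> x)"
      using h_le[OF x] l by (intro mult_left_mono) auto
    moreover have "l * A / k < \<delta>"
      using k \<delta>(1) by (simp add: field_simps)
    moreover have "\<delta> \<le> p x + l * \<mu> x" using \<delta>(2)[OF x] .
    ultimately show "p x - l * h x > 0" by (simp add: right_diff_distrib)
  qed
  from QM_add[OF this QM_cmult[OF l h_QM]] show ?thesis by simp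
qed

section \<open>Quadratic growth and bump polynomials\<close>

text \<open>The radius is fixed to 1 so that bounds can be combined without shrinking
  neighbourhoods; polynomials are bounded on the unit ball anyway. For \<open>k > 0\<close> the
  bound forces \<open>d u = 0\<close>.\<close>

definition ordO :: "real^'n::finite \<Rightarrow> nat \<Rightarrow> (real^'n \<Rightarrow> real) \<Rightarrow> bool" where
  "ordO u k d \<longleftrightarrow> (\<exists>C\<ge>0. \<forall>x. norm (x - u) \<le> 1 \<longrightarrow> \<bar>d x\<bar> \<le> C * norm (x - u) ^ k)"

lemma ordO_weaken:
  assumes "ordO u k d" "j \<le> k"
  shows "ordO u j d"
proof -
  obtain C where C: "C \<ge> 0" "\<And>x. norm (x - u) \<le> 1 \<Longrightarrow> \<bar>d x\<bar> \<le> C * norm (x - u) ^ k"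
    using assms unfolding ordO_def by blast
  have "\<bar>d x\<bar> \<le> C * norm (x - u) ^ j" if "norm (x - u) \<le> 1" for x
    using C(2)[OF that] power_decreasing[OF assms(2) norm_ge_zero that] C(1)
    by (meson mult_left_mono order_trans)
  with C show ?thesis unfolding ordO_def by blast
qed

lemma ordO_add:
  assumes "ordO u k d" "ordO u k e"
  shows "ordO u k (\<lambda>x. d x + e x)"
proof -
  obtain C C' where C: "C \<ge> 0" "\<And>x. norm (x - u) \<le> 1 \<Longrightarrow> \<bar>d x\<bar> \<le> C * norm (x - u) ^ k"
    "C' \<ge> 0" "\<And>x. norm (x - u) \<le> 1 \<Longrightarrow> \<bar>e x\<bar> \<le> C' * norm (x - u) ^ k"
    using assms unfolding ordO_def by blast
  have "\<bar>d x + e x\<bar> \<le> (C + C') * norm (x - u) ^ k" if "norm (x - u) \<le> 1" for x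
    using C(2)[OF that] C(4)[OF that] by (simp add: distrib_right)
  with C show ?thesis unfolding ordO_def by (meson add_nonneg_nonneg)
qed

lemma ordO_mult:
  assumes "ordO u j d" "ordO u k e"
  shows "ordO u (j + k) (\<lambda>x. d x * e x)"
proof -
  obtain C C' where C: "C \<ge> 0" "\<And>x. norm (x - u) \<le> 1 \<Longrightarrow> \<bar>d x\<bar> \<le> C * norm (x - u) ^ j"
    "C' \<ge> 0" "\<And>x. norm (x - u) \<le> 1 \<Longrightarrow> \<bar>e x\<bar> \<le> C' * norm (x - u) ^ k"
    using assms unfolding ordO_def by blast
  have "\<bar>d x * e x\<bar> \<le> (C * C') * norm (x - u) ^ (j + k)" if "norm (x - u) \<le> 1" for x
    using mult_mono[OF C(2)[OF that] C(4)[OF that]] C by (simp add: abs_mult power_add mult_ac)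
  with C show ?thesis unfolding ordO_def by (meson mult_nonneg_nonneg)
qed

lemma ordO_const: "ordO u 0 (\<lambda>x. c)"
  unfolding ordO_def by (intro exI[of _ "\<bar>c\<bar>"]) simp

lemma ordO_cmult: "ordO u k d \<Longrightarrow> ordO u k (\<lambda>x. c * d x)"
  using ordO_mult[OF ordO_const] by fastforce

lemma ordO_minus: "ordO u k d \<Longrightarrow> ordO u k (\<lambda>x. - d x)"
  using ordO_cmult[of u k d "-1"] by simp

lemma ordO_0: "ordO u k (\<lambda>x. 0)"
  unfolding ordO_def by (intro exI[of _ 0]) simp

lemma ordO_sum: "(\<And>i. i \<in> I \<Longrightarrow> ordO u k (d i)) \<Longrightarrow> ordO u k (\<lambda>x. \<Sum>i\<in>I. d i x)"
  by (induction I rule: infinite_finite_induct) (auto intro: ordO_0 ordO_add)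

lemma ordO_power: "ordO u 1 d \<Longrightarrow> ordO u k (\<lambda>x. d x ^ k)"
proof (induction k)
  case (Suc k)
  show ?case using ordO_mult[OF Suc.prems Suc.IH[OF Suc.prems]] by simp
qed (simp add: ordO_const)

lemma ordO_poly:
  assumes "is_poly d"
  shows "ordO u 0 d"
proof -
  obtain C where "C > 0" "\<And>x. x \<in> cball u 1 \<Longrightarrow> \<bar>d x\<bar> \<le> C"
    using is_poly_bounded_on_compact[OF assms compact_cball] by blast
  then show ?thesis
    unfolding ordO_def by (intro exI[of _ C]) (auto simp: dist_norm norm_minus_commute)
qed

lemma ordO_component: "ordO u 1 (\<lambda>x. x $ i - u $ i)"
  unfolding ordO_def by (intro exI[of _ 1]) (simp add: component_le_norm_cart flip: vector_minus_component)

lemma ordO_norm: "ordO u k (\<lambda>x. norm (x - u) ^ k)"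
  unfolding ordO_def by (intro exI[of _ 1]) auto

lemma ordO_poly_vanishing:
  assumes "is_poly d" "d u = 0"
  shows "ordO u 1 d"
proof -
  obtain q where q: "\<And>i. is_poly (q i)" "\<And>x. d x = d u + (\<Sum>i\<in>UNIV. (x $ i - u $ i) * q i x)"
    using is_poly_hadamard[OF assms(1)] by metis
  have "ordO u (1 + 0) (\<lambda>x. (x $ i - u $ i) * q i x)" for i
    by (intro ordO_mult ordO_component ordO_poly q)
  then have "ordO u 1 (\<lambda>x. \<Sum>i\<in>UNIV. (x $ i - u $ i) * q i x)"
    by (intro ordO_sum) simp
  moreover have "d = (\<lambda>x. \<Sum>i\<in>UNIV. (x $ i - u $ i) * q i x)"
    using q(2) assms(2) by (metis add_0)
  ultimately show ?thesis by metis
qed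

lemma ordO_absorb:
  assumes "ordO u 3 d" "c > 0"
  obtains r where "r > 0" "\<And>x. norm (x - u) < r \<Longrightarrow> \<bar>d x\<bar> \<le> c * (norm (x - u))\<^sup>2"
proof -
  obtain C where C: "C \<ge> 0" "\<And>x. norm (x - u) \<le> 1 \<Longrightarrow> \<bar>d x\<bar> \<le> C * norm (x - u) ^ 3"
    using assms unfolding ordO_def by blast
  show ?thesis
  proof (rule that[of "min 1 (c / (C + 1))"])
    show "min 1 (c / (C + 1)) > 0" using C assms by simp
    fix x assume x: "norm (x - u) < min 1 (c / (C + 1))"
    then have "norm (x - u) \<le> 1" "(C + 1) * norm (x - u) \<le> c"
      using C by (auto simp: field_simps)
    then have "C * norm (x - u) \<le> c" by (simp add: distrib_right) (metis add.commute add_increasing norm_ge_zero order_trans le_add_same_cancel1)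
    then have "C * norm (x - u) * (norm (x - u))\<^sup>2 \<le> c * (norm (x - u))\<^sup>2"
      by (intro mult_right_mono) auto
    with C(2)[OF \<open>norm (x - u) \<le> 1\<close>] show "\<bar>d x\<bar> \<le> c * (norm (x - u))\<^sup>2"
      by (simp add: power3_eq_cube power2_eq_square mult_ac)
  qed
qed

definition quad_growth :: "(real^'n::finite \<Rightarrow> real) \<Rightarrow> real^'n \<Rightarrow> bool" where
  "quad_growth F u \<longleftrightarrow> F u = 0 \<and>
     (\<exists>c>0. \<exists>r>0. \<forall>x. norm (x - u) < r \<longrightarrow> c * (norm (x - u))\<^sup>2 \<le> F x)"

lemma quad_growth_perturb:
  assumes "quad_growth F u" "ordO u 3 d"
  shows "quad_growth (\<lambda>x. F x + d x) u"
proof -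
  obtain c r where c: "F u = 0" "c > 0" "r > 0" "\<And>x. norm (x - u) < r \<Longrightarrow> c * (norm (x - u))\<^sup>2 \<le> F x"
    using assms unfolding quad_growth_def by blast
  obtain s where s: "s > 0" "\<And>x. norm (x - u) < s \<Longrightarrow> \<bar>d x\<bar> \<le> c / 2 * (norm (x - u))\<^sup>2"
    using ordO_absorb[OF assms(2), of "c / 2"] c by auto
  have "c / 2 * (norm (x - u))\<^sup>2 \<le> F x + d x" if "norm (x - u) < min r s" for x
    using c(4)[of x] s(2)[of x] that by (simp add: field_simps abs_le_iff)
  moreover have "F u + d u = 0"
    using s(2)[of u] s(1) c(1) by simp
  ultimately show ?thesis
    unfolding quad_growth_def using c s by (metis half_gt_zero min_less_iff_conj)
qed

lemma quad_growth_mult: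
  assumes "quad_growth F u" "isCont w u" "w u > 0"
  shows "quad_growth (\<lambda>x. w x * F x) u"
proof -
  obtain c r where c: "F u = 0" "c > 0" "r > 0" "\<And>x. norm (x - u) < r \<Longrightarrow> c * (norm (x - u))\<^sup>2 \<le> F x"
    using assms unfolding quad_growth_def by blast
  have "eventually (\<lambda>x. w x > w u / 2) (at u)"
    using assms by (intro order_tendstoD(1)[of _ "w u"]) (auto simp: isCont_def)
  then obtain s where s: "s > 0" "\<And>x. x \<noteq> u \<Longrightarrow> norm (x - u) < s \<Longrightarrow> w x > w u / 2"
    unfolding eventually_at by (auto simp: dist_norm)
  have "w u / 2 * c * (norm (x - u))\<^sup>2 \<le> w x * F x" if "norm (x - u) < min r s" for x
  proof (cases "x = u")
    case False
    then have "w u / 2 * (c * (norm (x - u))\<^sup>2) \<le> w x * F x"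
      using c(4)[of x] s(2)[of x] that assms(3) c(2) by (intro mult_mono) auto
    then show ?thesis by (simp add: mult_ac)
  qed (use c in simp)
  moreover have "w u / 2 * c > 0" using assms c by simp
  ultimately show ?thesis
    unfolding quad_growth_def using c s by (metis min_less_iff_conj mult_zero_right)
qed

lemma quad_growth_pos:
  assumes "quad_growth F u"
  obtains r where "r > 0" "\<And>x. x \<noteq> u \<Longrightarrow> norm (x - u) < r \<Longrightarrow> F x > 0"
proof -
  obtain c r where c: "c > 0" "r > 0" "\<And>x. norm (x - u) < r \<Longrightarrow> c * (norm (x - u))\<^sup>2 \<le> F x"
    using assms unfolding quad_growth_def by blast
  have "F x > 0" if "x \<noteq> u" "norm (x - u) < r" for x
  proof -
    have "0 < c * (norm (x - u))\<^sup>2" using c that by simp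
    then show ?thesis using c(3)[OF that(2)] by linarith
  qed
  with c that show ?thesis by blast
qed

lemma is_poly_isCont: "is_poly p \<Longrightarrow> isCont p x"
  using is_poly_continuous[of p UNIV] by (simp add: continuous_on_eq_continuous_at)

text \<open>Growth is assumed on \<open>S\<close> only, because at zeros not yet made regular it is
  known only along feasible points.\<close>

lemma ordO_dominated:
  assumes "ordO z 3 d" "\<exists>c>0. \<exists>r>0. \<forall>x\<in>S. norm (x - z) < r \<longrightarrow> c * (norm (x - z))\<^sup>2 \<le> B x"
  shows "\<exists>r>0. \<forall>x\<in>S - {z}. norm (x - z) < r \<longrightarrow> \<bar>d x\<bar> < B x"
proof -
  obtain c r where c: "c > 0" "r > 0" "\<And>x. x \<in> S \<Longrightarrow> norm (x - z) < r \<Longrightarrow> c * (norm (x - z))\<^sup>2 \<le> B x"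
    using assms(2) by blast
  obtain s where s: "s > 0" "\<And>x. norm (x - z) < s \<Longrightarrow> \<bar>d x\<bar> \<le> c / 2 * (norm (x - z))\<^sup>2"
    using ordO_absorb[OF assms(1), of "c / 2"] c(1) by auto
  have "\<bar>d x\<bar> < B x" if "x \<in> S - {z}" "norm (x - z) < min r s" for x
  proof -
    have "0 < c / 2 * (norm (x - z))\<^sup>2" using that c by simp
    then show ?thesis
      using c(3)[of x] s(2)[of x] that by simp
  qed
  with c(2) s(1) show ?thesis by (metis min_less_iff_conj)
qed

section \<open>Polynomials peaking at a single point\<close>

lemma compact_within_radius:
  fixes S :: "'a::real_normed_vector set"
  assumes "compact S"
  shows "\<exists>\<rho>>0. \<forall>x\<in>S. norm (x - u) \<le> \<rho>"
proof -
  obtain b where b: "b > 0" "\<And>x. x \<in> S \<Longrightarrow> norm x \<le> b"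
    using compact_imp_bounded[OF assms] unfolding bounded_pos by blast
  then have "norm (x - u) \<le> b + norm u" if "x \<in> S" for x
    using norm_triangle_ineq4[of x u] b(2)[OF that] by linarith
  with b(1) show ?thesis by (meson add_pos_nonneg norm_ge_zero)
qed

text \<open>Polynomials congruent to 1 modulo \<open>t\<close> are closed under products. With
  \<open>t = |x - u|^2\<close> this is the divisibility of \<open>1 - E^(2k)\<close> on which all
  damping arguments rest.\<close>

lemma prod_one_minus_mult:
  assumes "finite I" "is_poly t" "\<And>i. i \<in> I \<Longrightarrow> is_poly (a i)"
  shows "\<exists>q. is_poly q \<and> (\<forall>x. (\<Prod>i\<in>I. 1 - t x * a i x) = 1 - t x * q x)"
  using assms
proof (induction I rule: finite_induct)
  case empty
  then show ?case by (intro exI[of _ "\<lambda>x. 0"]) (simp add: is_poly_const)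
next
  case (insert i I)
  then obtain q where q: "is_poly q" "\<And>x. (\<Prod>i\<in>I. 1 - t x * a i x) = 1 - t x * q x" by auto
  show ?case
  proof (intro exI[of _ "\<lambda>x. a i x + q x - t x * a i x * q x"] conjI allI)
    show "is_poly (\<lambda>x. a i x + q x - t x * a i x * q x)"
      using q insert.prems by (intro is_poly_intros) auto
    show "(\<Prod>i\<in>insert i I. 1 - t x * a i x) = 1 - t x * (a i x + q x - t x * a i x * q x)" for x
      by (simp only: prod.insert[OF insert.hyps] q(2)) (simp add: algebra_simps)
  qed
qed

lemma power_one_minus_mult:
  assumes "is_poly t" "is_poly a"
  shows "\<exists>q. is_poly q \<and> (\<forall>x. (1 - t x * a x) ^ k = 1 - t x * q x)"
  using prod_one_minus_mult[of "{..<k}" t "\<lambda>_. a"] assms by simp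

text \<open>The product \<open>p\<close> of the factors \<open>1 - t / t(z)\<close> vanishes on
  \<open>Z\<close> and equals 1 at \<open>u\<close>, but may exceed 1 in modulus. Being
  \<open>1 - t q\<close>, it is at most \<open>exp (t B)\<close> on the ball, and the factor
  \<open>(1 - t / \<rho>^2)^L\<close>, at most \<open>exp (- t L / \<rho>^2)\<close>, beats this as
  soon as \<open>L > B \<rho>^2\<close>.\<close>

lemma bump_polynomial:
  fixes u :: "real^'n::finite"
  assumes "finite Z" "u \<notin> Z" "\<rho> > 0"
  obtains E where "is_poly E" "E u = 1" "\<And>z. z \<in> Z \<Longrightarrow> E z = 0"
    "\<And>x. x \<noteq> u \<Longrightarrow> norm (x - u) \<le> \<rho> \<Longrightarrow> \<bar>E x\<bar> < 1"
    "\<exists>a. is_poly a \<and> (\<forall>x. E x = 1 - (norm (x - u))\<^sup>2 * a x)"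
proof -
  define t where "t x = (norm (x - u))\<^sup>2" for x
  have t: "is_poly t" "\<And>x. t x \<ge> 0" "t u = 0"
    unfolding t_def using is_poly_norm_diff_sq by auto
  define p where "p x = (\<Prod>z\<in>Z. 1 - t x * (1 / t z))" for x
  obtain q where q: "is_poly q" "\<And>x. p x = 1 - t x * q x"
    using prod_one_minus_mult[OF assms(1) t(1), of "\<lambda>z x. 1 / t z"] is_poly_const unfolding p_def by blast
  obtain B where B: "B > 0" "\<And>x. x \<in> cball u \<rho> \<Longrightarrow> \<bar>q x\<bar> \<le> B"
    using is_poly_bounded_on_compact[OF q(1) compact_cball] by blast
  obtain L :: nat where L: "B * \<rho>\<^sup>2 < L" using reals_Archimedean2 by blast
  define E where "E x = (1 - t x * (1 / \<rho>\<^sup>2)) ^ L * p x" for x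
  show ?thesis
  proof (rule that[of E])
    show "is_poly E"
      unfolding E_def q(2) by (intro is_poly_intros t q)
    show "E u = 1"
      by (simp add: E_def q(2) t)
    show "E z = 0" if "z \<in> Z" for z
    proof -
      have "t z \<noteq> 0" using assms(2) that by (auto simp: t_def)
      then have "p z = 0" unfolding p_def using that assms(1) by (intro prod_zero) (auto intro!: bexI[of _ z])
      then show ?thesis by (simp add: E_def)
    qed
    show "\<bar>E x\<bar> < 1" if "x \<noteq> u" "norm (x - u) \<le> \<rho>" for x
    proof -
      have tx: "t x > 0" "t x \<le> \<rho>\<^sup>2"
        using that by (auto simp: t_def intro: power_mono)
      have "\<bar>p x\<bar> \<le> 1 + t x * \<bar>q x\<bar>"
        unfolding q(2) using tx abs_triangle_ineq4[of 1 "t x * q x"] by (simp add: abs_mult)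
      also have "\<dots> \<le> 1 + t x * B"
        using B(2)[of x] that tx by (simp add: dist_norm norm_minus_commute)
      also have "\<dots> \<le> exp (t x * B)"
        by (rule exp_ge_add_one_self)
      finally have 1: "\<bar>p x\<bar> \<le> exp (t x * B)" .
      have "0 \<le> 1 - t x * (1 / \<rho>\<^sup>2)"
        using tx assms(3) by (simp add: field_simps)
      moreover have "1 - t x * (1 / \<rho>\<^sup>2) \<le> exp (- (t x * (1 / \<rho>\<^sup>2)))"
        using exp_ge_add_one_self[of "- (t x * (1 / \<rho>\<^sup>2))"] by simp
      ultimately have "\<bar>(1 - t x * (1 / \<rho>\<^sup>2)) ^ L\<bar> \<le> exp (- (t x * (1 / \<rho>\<^sup>2))) ^ L"
        by (simp add: power_abs power_mono)
      also have "\<dots> = exp (- (t x * (L / \<rho>\<^sup>2)))"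
        by (simp add: exp_of_nat_mult[symmetric] mult_ac)
      finally have "\<bar>E x\<bar> \<le> exp (- (t x * (L / \<rho>\<^sup>2))) * exp (t x * B)"
        unfolding E_def abs_mult using 1 by (intro mult_mono) auto
      also have "\<dots> = exp (t x * (B - L / \<rho>\<^sup>2))"
        by (simp add: exp_add[symmetric] algebra_simps)
      also have "\<dots> < exp 0"
      proof -
        have "B - L / \<rho>\<^sup>2 < 0" using L assms(3) by (simp add: field_simps)
        then show ?thesis using tx by (simp add: mult_less_0_iff)
      qed
      finally show ?thesis by simp
    qed
    obtain a where a: "is_poly a" "\<And>x. (1 - t x * (1 / \<rho>\<^sup>2)) ^ L = 1 - t x * a x"
      using power_one_minus_mult[OF t(1) is_poly_const, of "1 / \<rho>\<^sup>2"] by blast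
    show "\<exists>a. is_poly a \<and> (\<forall>x. E x = 1 - (norm (x - u))\<^sup>2 * a x)"
    proof (intro exI[of _ "\<lambda>x. a x + q x - t x * a x * q x"] conjI allI)
      show "is_poly (\<lambda>x. a x + q x - t x * a x * q x)" by (intro is_poly_intros a q t)
      show "E x = 1 - (norm (x - u))\<^sup>2 * (a x + q x - t x * a x * q x)" for x
        unfolding E_def a(2) q(2) t_def[symmetric] by (simp add: algebra_simps)
    qed
  qed
qed

text \<open>Three regions need three reasons. Near \<open>u\<close> every weight in
  \<open>[0, 1]\<close> is allowed. Near another point of \<open>Z\<close> the weight
  \<open>E^(2k)\<close> is at most \<open>E^4\<close>, which \<open>B\<close> dominates. On the
  compact rest \<open>B\<close> has a positive minimum while \<open>E^(2k)\<close> decays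
  geometrically and uniformly.\<close>

lemma bump_positivity:
  fixes S :: "(real^'n::finite) set" and B p E :: "real^'n \<Rightarrow> real"
  assumes "compact S" "continuous_on S B" "continuous_on S p" "continuous_on S E" "finite Z"
    and E: "\<And>x. x \<in> S \<Longrightarrow> x \<noteq> u \<Longrightarrow> \<bar>E x\<bar> < 1" "E u = 1"
    and B: "\<And>x. x \<in> S - Z \<Longrightarrow> B x > 0"
    and u: "u \<in> Z" "\<exists>r>0. \<forall>x\<in>S - {u}. norm (x - u) < r \<longrightarrow> (\<forall>s\<in>{0..1}. B x + s * p x > 0)"
    and z: "\<And>z. z \<in> Z - {u} \<Longrightarrow> \<exists>r>0. \<forall>x\<in>S - {z}. norm (x - z) < r \<longrightarrow> \<bar>E x ^ 4 * p x\<bar> < B x"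
  shows "\<exists>K. \<forall>k\<ge>K. \<forall>x\<in>S - Z. B x + E x ^ (2 * k) * p x > 0"
proof -
  have E_le: "\<bar>E x\<bar> \<le> 1" if "x \<in> S" for x
    using E(1)[of x] E(2) that by (cases "x = u") auto
  have "\<exists>r>0. \<forall>x\<in>S - {z}. norm (x - z) < r \<longrightarrow> (\<forall>k\<ge>2. B x + E x ^ (2 * k) * p x > 0)" if zZ: "z \<in> Z" for z
  proof (cases "z = u")
    case True
    obtain r where r: "r > 0" "\<And>x s. x \<in> S - {u} \<Longrightarrow> norm (x - u) < r \<Longrightarrow> s \<in> {0..1} \<Longrightarrow> B x + s * p x > 0"
      using u(2) by blast
    have "E x ^ (2 * k) \<in> {0..1}" if "x \<in> S" for x k
      using E_le[OF that] by (simp add: power_mult power_le_one_iff abs_square_le_1 power_le_one)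
    then show ?thesis using r True by blast
  next
    case False
    obtain r where r: "r > 0" "\<And>x. x \<in> S - {z} \<Longrightarrow> norm (x - z) < r \<Longrightarrow> \<bar>E x ^ 4 * p x\<bar> < B x"
      using z[of z] False zZ by blast
    have "B x + E x ^ (2 * k) * p x > 0" if x: "x \<in> S - {z}" "norm (x - z) < r" "k \<ge> 2" for x k
    proof -
      have "\<bar>E x\<bar> ^ (2 * k) \<le> \<bar>E x\<bar> ^ 4"
        using E_le x by (intro power_decreasing) auto
      then have "\<bar>E x ^ (2 * k) * p x\<bar> \<le> \<bar>E x ^ 4 * p x\<bar>"
        unfolding abs_mult power_abs by (intro mult_right_mono) auto
      then show ?thesis using r(2)[OF x(1,2)] by linarith
    qed
    with r(1) show ?thesis by blast
  qed
  then obtain r where r: "\<And>z. z \<in> Z \<Longrightarrow> r z > 0"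
    "\<And>z x k. z \<in> Z \<Longrightarrow> x \<in> S - {z} \<Longrightarrow> norm (x - z) < r z \<Longrightarrow> k \<ge> 2 \<Longrightarrow> B x + E x ^ (2 * k) * p x > 0"
    by metis
  define T where "T = S - (\<Union>z\<in>Z. ball z (r z))"
  have T: "compact T" "T \<subseteq> S" "T \<inter> Z = {}"
    unfolding T_def using assms(1) r(1) by (auto intro!: compact_diff)
  obtain K where K: "\<And>k x. k \<ge> K \<Longrightarrow> x \<in> T \<Longrightarrow> B x + E x ^ (2 * k) * p x > 0"
  proof (cases "T = {}")
    case True
    then show ?thesis using that by blast
  next
    case False
    obtain x1 where x1: "x1 \<in> T" "\<forall>x\<in>T. B x1 \<le> B x"
      using continuous_attains_inf[OF T(1) False] continuous_on_subset[OF assms(2) T(2)] by blast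
    have "continuous_on T (\<lambda>x. \<bar>E x\<bar>)"
      by (intro continuous_intros continuous_on_subset[OF assms(4) T(2)])
    then obtain x2 where x2: "x2 \<in> T" "\<forall>x\<in>T. \<bar>E x\<bar> \<le> \<bar>E x2\<bar>"
      using continuous_attains_sup[OF T(1) False] by blast
    have "continuous_on T (\<lambda>x. \<bar>p x\<bar>)"
      by (intro continuous_intros continuous_on_subset[OF assms(3) T(2)])
    then obtain x3 where x3: "x3 \<in> T" "\<forall>x\<in>T. \<bar>p x\<bar> \<le> \<bar>p x3\<bar>"
      using continuous_attains_sup[OF T(1) False] by blast
    have th: "\<bar>E x2\<bar> < 1" and B1: "B x1 > 0"
      using E(1)[of x2] x2 x1 T u(1) B[of x1] by auto
    have "(\<lambda>k. \<bar>E x2\<bar> ^ k * \<bar>p x3\<bar>) \<longlonglongrightarrow> 0 * \<bar>p x3\<bar>"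
      by (intro tendsto_intros LIMSEQ_power_zero) (use th in auto)
    then have "eventually (\<lambda>k. \<bar>E x2\<bar> ^ k * \<bar>p x3\<bar> < B x1) sequentially"
      using B1 by (intro order_tendstoD(2)) auto
    then obtain K where K: "\<And>k. k \<ge> K \<Longrightarrow> \<bar>E x2\<bar> ^ k * \<bar>p x3\<bar> < B x1"
      unfolding eventually_sequentially by blast
    show ?thesis
    proof (rule that[of K])
      fix k x assume k: "k \<ge> K" and x: "x \<in> T"
      have "\<bar>E x ^ (2 * k) * p x\<bar> \<le> \<bar>E x2\<bar> ^ (2 * k) * \<bar>p x3\<bar>"
        unfolding abs_mult power_abs using x x2 x3 by (intro mult_mono power_mono) auto
      also have "\<dots> < B x1" using K[of "2 * k"] k by simp
      also have "\<dots> \<le> B x" using x1 x by blast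
      finally show "B x + E x ^ (2 * k) * p x > 0" by linarith
    qed
  qed
  show ?thesis
  proof (intro exI[of _ "max 2 K"] allI impI ballI)
    fix k x assume k: "max 2 K \<le> k" and x: "x \<in> S - Z"
    show "B x + E x ^ (2 * k) * p x > 0"
    proof (cases "x \<in> T")
      case True
      then show ?thesis using K k by simp
    next
      case False
      then obtain z where z: "z \<in> Z" "norm (x - z) < r z"
        using x by (auto simp: T_def dist_norm norm_minus_commute)
      then show ?thesis using r(2)[of z x k] x k by auto
    qed
  qed
qed

section \<open>Positive semidefinite matrices and quadratic growth\<close>

lemma symmat_inner: "symmat A \<Longrightarrow> x \<bullet> (A *v y) = (A *v x) \<bullet> y"
  unfolding symmat_def by (metis dot_lmul_matrix vector_transpose_matrix)

text \<open>Otherwise a small step from \<open>v\<close> against \<open>A *v v\<close> would make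
  the form negative; \<open>s\<close> is chosen so that the quadratic term \<open>s * c\<close>
  stays below half of the linear term \<open>2 * (a \<bullet> a)\<close>.\<close>

lemma psd_inner_eq_0:
  assumes "psd A" "v \<bullet> (A *v v) = 0"
  shows "A *v v = 0"
proof (rule ccontr)
  assume "A *v v \<noteq> 0"
  define a where "a = A *v v"
  define c where "c = a \<bullet> (A *v a)"
  have a: "a \<bullet> a > 0" using \<open>A *v v \<noteq> 0\<close> by (simp add: a_def)
  have c: "c \<ge> 0" using assms(1) by (simp add: c_def psd_def)
  define s where "s = (a \<bullet> a) / (c + 1)"
  have s: "s > 0" "s * c < a \<bullet> a"
    using a c by (simp_all add: s_def field_simps)
  have va: "v \<bullet> (A *v a) = a \<bullet> a"
    using symmat_inner[of A v a] assms(1) by (simp add: psd_def a_def)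
  have "(v - s *\<^sub>R a) \<bullet> (A *v (v - s *\<^sub>R a)) = s * (s * c - 2 * (a \<bullet> a))"
    using assms(2) by (simp add: matrix_vector_mult_diff_distrib matrix_vector_mult_scaleR inner_diff_left
        inner_diff_right va c_def algebra_simps flip: a_def)
  moreover have "(v - s *\<^sub>R a) \<bullet> (A *v (v - s *\<^sub>R a)) \<ge> 0"
    using assms(1) by (simp add: psd_def)
  ultimately have "s * c - 2 * (a \<bullet> a) \<ge> 0"
    using s by (simp add: zero_le_mult_iff)
  then show False using s a by linarith
qed

text \<open>Eliminating one pivot direction at a time strictly enlarges the kernel.\<close>

lemma psd_sum_outer:
  fixes A :: "real^'m::finite^'m"
  assumes "psd A"
  obtains vs :: "(real^'m) list" where "\<And>x. A *v x = (\<Sum>v\<leftarrow>vs. (v \<bullet> x) *\<^sub>R v)"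
proof -
  have "\<exists>vs :: (real^'m) list. \<forall>x. A *v x = (\<Sum>v\<leftarrow>vs. (v \<bullet> x) *\<^sub>R v)"
    using assms
  proof (induction "CARD('m) - dim {x. A *v x = 0}" arbitrary: A rule: less_induct)
    case less
    show ?case
    proof (cases "\<forall>v. A *v v = 0")
      case True
      then show ?thesis by (intro exI[of _ "[]"]) simp
    next
      case False
      then obtain v where "A *v v \<noteq> 0" by blast
      then have "v \<bullet> (A *v v) \<noteq> 0" using psd_inner_eq_0[OF less.prems] by blast
      moreover have "v \<bullet> (A *v v) \<ge> 0" using less.prems by (simp add: psd_def)
      ultimately have c: "v \<bullet> (A *v v) > 0" by simp
      define c where "c = v \<bullet> (A *v v)"
      define a where "a = A *v v"
      note sym = symmat_inner[of A]
      have symA: "symmat A" using less.prems by (simp add: psd_def)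
      define B where "B = A - (1 / c) *\<^sub>R (\<chi> i j. a $ i * a $ j)"
      have Bx: "B *v x = A *v x - ((a \<bullet> x) / c) *\<^sub>R a" for x
      proof -
        have "(\<chi> i j. a $ i * a $ j) *v x = (a \<bullet> x) *\<^sub>R a"
          by (simp add: matrix_vector_mult_def inner_vec_def vec_eq_iff sum_distrib_left sum_distrib_right mult_ac)
        then show ?thesis
          by (simp add: B_def matrix_vector_mult_diff_rdistrib scaleR_matrix_vector_assoc[symmetric])
      qed
      have "psd B"
        unfolding psd_def
      proof (intro conjI allI)
        show "symmat B"
          using symA by (simp add: symmat_def B_def transpose_def vec_eq_iff mult.commute)
        fix x
        define s where "s = (a \<bullet> x) / c"
        have ax: "v \<bullet> (A *v x) = a \<bullet> x" "x \<bullet> (A *v v) = a \<bullet> x"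
          using sym[OF symA, of v x] by (simp_all add: a_def inner_commute)
        \<comment> \<open>Completing the square: the form of \<open>B\<close> at \<open>x\<close> is
          the form of \<open>A\<close> at \<open>x - s v\<close>, with \<open>s\<close> the
          minimizing shift along \<open>v\<close>.\<close>
        have "0 \<le> (x - s *\<^sub>R v) \<bullet> (A *v (x - s *\<^sub>R v))"
          using less.prems by (simp add: psd_def)
        also have "\<dots> = x \<bullet> (A *v x) - 2 * s * (a \<bullet> x) + s * s * c"
          by (simp add: matrix_vector_mult_diff_distrib matrix_vector_mult_scaleR inner_diff_left
              inner_diff_right ax c_def algebra_simps)
        also have "s * c = a \<bullet> x" using c by (simp add: s_def c_def)
        then have "x \<bullet> (A *v x) - 2 * s * (a \<bullet> x) + s * s * c = x \<bullet> (A *v x) - s * (a \<bullet> x)"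
          by (simp add: mult.assoc)
        also have "\<dots> = x \<bullet> (B *v x)"
          by (simp add: Bx inner_diff_right s_def inner_commute)
        finally show "0 \<le> x \<bullet> (B *v x)" .
      qed
      moreover have "CARD('m) - dim {x. B *v x = 0} < CARD('m) - dim {x. A *v x = 0}"
      proof -
        have sub: "subspace {x. M *v x = 0}" for M :: "real^'m^'m"
          by (auto simp: subspace_def matrix_vector_right_distrib matrix_vector_mult_scaleR)
        have "B *v x = 0" if "A *v x = 0" for x
        proof -
          have "a \<bullet> x = 0" using sym[OF symA, of v x] that by (simp add: a_def)
          then show ?thesis using that by (simp add: Bx)
        qed
        moreover have "B *v v = 0" "A *v v \<noteq> 0"
          using c by (auto simp: Bx a_def c_def inner_commute)
        ultimately have "{x. A *v x = 0} \<subset> {x. B *v x = 0}" by blast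
        then have "dim {x. A *v x = 0} < dim {x. B *v x = 0}"
          using dim_psubset[of "{x. A *v x = 0}" "{x. B *v x = 0}"] sub by (simp add: span_eq_iff[THEN iffD2])
        then show ?thesis
          using dim_subset_UNIV_cart[of "{x. B *v x = 0}"] by linarith
      qed
      ultimately obtain vs where vs: "\<And>x. B *v x = (\<Sum>v\<leftarrow>vs. (v \<bullet> x) *\<^sub>R v)"
        using less.hyps by blast
      have "A *v x = (\<Sum>v\<leftarrow>((1 / sqrt c) *\<^sub>R a) # vs. (v \<bullet> x) *\<^sub>R v)" for x
        using c vs[of x] by (simp add: Bx c_def[symmetric] algebra_simps)
      then show ?thesis by blast
    qed
  qed
  with that show ?thesis by blast
qed

lemma inner_sum_list_right: "(y::'a::real_inner) \<bullet> (\<Sum>v\<leftarrow>vs. g v) = (\<Sum>v\<leftarrow>vs. y \<bullet> g v)"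
  by (induction vs) (auto simp: inner_add_right)

text \<open>Only the symmetric part of \<open>M\<close> contributes to the form, and its rank-one
  terms give squares of affine polynomials.\<close>

lemma quad_form_sos:
  fixes M :: "real^'n::finite^'n"
  assumes nonneg: "\<And>h. h \<bullet> (M *v h) \<ge> 0"
  shows "sos (\<lambda>x. (x - u) \<bullet> (M *v (x - u)))"
proof -
  define A where "A = (1 / 2) *\<^sub>R (M + transpose M)"
  have A: "h \<bullet> (A *v h) = h \<bullet> (M *v h)" for h
  proof -
    have "h \<bullet> (transpose M *v h) = h \<bullet> (M *v h)"
      by (metis dot_lmul_matrix inner_commute transpose_matrix_vector)
    then show ?thesis
      by (simp add: A_def scaleR_matrix_vector_assoc[symmetric] matrix_vector_mult_add_rdistrib inner_add_right)
  qed
  have "psd A"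
    unfolding psd_def A using nonneg by (simp add: symmat_def A_def transpose_def vec_eq_iff add.commute)
  then obtain vs :: "(real^'n) list" where vs: "\<And>x. A *v x = (\<Sum>v\<leftarrow>vs. (v \<bullet> x) *\<^sub>R v)"
    using psd_sum_outer by blast
  have "h \<bullet> (A *v h) = (\<Sum>v\<leftarrow>vs. (v \<bullet> h)\<^sup>2)" for h
    unfolding vs by (simp add: inner_sum_list_right power2_eq_square inner_commute)
  moreover have "is_poly (\<lambda>x. v \<bullet> (x - u))" for v
    unfolding inner_vec_def inner_real_def vector_minus_component by (intro is_poly_intros)
  ultimately show ?thesis
    unfolding sos_def by (intro exI[of _ "map (\<lambda>v x. v \<bullet> (x - u)) vs"]) (auto simp: A[symmetric] o_def)
qed

section \<open>Local structure at a point of quadratic growth\<close>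

lemma inner_matrix_eq_sum: "h \<bullet> (M *v h) = (\<Sum>i\<in>UNIV. \<Sum>j\<in>UNIV. h $ i * h $ j * M $ i $ j)"
  by (simp add: inner_vec_def matrix_vector_mult_def sum_distrib_left mult_ac)

text \<open>Growth at \<open>u\<close> excludes a nonzero gradient, because a short step against it
  would make \<open>F\<close> negative. Two Hadamard factorizations then leave quadratic terms
  only.\<close>

lemma taylor_at_growth_point:
  fixes F :: "real^'n::finite \<Rightarrow> real"
  assumes "is_poly F" "quad_growth F u"
  obtains D where "\<And>i j. is_poly (D i j)"
    and "\<And>x. F x = (\<Sum>i\<in>UNIV. \<Sum>j\<in>UNIV. (x $ i - u $ i) * (x $ j - u $ j) * D i j x)"
proof -
  obtain c r where c: "F u = 0" "c > 0" "r > 0" "\<And>x. norm (x - u) < r \<Longrightarrow> c * (norm (x - u))\<^sup>2 \<le> F x"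
    using assms unfolding quad_growth_def by blast
  obtain q where q: "\<And>i. is_poly (q i)" "\<And>x. F x = F u + (\<Sum>i\<in>UNIV. (x $ i - u $ i) * q i x)"
    using is_poly_hadamard[OF assms(1)] by metis
  have "\<forall>i. \<exists>D. (\<forall>j. is_poly (D j)) \<and> (\<forall>x. q i x = q i u + (\<Sum>j\<in>UNIV. (x $ j - u $ j) * D j x))"
    using is_poly_hadamard[OF q(1)] by metis
  then obtain D where D: "\<And>i j. is_poly (D i j)" "\<And>i x. q i x = q i u + (\<Sum>j\<in>UNIV. (x $ j - u $ j) * D i j x)"
    by metis
  define g where "g = (\<chi> i. q i u)"
  define R where "R x = (\<Sum>i\<in>UNIV. \<Sum>j\<in>UNIV. (x $ i - u $ i) * (x $ j - u $ j) * D i j x)" for x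
  have F: "F x = g \<bullet> (x - u) + R x" for x
  proof -
    have "F x = (\<Sum>i\<in>UNIV. (x $ i - u $ i) * (q i u + (\<Sum>j\<in>UNIV. (x $ j - u $ j) * D i j x)))"
      using q(2)[of x] D(2)[of _ x] c(1) by simp
    then show ?thesis
      by (simp add: g_def R_def inner_vec_def distrib_left sum.distrib sum_distrib_left mult_ac)
  qed
  have "ordO u (1 + 1 + 0) (\<lambda>x. (x $ i - u $ i) * (x $ j - u $ j) * D i j x)" for i j
    by (intro ordO_mult ordO_component ordO_poly D)
  then have "ordO u 2 R"
    unfolding R_def by (intro ordO_sum) (simp add: numeral_2_eq_2)
  then obtain C where C: "C \<ge> 0" "\<And>x. norm (x - u) \<le> 1 \<Longrightarrow> \<bar>R x\<bar> \<le> C * (norm (x - u))\<^sup>2"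
    unfolding ordO_def by blast
  have "g = 0"
  proof (rule ccontr)
    assume "g \<noteq> 0"
    have ng: "norm g > 0" using \<open>g \<noteq> 0\<close> by simp
    \<comment> \<open>The step length must stay within the ball of the remainder bound and within
      the growth radius, and must keep the remainder below half of the linear decrease.\<close>
    define m where "m = min (min 1 (r / 2)) (norm g / (2 * (C + 1)))"
    have m: "m > 0" "m \<le> 1" "m < r" "m * (C + 1) \<le> norm g / 2"
    proof -
      show "m > 0" using c C ng by (simp add: m_def)
      show "m \<le> 1" by (simp add: m_def)
      have "m \<le> r / 2" unfolding m_def by (meson min.cobounded1 min.cobounded2 order_trans)
      then show "m < r" using c(3) by simp
      have "m * (C + 1) \<le> norm g / (2 * (C + 1)) * (C + 1)"
        using C(1) by (intro mult_right_mono) (auto simp: m_def)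
      also have "\<dots> = norm g / 2" using C(1) by (simp add: divide_simps)
      finally show "m * (C + 1) \<le> norm g / 2" .
    qed
    define x where "x = u - (m / norm g) *\<^sub>R g"
    have nx: "norm (x - u) = m" using ng m by (simp add: x_def)
    have "0 \<le> c * (norm (x - u))\<^sup>2" using c by simp
    also have "\<dots> \<le> F x" using c(4)[of x] nx m by simp
    also have "F x = - (m * norm g) + R x"
      using ng by (simp add: F x_def inner_diff_right power2_norm_eq_inner[symmetric] power2_eq_square)
    finally have "m * norm g \<le> C * m\<^sup>2"
      using C(2)[of x] nx m by (simp add: abs_le_iff)
    then have "norm g \<le> C * m" using m by (simp add: power2_eq_square)
    also have "\<dots> \<le> m * (C + 1)" using m by (simp add: algebra_simps)
    finally show False using m ng by linarith
  qed
  then have "F x = (\<Sum>i\<in>UNIV. \<Sum>j\<in>UNIV. (x $ i - u $ i) * (x $ j - u $ j) * D i j x)" for x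
    using F by (simp add: R_def)
  with D that show ?thesis by blast
qed

text \<open>Shrinking \<open>h\<close> makes the third order error cost at most half of the growth;
  homogeneity of degree two then removes the scale.\<close>

lemma quadratic_part_pos:
  fixes F :: "real^'n::finite \<Rightarrow> real" and M :: "real^'n^'n"
  assumes "quad_growth F u" "ordO u 3 (\<lambda>x. F x - (x - u) \<bullet> (M *v (x - u)))"
  obtains c where "c > 0" "\<And>h. h \<bullet> (M *v h) \<ge> c * (norm h)\<^sup>2"
proof -
  obtain c r where c: "c > 0" "r > 0" "\<And>x. norm (x - u) < r \<Longrightarrow> c * (norm (x - u))\<^sup>2 \<le> F x"
    using assms unfolding quad_growth_def by blast
  obtain s where s: "s > 0" "\<And>x. norm (x - u) < s \<Longrightarrow> \<bar>F x - (x - u) \<bullet> (M *v (x - u))\<bar> \<le> c / 2 * (norm (x - u))\<^sup>2"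
    using ordO_absorb[OF assms(2), of "c / 2"] c by auto
  show ?thesis
  proof (rule that[of "c / 2"])
    show "c / 2 > 0" using c by simp
    fix h :: "real^'n"
    define m where "m = min r s / (2 * (norm h + 1))"
    have m: "m > 0" using c s by (simp add: m_def add_nonneg_pos)
    have "m * norm h \<le> m * (norm h + 1)" using m by simp
    also have "\<dots> = min r s / 2" by (simp add: m_def field_simps add_nonneg_eq_0_iff)
    also have "\<dots> < min r s" using c(2) s(1) by (simp add: min_def)
    finally have small: "norm (m *\<^sub>R h) < min r s" using m by simp
    have "c * (norm (m *\<^sub>R h))\<^sup>2 \<le> F (u + m *\<^sub>R h)"
      using c(3)[of "u + m *\<^sub>R h"] small by simp
    moreover have "\<bar>F (u + m *\<^sub>R h) - (m *\<^sub>R h) \<bullet> (M *v (m *\<^sub>R h))\<bar> \<le> c / 2 * (norm (m *\<^sub>R h))\<^sup>2"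
      using s(2)[of "u + m *\<^sub>R h", unfolded add_diff_cancel_left'] small by linarith
    ultimately have "c / 2 * (norm (m *\<^sub>R h))\<^sup>2 \<le> (m *\<^sub>R h) \<bullet> (M *v (m *\<^sub>R h))"
      by linarith
    then have "m\<^sup>2 * (c / 2 * (norm h)\<^sup>2) \<le> m\<^sup>2 * (h \<bullet> (M *v h))"
      using m by (simp add: matrix_vector_mult_scaleR power2_eq_square mult_ac)
    then show "h \<bullet> (M *v h) \<ge> c / 2 * (norm h)\<^sup>2"
      using m by simp
  qed
qed

text \<open>A positive definite form lies in the interior of the cone spanned by the squares
  \<open>(h\<^sub>i \<plusminus> h\<^sub>j)\<^sup>2\<close> and the squares of linear forms; the former absorb the
  variable part of the Hessian because \<open>4 h\<^sub>i h\<^sub>j = (h\<^sub>i + h\<^sub>j)\<^sup>2 - (h\<^sub>i - h\<^sub>j)\<^sup>2\<close>.\<close>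

lemma growth_decomposition:
  fixes F :: "real^'n::finite \<Rightarrow> real"
  assumes "is_poly F" "quad_growth F u"
  obtains Q and l \<phi> :: "'n \<times> 'n \<times> bool \<Rightarrow> real^'n \<Rightarrow> real"
  where "sos Q" "\<And>a. is_poly (l a)" "\<And>a. is_poly (\<phi> a)" "\<And>a. \<phi> a u > 0"
    "\<And>x. F x = Q x + (\<Sum>a\<in>UNIV. (l a x)\<^sup>2 * \<phi> a x)"
    "\<And>x. (\<Sum>a\<in>UNIV. (l a x)\<^sup>2) = 4 * real CARD('n) * (norm (x - u))\<^sup>2"
proof -
  obtain D where D: "\<And>i j. is_poly (D i j)"
    and F: "\<And>x. F x = (\<Sum>i\<in>UNIV. \<Sum>j\<in>UNIV. (x $ i - u $ i) * (x $ j - u $ j) * D i j x)"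
    by (rule taylor_at_growth_point[OF assms]) blast
  define M where "M = (\<chi> i j. D i j u)"
  have FM: "F x - (x - u) \<bullet> (M *v (x - u)) = (\<Sum>i\<in>UNIV. \<Sum>j\<in>UNIV. (x $ i - u $ i) * (x $ j - u $ j) * (D i j x - D i j u))" for x
    unfolding F inner_matrix_eq_sum M_def by (simp add: sum_subtractf right_diff_distrib)
  have "ordO u (1 + 1 + 1) (\<lambda>x. (x $ i - u $ i) * (x $ j - u $ j) * (D i j x - D i j u))" for i j
    by (intro ordO_mult ordO_component ordO_poly_vanishing is_poly_intros D) simp
  then have "ordO u 3 (\<lambda>x. F x - (x - u) \<bullet> (M *v (x - u)))"
    unfolding FM by (intro ordO_sum) (simp add: numeral_3_eq_3)
  from quadratic_part_pos[OF assms(2) this] obtain c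
    where c: "c > 0" "\<And>h. h \<bullet> (M *v h) \<ge> c * (norm h)\<^sup>2" by blast
  define n where "n = real CARD('n)"
  have n: "n > 0" by (simp add: n_def)
  \<comment> \<open>The squares \<open>(l a)^2\<close> add up to \<open>4 n |x - u|^2\<close>, so
    weight \<open>\<epsilon>\<close> on each of them restores exactly the \<open>c |x - u|^2\<close>
    taken out of \<open>M\<close> in \<open>Q\<close>.\<close>
  define \<epsilon> where "\<epsilon> = c / (4 * n)"
  define sg :: "bool \<Rightarrow> real" where "sg b = (if b then 1 else - 1)" for b
  define Q where "Q x = (x - u) \<bullet> ((M - c *\<^sub>R mat 1) *v (x - u))" for x
  define l where "l a x = (case a of (i, j, b) \<Rightarrow> (x $ i - u $ i) + sg b * (x $ j - u $ j))" for a :: "'n \<times> 'n \<times> bool" and x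
  define \<phi> where "\<phi> a x = (case a of (i, j, b) \<Rightarrow> \<epsilon> + sg b * (D i j x - D i j u) / 4)" for a :: "'n \<times> 'n \<times> bool" and x
  have UN: "(\<Sum>a\<in>UNIV. h a) = (\<Sum>i\<in>UNIV. \<Sum>j\<in>UNIV. h (i, j, True) + h (i, j, False))" for h :: "'n \<times> 'n \<times> bool \<Rightarrow> real"
  proof -
    have "(\<Sum>i\<in>UNIV. \<Sum>j\<in>UNIV. \<Sum>b\<in>UNIV. h (i, j, b)) = (\<Sum>a\<in>UNIV. h a)"
      by (simp add: sum.cartesian_product case_prod_beta')
    then show ?thesis by (simp add: UNIV_bool add.commute)
  qed
  have norm_sq: "(norm (x - u))\<^sup>2 = (\<Sum>i\<in>UNIV. (x $ i - u $ i)\<^sup>2)" for x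
    unfolding power2_norm_eq_inner by (simp add: inner_vec_def power2_eq_square)
  have sum_l: "(\<Sum>a\<in>UNIV. (l a x)\<^sup>2) = 4 * n * (norm (x - u))\<^sup>2" for x
  proof -
    have "(\<Sum>a\<in>UNIV. (l a x)\<^sup>2) = (\<Sum>i\<in>UNIV. \<Sum>j\<in>(UNIV::'n set). 2 * (x $ i - u $ i)\<^sup>2 + 2 * (x $ j - u $ j)\<^sup>2)"
      unfolding UN by (intro sum.cong refl) (simp add: l_def sg_def power2_eq_square algebra_simps)
    also have "\<dots> = 4 * n * (norm (x - u))\<^sup>2"
      by (simp add: sum.distrib norm_sq n_def sum_distrib_left[symmetric])
    finally show ?thesis .
  qed
  have Qx: "Q x = (x - u) \<bullet> (M *v (x - u)) - c * (norm (x - u))\<^sup>2" for x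
    by (simp add: Q_def matrix_vector_mult_diff_rdistrib scaleR_matrix_vector_assoc[symmetric] inner_diff_right
        power2_norm_eq_inner)
  show ?thesis
  proof (rule that[of Q l \<phi>])
    show "sos Q"
      unfolding Q_def
    proof (rule quad_form_sos)
      show "0 \<le> h \<bullet> ((M - c *\<^sub>R mat 1) *v h)" for h
        using c(2)[of h] by (simp add: matrix_vector_mult_diff_rdistrib scaleR_matrix_vector_assoc[symmetric] inner_diff_right power2_norm_eq_inner)
    qed
    show "is_poly (l a)" for a
      unfolding l_def by (cases a) (auto intro!: is_poly_intros)
    show "is_poly (\<phi> a)" for a
      unfolding \<phi>_def by (cases a) (auto intro!: is_poly_intros D)
    show "\<phi> a u > 0" for a
      using c n by (cases a) (simp add: \<phi>_def \<epsilon>_def)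
    show "(\<Sum>a\<in>UNIV. (l a x)\<^sup>2) = 4 * real CARD('n) * (norm (x - u))\<^sup>2" for x
      using sum_l by (simp add: n_def)
    show "F x = Q x + (\<Sum>a\<in>UNIV. (l a x)\<^sup>2 * \<phi> a x)" for x
    proof -
      have "(\<Sum>a\<in>UNIV. (l a x)\<^sup>2 * \<phi> a x) = \<epsilon> * (\<Sum>a\<in>UNIV. (l a x)\<^sup>2) + (\<Sum>a\<in>UNIV. (l a x)\<^sup>2 * (\<phi> a x - \<epsilon>))"
        by (simp add: sum_distrib_left sum.distrib[symmetric] algebra_simps)
      also have "\<epsilon> * (\<Sum>a\<in>UNIV. (l a x)\<^sup>2) = c * (norm (x - u))\<^sup>2"
        using n by (simp add: sum_l \<epsilon>_def)
      also have "(\<Sum>a\<in>UNIV. (l a x)\<^sup>2 * (\<phi> a x - \<epsilon>)) = F x - (x - u) \<bullet> (M *v (x - u))"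
      proof -
        have pol: "(p + 1 * q)\<^sup>2 * (e + 1 * d / 4 - e) + (p + - 1 * q)\<^sup>2 * (e + - 1 * d / 4 - e) = p * q * d"
          for p q d e :: real
          by (simp add: power2_eq_square field_simps)
        show ?thesis
          unfolding FM UN l_def \<phi>_def sg_def by (simp only: prod.case if_True if_False pol)
      qed
      finally show ?thesis by (simp add: Qx)
    qed
  qed
qed

section \<open>From local to global certificates\<close>

text \<open>Induction over the zeros already made regular: at each new zero \<open>u\<close> the witness
  \<open>g\<close> is subtracted after damping by an even power of a polynomial that peaks at \<open>u\<close>.\<close>

lemma regularize_zeros:
  fixes G :: "real^'n::finite \<Rightarrow> real^'m::finite^'m"
  assumes G: "polymat G" "compact (feasible G)"
    and F: "is_poly F" "\<And>x. x \<in> feasible G - Z \<Longrightarrow> F x > 0" "\<And>x. x \<in> Z \<Longrightarrow> F x = 0"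
    and Z: "finite Z" "Z \<subseteq> feasible G"
    and nice: "\<And>u. u \<in> Z \<Longrightarrow> \<exists>g. QM G g \<and> quad_growth (\<lambda>x. F x - g x) u"
  obtains h where "QM G h" "\<And>x. x \<in> feasible G - Z \<Longrightarrow> F x - h x > 0"
    "\<And>u. u \<in> Z \<Longrightarrow> quad_growth (\<lambda>x. F x - h x) u"
proof -
  let ?S = "feasible G"
  have "\<exists>h. QM G h \<and> (\<forall>x\<in>?S - Z. F x - h x > 0) \<and> (\<forall>u\<in>A. quad_growth (\<lambda>x. F x - h x) u)
      \<and> (\<forall>u\<in>Z - A. \<exists>g. QM G g \<and> quad_growth (\<lambda>x. F x - h x - g x) u)"
    if "finite A" "A \<subseteq> Z" for A
    using that
  proof (induction A rule: finite_induct)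
    case empty
    show ?case
      using F nice by (intro exI[of _ "\<lambda>x. 0"]) (auto intro: QM_sos sos_0)
  next
    case (insert u A)
    then obtain h where h: "QM G h" "\<And>x. x \<in> ?S - Z \<Longrightarrow> F x - h x > 0"
      "\<And>z. z \<in> A \<Longrightarrow> quad_growth (\<lambda>x. F x - h x) z"
      "\<And>z. z \<in> Z - A \<Longrightarrow> \<exists>g. QM G g \<and> quad_growth (\<lambda>x. F x - h x - g x) z"
      by auto
    have u: "u \<in> Z" "u \<in> ?S" using insert Z by auto
    obtain g where g: "QM G g" "quad_growth (\<lambda>x. F x - h x - g x) u"
      using h(4)[of u] insert u by blast
    have poly: "is_poly h" "is_poly g"
      using QM_is_poly[OF G(1)] h g by auto
    \<comment> \<open>At the feasible point \<open>u\<close> both \<open>h\<close> and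
      \<open>g\<close> are nonnegative and their sum is \<open>F u = 0\<close>. That
      \<open>g\<close> vanishes there makes damping a third order change.\<close>
    have gu: "g u = 0"
    proof -
      have "F u - h u - g u = 0" using g by (simp add: quad_growth_def)
      then show ?thesis using F(3) u QM_nonneg[OF h(1) u(2)] QM_nonneg[OF g(1) u(2)] by auto
    qed
    obtain \<rho> where \<rho>: "\<rho> > 0" "\<And>x. x \<in> ?S \<Longrightarrow> norm (x - u) \<le> \<rho>"
      using compact_within_radius[OF G(2), of u] by blast
    \<comment> \<open>Since \<open>E\<close> also vanishes at the other zeros, a fourth or higher
      power of it leaves quadratic growth there intact.\<close>
    obtain E a where E: "is_poly E" "E u = 1" "\<And>z. z \<in> Z - {u} \<Longrightarrow> E z = 0"
      "\<And>x. x \<noteq> u \<Longrightarrow> norm (x - u) \<le> \<rho> \<Longrightarrow> \<bar>E x\<bar> < 1"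
      and a: "is_poly a" "\<And>x. E x = 1 - (norm (x - u))\<^sup>2 * a x"
      using bump_polynomial[of "Z - {u}" u \<rho>] Z(1) \<rho>(1) by (metis DiffE finite_Diff insertI1)
    have Eord: "ordO z 1 E" if "z \<in> Z - {u}" for z
      using ordO_poly_vanishing[OF E(1) E(3)[OF that]] .
    \<comment> \<open>Along feasible points growth holds even at untreated zeros, because the
      certificate still to be subtracted is nonnegative there.\<close>
    have growth_S: "\<exists>c>0. \<exists>r>0. \<forall>x\<in>?S. norm (x - z) < r \<longrightarrow> c * (norm (x - z))\<^sup>2 \<le> F x - h x" if z: "z \<in> Z" for z
    proof (cases "z \<in> A")
      case True
      then show ?thesis using h(3)[of z] unfolding quad_growth_def by blast
    next
      case False
      then obtain g' where g': "QM G g'" "quad_growth (\<lambda>x. F x - h x - g' x) z"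
        using h(4) z by blast
      then obtain c r where c: "c > 0" "r > 0" "\<And>x. norm (x - z) < r \<Longrightarrow> c * (norm (x - z))\<^sup>2 \<le> F x - h x - g' x"
        unfolding quad_growth_def by blast
      have "c * (norm (x - z))\<^sup>2 \<le> F x - h x" if "x \<in> ?S" "norm (x - z) < r" for x
        using c(3)[OF that(2)] QM_nonneg[OF g'(1) that(1)] by linarith
      with c show ?thesis by blast
    qed
    have "\<exists>K. \<forall>k\<ge>K. \<forall>x\<in>?S - Z. (F x - h x) + E x ^ (2 * k) * (- g x) > 0"
    proof (rule bump_positivity[OF G(2), of "\<lambda>x. F x - h x" "\<lambda>x. - g x" E Z u])
      show "continuous_on ?S (\<lambda>x. F x - h x)" "continuous_on ?S (\<lambda>x. - g x)" "continuous_on ?S E"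
        by (intro is_poly_continuous is_poly_intros F poly E)+
      show "\<bar>E x\<bar> < 1" if "x \<in> ?S" "x \<noteq> u" for x
        using E(4) \<rho>(2) that by blast
      show "\<exists>r>0. \<forall>x\<in>?S - {u}. norm (x - u) < r \<longrightarrow> (\<forall>s\<in>{0..1}. 0 < F x - h x + s * - g x)"
      proof -
        obtain r where r: "r > 0" "\<And>x. x \<noteq> u \<Longrightarrow> norm (x - u) < r \<Longrightarrow> F x - h x - g x > 0"
          using quad_growth_pos[OF g(2)] by blast
        have "0 < F x - h x + s * - g x" if "x \<in> ?S - {u}" "norm (x - u) < r" "s \<in> {0..1}" for x s
        proof -
          have "s * g x \<le> 1 * g x"
            using QM_nonneg[OF g(1), of x] that by (intro mult_right_mono) auto
          then show ?thesis using r(2)[of x] that by simp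
        qed
        with r(1) show ?thesis by blast
      qed
      show "\<exists>r>0. \<forall>x\<in>?S - {z}. norm (x - z) < r \<longrightarrow> \<bar>E x ^ 4 * - g x\<bar> < F x - h x" if z: "z \<in> Z - {u}" for z
      proof (rule ordO_dominated[OF _ growth_S])
        have "ordO z (4 + 0) (\<lambda>x. E x ^ 4 * - g x)"
          by (intro ordO_mult ordO_power Eord z ordO_poly is_poly_minus poly)
        then show "ordO z 3 (\<lambda>x. E x ^ 4 * - g x)" by (rule ordO_weaken) simp
      qed (use z in blast)
    qed (use Z u E h in auto)
    then obtain K where K: "\<And>k x. k \<ge> K \<Longrightarrow> x \<in> ?S - Z \<Longrightarrow> (F x - h x) + E x ^ (2 * k) * (- g x) > 0"
      by blast
    \<comment> \<open>The lower bound 2 gives \<open>E^(2k)\<close> order at least four at the other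
      zeros, enough for the third order perturbation bound.\<close>
    define k where "k = max 2 K"
    define h' where "h' x = h x + (E x ^ k)\<^sup>2 * g x" for x
    have h'_eq: "h' x = h x + E x ^ (2 * k) * g x" for x
      by (simp add: h'_def power_mult[symmetric] mult.commute)
    have away: "ordO z 3 (\<lambda>x. - (E x ^ (2 * k) * g x))" if "z \<in> Z - {u}" for z
    proof -
      have "ordO z (2 * k + 0) (\<lambda>x. E x ^ (2 * k) * g x)"
        by (intro ordO_mult ordO_power Eord that ordO_poly poly)
      then have "ordO z 3 (\<lambda>x. E x ^ (2 * k) * g x)"
        by (rule ordO_weaken) (simp add: k_def)
      then show ?thesis by (rule ordO_minus)
    qed
    \<comment> \<open>Damping costs \<open>(1 - E^(2k)) g\<close>, that is \<open>|x - u|^2\<close>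
      times a polynomial times \<open>g\<close>, which is of third order because
      \<open>g u = 0\<close>.\<close>
    have at: "quad_growth (\<lambda>x. F x - h' x) u"
    proof -
      obtain b where b: "is_poly b" "\<And>x. E x ^ (2 * k) = 1 - (norm (x - u))\<^sup>2 * b x"
        using power_one_minus_mult[OF is_poly_norm_diff_sq a(1), of u "2 * k"] a(2) by auto
      have "ordO u (2 + 0 + 1) (\<lambda>x. (norm (x - u))\<^sup>2 * b x * g x)"
        by (intro ordO_mult ordO_norm ordO_poly ordO_poly_vanishing b poly gu)
      then have "quad_growth (\<lambda>x. (F x - h x - g x) + (norm (x - u))\<^sup>2 * b x * g x) u"
        by (intro quad_growth_perturb g) simp
      moreover have "F x - h' x = (F x - h x - g x) + (norm (x - u))\<^sup>2 * b x * g x" for x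
        unfolding h'_eq b(2) by (simp add: algebra_simps)
      ultimately show ?thesis by presburger
    qed
    show ?case
    proof (rule exI[of _ h'], intro conjI ballI)
      show "QM G h'"
        unfolding h'_def by (intro QM_add h QM_square_mult g is_poly_power E)
      show "F x - h' x > 0" if "x \<in> ?S - Z" for x
        using K[OF _ that, of k] by (simp add: h'_eq k_def)
      show "quad_growth (\<lambda>x. F x - h' x) z" if "z \<in> insert u A" for z
      proof (cases "z = u")
        case False
        then have "z \<in> A" "z \<in> Z - {u}" using that insert.prems by auto
        from quad_growth_perturb[OF h(3)[OF this(1)] away[OF this(2)]] show ?thesis
          by (simp add: h'_eq algebra_simps)
      qed (use at in simp)
      show "\<exists>g. QM G g \<and> quad_growth (\<lambda>x. F x - h' x - g x) z" if z: "z \<in> Z - insert u A" for z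
      proof -
        obtain g' where g': "QM G g'" "quad_growth (\<lambda>x. F x - h x - g' x) z"
          using h(4)[of z] z by blast
        from quad_growth_perturb[OF g'(2) away[of z]] z
        have "quad_growth (\<lambda>x. F x - h' x - g' x) z"
          by (simp add: h'_eq algebra_simps)
        with g'(1) show ?thesis by blast
      qed
    qed
  qed
  from this[OF Z(1) order_refl] that show ?thesis by auto
qed

text \<open>The weights \<open>\<phi> a\<close> of the growth decomposition are known to be positive
  only near \<open>u\<close>; mixing in \<open>F\<close> itself repairs this. Write
  \<open>1 - E^(2k) = |x - u|^2 w_k\<close> and let \<open>n |x - u|^2\<close> be the sum of the
  \<open>(l a)^2\<close>. Then \<open>F = E^(2k) F + (1 - E^(2k)) F\<close> becomes
  \<open>E^(2k) Q\<close> plus the sum of the \<open>(l a)^2 \<psi>_a\<close>, where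
  \<open>\<psi>_a = w_k F / n + E^(2k) \<phi>_a\<close>. Each \<open>\<psi>_a\<close> is positive at
  \<open>u\<close> and keeps quadratic growth at the other zeros, so the induction hypothesis
  applies.\<close>

lemma quad_growth_QM:
  fixes G :: "real^'n::finite \<Rightarrow> real^'m::finite^'m"
  assumes G: "polymat G" "\<forall>x. symmat (G x)" "archimedean G"
    and "finite Z" "Z \<subseteq> feasible G" "is_poly F" "\<And>x. x \<in> feasible G - Z \<Longrightarrow> F x > 0"
    "\<And>z. z \<in> Z \<Longrightarrow> quad_growth F z"
  shows "QM G F"
  using assms(4-)
proof (induction Z arbitrary: F rule: finite_induct)
  case empty
  then show ?case by (intro putinar G) auto
next
  case (insert u Z)
  let ?S = "feasible G"
  have S: "compact ?S" by (rule compact_feasible[OF G])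
  obtain Q and l \<phi> :: "'n \<times> 'n \<times> bool \<Rightarrow> real^'n \<Rightarrow> real"
    where Q: "sos Q" and l: "\<And>a. is_poly (l a)" and \<phi>: "\<And>a. is_poly (\<phi> a)" "\<And>a. \<phi> a u > 0"
      and F_eq: "\<And>x. F x = Q x + (\<Sum>a\<in>UNIV. (l a x)\<^sup>2 * \<phi> a x)"
      and sum_l: "\<And>x. (\<Sum>a\<in>UNIV. (l a x)\<^sup>2) = 4 * real CARD('n) * (norm (x - u))\<^sup>2"
    by (rule growth_decomposition[OF insert.prems(2) insert.prems(4)[of u]]) blast+
  define n where "n = 4 * real CARD('n)"
  have n: "n > 0" by (simp add: n_def)
  obtain \<rho> where \<rho>: "\<rho> > 0" "\<And>x. x \<in> ?S \<Longrightarrow> norm (x - u) \<le> \<rho>"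
    using compact_within_radius[OF S, of u] by blast
  obtain E a where E: "is_poly E" "E u = 1" "\<And>z. z \<in> Z \<Longrightarrow> E z = 0"
    "\<And>x. x \<noteq> u \<Longrightarrow> norm (x - u) \<le> \<rho> \<Longrightarrow> \<bar>E x\<bar> < 1"
    and a: "is_poly a" "\<And>x. E x = 1 - (norm (x - u))\<^sup>2 * a x"
    using bump_polynomial[of Z u \<rho>] insert.hyps \<rho>(1) by metis
  have "\<exists>w. is_poly w \<and> (\<forall>x. E x ^ (2 * k) = 1 - (norm (x - u))\<^sup>2 * w x)" for k
    using power_one_minus_mult[OF is_poly_norm_diff_sq a(1), of u "2 * k"] a(2) by simp
  then obtain w where w: "\<And>k. is_poly (w k)" "\<And>k x. E x ^ (2 * k) = 1 - (norm (x - u))\<^sup>2 * w k x"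
    by metis
  have E1: "\<bar>E x\<bar> < 1" if "x \<in> ?S" "x \<noteq> u" for x
    using E(4) \<rho>(2) that by blast
  \<comment> \<open>Away from \<open>u\<close>, \<open>w k\<close> is the quotient
    \<open>(1 - E^(2k)) / |x - u|^2\<close>, positive and increasing in \<open>k\<close> where
    \<open>|E| < 1\<close>.\<close>
  have w_mono: "0 < w 1 x" "w 1 x \<le> w k x" if "x \<in> ?S" "x \<noteq> u" "k \<ge> 1" for x k
  proof -
    have t: "(norm (x - u))\<^sup>2 > 0" using that by simp
    have "(E x)\<^sup>2 < 1" using E1[OF that(1,2)] by (simp add: abs_square_less_1)
    then have "0 < (norm (x - u))\<^sup>2 * w 1 x" using w(2)[of x 1] by simp
    then show "0 < w 1 x" using t by (simp add: zero_less_mult_iff)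
    have "E x ^ (2 * k) \<le> E x ^ (2 * 1)"
      using power_decreasing[of 1 k "(E x)\<^sup>2"] that(3) \<open>(E x)\<^sup>2 < 1\<close> by (simp add: power_mult)
    then have "(norm (x - u))\<^sup>2 * w 1 x \<le> (norm (x - u))\<^sup>2 * w k x" using w(2)[of x 1] w(2)[of x k] by linarith
    then show "w 1 x \<le> w k x" using t by simp
  qed
  have wz: "w k z > 0" if "z \<in> Z" "k \<ge> 1" for z k
    using w_mono[of z k] that insert by force
  have Eord: "ordO z 1 E" if "z \<in> Z" for z
    using ordO_poly_vanishing[OF E(1) E(3)[OF that]] .
  have Bgrowth: "quad_growth (\<lambda>x. w k x / n * F x) z" if "z \<in> Z" "k \<ge> 1" for z k
    using that wz n by (intro quad_growth_mult insert.prems is_poly_isCont is_poly_intros w) auto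
  have pert: "ordO z 3 (\<lambda>x. E x ^ j * \<phi> a x)" if "z \<in> Z" "j \<ge> 3" for z j a
    by (rule ordO_weaken[OF ordO_mult[OF ordO_power[OF Eord[OF that(1)]] ordO_poly[OF \<phi>(1)]]]) (use that in simp)
  \<comment> \<open>The base term is taken with \<open>w 1\<close> so that it stays fixed while
    \<open>k\<close> grows; replacing it by \<open>w k\<close> afterwards only increases it.\<close>
  have "\<exists>K. \<forall>k\<ge>K. \<forall>x\<in>?S - insert u Z. w 1 x / n * F x + E x ^ (2 * k) * \<phi> a x > 0" for a
  proof (rule bump_positivity[OF S, of _ _ E "insert u Z" u])
    show "continuous_on ?S (\<lambda>x. w 1 x / n * F x)" "continuous_on ?S (\<phi> a)" "continuous_on ?S E"
      by (intro is_poly_continuous is_poly_intros insert.prems w \<phi> E)+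
    show pos: "0 < w 1 x / n * F x" if "x \<in> ?S - insert u Z" for x
      using that w_mono(1)[of x 1] n insert.prems(3)[OF that] by simp
    show "\<exists>r>0. \<forall>x\<in>?S - {u}. norm (x - u) < r \<longrightarrow> (\<forall>s\<in>{0..1}. 0 < w 1 x / n * F x + s * \<phi> a x)"
    proof -
      obtain r where r: "r > 0" "\<And>x. x \<noteq> u \<Longrightarrow> norm (x - u) < r \<Longrightarrow> F x > 0"
        using quad_growth_pos[OF insert.prems(4)[of u]] by blast
      have "eventually (\<lambda>x. \<phi> a x > 0) (at u)"
        using is_poly_isCont[OF \<phi>(1)[of a], of u] unfolding isCont_def
        by (rule order_tendstoD(1)) (rule \<phi>(2))
      then obtain s where s: "s > 0" "\<And>x. x \<noteq> u \<Longrightarrow> norm (x - u) < s \<Longrightarrow> \<phi> a x > 0"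
        unfolding eventually_at by (auto simp: dist_norm)
      have "0 < w 1 x / n * F x + q * \<phi> a x" if "x \<in> ?S - {u}" "norm (x - u) < min r s" "q \<in> {0..1}" for x q
      proof -
        have "0 < w 1 x / n * F x" using w_mono(1)[of x 1] r(2)[of x] n that by simp
        moreover have "0 \<le> q * \<phi> a x" using s(2)[of x] that by simp
        ultimately show ?thesis by linarith
      qed
      with r(1) s(1) show ?thesis by (metis min_less_iff_conj)
    qed
    show "\<exists>r>0. \<forall>x\<in>?S - {z}. norm (x - z) < r \<longrightarrow> \<bar>E x ^ 4 * \<phi> a x\<bar> < w 1 x / n * F x"
      if z: "z \<in> insert u Z - {u}" for z
    proof (rule ordO_dominated[OF pert])
      show "z \<in> Z" using z by blast
      then show "\<exists>c>0. \<exists>r>0. \<forall>x\<in>?S. norm (x - z) < r \<longrightarrow> c * (norm (x - z))\<^sup>2 \<le> w 1 x / n * F x"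
        using Bgrowth[of z 1] unfolding quad_growth_def by auto
    qed simp
  qed (use insert E E1 in auto)
  then obtain K where K: "\<And>a k x. k \<ge> K a \<Longrightarrow> x \<in> ?S - insert u Z \<Longrightarrow> w 1 x / n * F x + E x ^ (2 * k) * \<phi> a x > 0"
    by metis
  \<comment> \<open>One exponent serves all the finitely many weights; the added 2 secures third
    order smallness of \<open>E^(2k) \<phi>_a\<close> at the remaining zeros.\<close>
  define k where "k = Max (range K) + 2"
  have k: "k \<ge> K a" for a
  proof -
    have "K a \<le> Max (range K)"
      by (rule Max_ge[OF finite_imageI[OF finite]]) blast
    then show ?thesis unfolding k_def by linarith
  qed
  have k2: "k \<ge> 2" by (simp add: k_def)
  define \<psi> where "\<psi> a x = w k x / n * F x + E x ^ (2 * k) * \<phi> a x" for a x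
  have \<psi>_QM: "QM G (\<psi> a)" for a
  proof (rule insert.IH)
    show "Z \<subseteq> ?S" using insert.prems by auto
    show "is_poly (\<psi> a)"
      unfolding \<psi>_def by (intro is_poly_intros w \<phi> E insert.prems)
    show "quad_growth (\<psi> a) z" if "z \<in> Z" for z
      unfolding \<psi>_def using that k2 by (intro quad_growth_perturb Bgrowth pert) auto
    \<comment> \<open>At \<open>u\<close> the base term vanishes with \<open>F\<close> and leaves
      \<open>\<phi> a u > 0\<close>: this is where one zero disappears.\<close>
    show "\<psi> a x > 0" if x: "x \<in> ?S - Z" for x
    proof (cases "x = u")
      case True
      have "F u = 0" using insert.prems(4)[of u] by (simp add: quad_growth_def)
      then show ?thesis using True E(2) \<phi>(2) by (simp add: \<psi>_def)
    next
      case False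
      then have x': "x \<in> ?S - insert u Z" using x by auto
      have "w 1 x / n * F x \<le> w k x / n * F x"
        using w_mono(2)[of x k] insert.prems(3)[OF x'] n x False k2
        by (intro mult_right_mono divide_right_mono) auto
      then show ?thesis using K[OF k x', of a] by (simp add: \<psi>_def)
    qed
  qed
  have "F x = (E x ^ k)\<^sup>2 * Q x + (\<Sum>a\<in>UNIV. (l a x)\<^sup>2 * \<psi> a x)" for x
  proof -
    have "(\<Sum>a\<in>UNIV. (l a x)\<^sup>2 * \<psi> a x) = (\<Sum>a\<in>UNIV. (l a x)\<^sup>2) * (w k x / n * F x) + E x ^ (2 * k) * (\<Sum>a\<in>UNIV. (l a x)\<^sup>2 * \<phi> a x)"
      by (simp add: \<psi>_def sum_distrib_left sum_distrib_right sum.distrib[symmetric] algebra_simps)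
    also have "(\<Sum>a\<in>UNIV. (l a x)\<^sup>2) * (w k x / n * F x) = (norm (x - u))\<^sup>2 * w k x * F x"
      using n by (simp add: sum_l flip: n_def)
    also have "(norm (x - u))\<^sup>2 * w k x = 1 - E x ^ (2 * k)" using w(2)[of x k] by simp
    finally have s: "(\<Sum>a\<in>UNIV. (l a x)\<^sup>2 * \<psi> a x) = (1 - E x ^ (2 * k)) * F x + E x ^ (2 * k) * (\<Sum>a\<in>UNIV. (l a x)\<^sup>2 * \<phi> a x)" .
    have p: "(E x ^ k)\<^sup>2 = E x ^ (2 * k)" by (simp add: power_mult[symmetric] mult.commute)
    have "(\<Sum>a\<in>UNIV. (l a x)\<^sup>2 * \<phi> a x) = F x - Q x" using F_eq[of x] by simp
    then show ?thesis
      by (simp only: p s) (simp add: algebra_simps)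
  qed
  moreover have "QM G (\<lambda>x. (E x ^ k)\<^sup>2 * Q x + (\<Sum>a\<in>UNIV. (l a x)\<^sup>2 * \<psi> a x))"
    by (intro QM_add QM_sum QM_square_mult QM_sos[OF Q] \<psi>_QM l is_poly_power E)
  ultimately show ?case by presburger
qed

theorem local_global:
  fixes G :: "real^'n::finite \<Rightarrow> real^'m::finite^'m"
  assumes G: "polymat G" "\<forall>x. symmat (G x)" "archimedean G"
    and F: "is_poly F" "\<And>x. x \<in> feasible G \<Longrightarrow> F x \<ge> 0"
    and nice: "\<And>u. u \<in> feasible G \<Longrightarrow> F u = 0 \<Longrightarrow> \<exists>g. QM G g \<and> quad_growth (\<lambda>x. F x - g x) u"
  shows "QM G F"
proof -
  let ?S = "feasible G"
  define Z where "Z = {x \<in> ?S. F x = 0}"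
  have S: "compact ?S" by (rule compact_feasible[OF G])
  have "closed {x. F x = 0}"
    using F(1) by (intro closed_Collect_eq is_poly_continuous continuous_on_const)
  moreover have "Z = ?S \<inter> {x. F x = 0}" by (auto simp: Z_def)
  ultimately have "compact Z" using S by (simp add: compact_Int_closed)
  have "\<exists>r>0. \<forall>x\<in>Z - {u}. norm (x - u) \<ge> r" if u: "u \<in> Z" for u
  proof -
    obtain g where g: "QM G g" "quad_growth (\<lambda>x. F x - g x) u"
      using nice u by (auto simp: Z_def)
    obtain r where r: "r > 0" "\<And>x. x \<noteq> u \<Longrightarrow> norm (x - u) < r \<Longrightarrow> F x - g x > 0"
      using quad_growth_pos[OF g(2)] by blast
    have "norm (x - u) \<ge> r" if "x \<in> Z - {u}" for x
      using r(2)[of x] QM_nonneg[OF g(1), of x] that by (force simp: Z_def)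
    with r(1) show ?thesis by blast
  qed
  then obtain r where r: "\<And>u. u \<in> Z \<Longrightarrow> r u > 0" "\<And>u x. u \<in> Z \<Longrightarrow> x \<in> Z - {u} \<Longrightarrow> norm (x - u) \<ge> r u"
    by metis
  obtain Z' where Z': "Z' \<subseteq> Z" "finite Z'" "Z \<subseteq> (\<Union>u\<in>Z'. ball u (r u))"
    using compactE_image[OF \<open>compact Z\<close>, of Z "\<lambda>u. ball u (r u)"] r(1) by force
  have "Z \<subseteq> Z'"
  proof
    fix x assume x: "x \<in> Z"
    then obtain u where "u \<in> Z'" "norm (x - u) < r u" using Z' by (auto simp: dist_norm norm_minus_commute)
    then show "x \<in> Z'" using r(2)[of u x] x Z' by force
  qed
  then have fin: "finite Z" using Z'(2) finite_subset by blast
  have pos: "F x > 0" if "x \<in> ?S - Z" for x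
    using F(2)[of x] that by (force simp: Z_def)
  obtain h where h: "QM G h" "\<And>x. x \<in> ?S - Z \<Longrightarrow> F x - h x > 0"
    "\<And>u. u \<in> Z \<Longrightarrow> quad_growth (\<lambda>x. F x - h x) u"
    by (rule regularize_zeros[OF G(1) S F(1) pos _ fin]) (use nice in \<open>auto simp: Z_def\<close>)
  have "QM G (\<lambda>x. F x - h x)"
    by (rule quad_growth_QM[OF G fin])
      (use h F QM_is_poly[OF G(1)] in \<open>auto simp: Z_def intro: is_poly_diff\<close>)
  from QM_add[OF this h(1)] show ?thesis by simp
qed

section \<open>Taylor expansion of polynomials\<close>

lemma is_poly_has_derivative:
  fixes p :: "real^'n::finite \<Rightarrow> real"
  assumes "is_poly p"
  shows "\<exists>D. (\<forall>i. is_poly (D i)) \<and> (\<forall>x. (p has_derivative (\<lambda>h. \<Sum>i\<in>UNIV. h $ i * D i x)) (at x))"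
proof -
  have "real_polynomial_function p"
    using assms by (simp add: is_poly_iff)
  then show ?thesis
  proof induction
    case (linear f)
    have "(f has_derivative (\<lambda>h. \<Sum>i\<in>UNIV. h $ i * f (axis i 1))) (at x)" for x
      using bounded_linear_imp_has_derivative[OF linear, of "at x"]
      unfolding linear_vec_expansion[OF bounded_linear.linear[OF linear], symmetric] .
    then show ?case
      by (intro exI[of _ "\<lambda>i x. f (axis i 1)"]) (simp add: is_poly_const)
  next
    case (const c)
    show ?case
      by (intro exI[of _ "\<lambda>i x. 0"]) (simp add: is_poly_const)
  next
    case (add f g)
    then obtain D D' where D: "\<And>i. is_poly (D i)" "\<And>x. (f has_derivative (\<lambda>h. \<Sum>i\<in>UNIV. h $ i * D i x)) (at x)"
      "\<And>i. is_poly (D' i)" "\<And>x. (g has_derivative (\<lambda>h. \<Sum>i\<in>UNIV. h $ i * D' i x)) (at x)"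
      by blast
    have "((\<lambda>x. f x + g x) has_derivative (\<lambda>h. \<Sum>i\<in>UNIV. h $ i * (D i x + D' i x))) (at x)" for x
      using has_derivative_add[OF D(2,4)] by (simp add: distrib_left sum.distrib)
    with D(1,3) show ?case
      by (intro exI[of _ "\<lambda>i x. D i x + D' i x"]) (simp add: is_poly_add)
  next
    case (mult f g)
    then obtain D D' where D: "\<And>i. is_poly (D i)" "\<And>x. (f has_derivative (\<lambda>h. \<Sum>i\<in>UNIV. h $ i * D i x)) (at x)"
      "\<And>i. is_poly (D' i)" "\<And>x. (g has_derivative (\<lambda>h. \<Sum>i\<in>UNIV. h $ i * D' i x)) (at x)"
      by blast
    have "((\<lambda>x. f x * g x) has_derivative (\<lambda>h. \<Sum>i\<in>UNIV. h $ i * (f x * D' i x + D i x * g x))) (at x)" for x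
      using has_derivative_mult[OF D(2,4)]
      by (simp add: distrib_left sum.distrib sum_distrib_left sum_distrib_right mult_ac)
    moreover have "is_poly f" "is_poly g"
      using mult by (simp_all add: is_poly_iff)
    ultimately show ?case
      using D(1,3) by (intro exI[of _ "\<lambda>i x. f x * D' i x + D i x * g x"]) (simp add: is_poly_add is_poly_mult)
  qed
qed

text \<open>Links \<open>partial\<close>, a one-dimensional \<open>deriv\<close> along an axis, to
  the total derivative, whose calculus rules then apply.\<close>

lemma partial_eqI:
  fixes p :: "real^'n::finite \<Rightarrow> real"
  assumes "(p has_derivative (\<lambda>h. \<Sum>i\<in>UNIV. h $ i * D i)) (at x)"
  shows "partial p i x = D i"
proof -
  have "((\<lambda>t. x + t *\<^sub>R axis i 1) has_derivative (\<lambda>t. t *\<^sub>R axis i 1)) (at (0::real))"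
    by (auto intro!: derivative_eq_intros)
  then have A: "((\<lambda>t. p (x + t *\<^sub>R axis i 1)) has_derivative (\<lambda>t. \<Sum>j\<in>UNIV. (t *\<^sub>R axis i 1) $ j * D j)) (at 0)"
    using assms by (intro has_derivative_compose[of _ _ 0 UNIV p]) simp_all
  have B: "(\<Sum>j\<in>UNIV. (t *\<^sub>R axis i 1) $ j * D j) = t * D i" for t :: real
    by (simp add: axis_def if_distrib[of "\<lambda>z. z * _"] if_distrib[of "\<lambda>z. t * z"] cong: if_cong)
  have "((\<lambda>t. p (x + t *\<^sub>R axis i 1)) has_real_derivative D i) (at 0)"
    unfolding has_field_derivative_def
    by (rule has_derivative_eq_rhs[OF A], rule ext) (simp only: B mult.commute[of "D i"])
  then show ?thesis
    unfolding partial_def by (rule DERIV_imp_deriv)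
qed

lemma has_derivative_partial:
  fixes p :: "real^'n::finite \<Rightarrow> real"
  assumes "is_poly p"
  shows "(p has_derivative (\<lambda>h. \<Sum>i\<in>UNIV. h $ i * partial p i x)) (at x)"
proof -
  obtain D where D: "\<And>x. (p has_derivative (\<lambda>h. \<Sum>i\<in>UNIV. h $ i * D i x)) (at x)"
    using is_poly_has_derivative[OF assms] by blast
  have "partial p i x = D i x" for i
    using partial_eqI[OF D] .
  with D[of x] show ?thesis by simp
qed

lemma is_poly_partial:
  assumes "is_poly p"
  shows "is_poly (partial p i)"
proof -
  obtain D where D: "\<And>i. is_poly (D i)" "\<And>x. (p has_derivative (\<lambda>h. \<Sum>i\<in>UNIV. h $ i * D i x)) (at x)"
    using is_poly_has_derivative[OF assms] by blast
  have "partial p i = D i"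
    using partial_eqI[OF D(2)] by blast
  with D(1) show ?thesis by simp
qed

lemma partial_sum:
  fixes f :: "'i \<Rightarrow> real^'n::finite \<Rightarrow> real"
  assumes "\<And>j. j \<in> J \<Longrightarrow> is_poly (f j)"
  shows "partial (\<lambda>x. \<Sum>j\<in>J. c j * f j x) i x = (\<Sum>j\<in>J. c j * partial (f j) i x)"
proof (rule partial_eqI)
  have "((\<lambda>x. \<Sum>j\<in>J. c j * f j x) has_derivative (\<lambda>h. \<Sum>j\<in>J. c j * (\<Sum>i\<in>UNIV. h $ i * partial (f j) i x))) (at x)"
    by (intro has_derivative_sum has_derivative_mult_right has_derivative_partial assms)
  moreover have "(\<Sum>j\<in>J. c j * (\<Sum>i\<in>UNIV. h $ i * partial (f j) i x)) = (\<Sum>i\<in>UNIV. h $ i * (\<Sum>j\<in>J. c j * partial (f j) i x))" for h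
    by (subst sum_distrib_left, subst sum.swap) (simp add: sum_distrib_left mult_ac)
  ultimately show "((\<lambda>x. \<Sum>j\<in>J. c j * f j x) has_derivative (\<lambda>h. \<Sum>i\<in>UNIV. h $ i * (\<Sum>j\<in>J. c j * partial (f j) i x))) (at x)"
    by simp
qed

lemma partial_diff:
  assumes "is_poly f" "is_poly g"
  shows "partial (\<lambda>x. f x - g x) i x = partial f i x - partial g i x"
proof (rule partial_eqI)
  show "((\<lambda>x. f x - g x) has_derivative (\<lambda>h. \<Sum>i\<in>UNIV. h $ i * (partial f i x - partial g i x))) (at x)"
    using has_derivative_diff[OF has_derivative_partial[OF assms(1)] has_derivative_partial[OF assms(2)]]
    by (simp add: right_diff_distrib sum_subtractf)
qed

text \<open>Maclaurin's formula along the segment from \<open>u\<close> to \<open>x\<close>, with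
  the directional operator \<open>D h\<close> iterated; the third partial derivatives are bounded on
  the unit ball, which gives one constant for all directions.\<close>

lemma poly_taylor_2:
  fixes p :: "real^'n::finite \<Rightarrow> real"
  assumes p: "is_poly p"
  shows "ordO u 3 (\<lambda>x. p x - (p u + grad p u \<bullet> (x - u) + 1 / 2 * ((x - u) \<bullet> (hess p u *v (x - u)))))"
proof -
  define D where "D h q x = (\<Sum>i\<in>UNIV. h $ i * partial q i x)" for h :: "real^'n" and q x
  have D_poly: "is_poly (D h q)" if "is_poly q" for h q
    unfolding D_def by (intro is_poly_intros is_poly_partial that)
  have D_line: "((\<lambda>t. q (u + t *\<^sub>R h)) has_real_derivative D h q (u + t *\<^sub>R h)) (at t)" if "is_poly q" for q h t
  proof -
    have "((\<lambda>t. u + t *\<^sub>R h) has_derivative (\<lambda>t. t *\<^sub>R h)) (at t)"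
      by (auto intro!: derivative_eq_intros)
    from has_derivative_compose[OF this has_derivative_partial[OF that]] show ?thesis
      unfolding has_field_derivative_def
      by (rule has_derivative_eq_rhs) (simp add: fun_eq_iff D_def sum_distrib_left sum_distrib_right mult_ac)
  qed
  have D1: "partial (D h q) j = (\<lambda>x. \<Sum>i\<in>UNIV. h $ i * partial (partial q i) j x)" if "is_poly q" for h q j
    unfolding D_def by (intro ext partial_sum is_poly_partial that)
  have D2: "D h (D h p) x = (\<Sum>j\<in>UNIV. \<Sum>i\<in>UNIV. h $ j * h $ i * partial (partial p i) j x)" for h x
    unfolding D_def[of h "D h p"] D1[OF p] by (simp only: sum_distrib_left mult.assoc)
  have "partial (partial (D h p) j) k x = (\<Sum>i\<in>UNIV. h $ i * partial (partial (partial p i) j) k x)" for h j k x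
    unfolding D1[OF p] by (intro partial_sum is_poly_partial p)
  then have D3: "D h (D h (D h p)) x = (\<Sum>k\<in>UNIV. \<Sum>j\<in>UNIV. \<Sum>i\<in>UNIV. h $ k * h $ j * h $ i * partial (partial (partial p i) j) k x)" for h x
    unfolding D_def[of h "D h (D h p)"] D1[OF D_poly[OF p]] by (simp only: sum_distrib_left mult.assoc)
  have "\<exists>C. C > 0 \<and> (\<forall>x\<in>cball u 1. \<bar>partial (partial (partial p i) j) k x\<bar> \<le> C)" for i j k
  proof -
    have "is_poly (partial (partial (partial p i) j) k)"
      by (intro is_poly_partial p)
    from is_poly_bounded_on_compact[OF this compact_cball[of u 1]] show ?thesis
      by metis
  qed
  then obtain C where C: "\<And>i j k. C i j k > 0" "\<And>i j k x. x \<in> cball u 1 \<Longrightarrow> \<bar>partial (partial (partial p i) j) k x\<bar> \<le> C i j k"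
    by metis
  define A where "A = (\<Sum>k\<in>UNIV. \<Sum>j\<in>UNIV. \<Sum>i\<in>UNIV. C i j k)"
  have "\<bar>p x - (p u + grad p u \<bullet> (x - u) + 1 / 2 * ((x - u) \<bullet> (hess p u *v (x - u))))\<bar> \<le> A * norm (x - u) ^ 3"
    if x: "norm (x - u) \<le> 1" for x
  proof -
    define h where "h = x - u"
    define diff where "diff m t = ((D h ^^ m) p) (u + t *\<^sub>R h)" for m t
    have "is_poly ((D h ^^ m) p)" for m
      by (induction m) (auto intro: p D_poly)
    then have "(diff m has_real_derivative diff (Suc m) t) (at t)" for m t
      unfolding diff_def using D_line[of "(D h ^^ m) p" h t] by simp
    then obtain s where s: "0 < s" "s < 1" "diff 0 1 = (\<Sum>m<3. diff m 0 / fact m * 1 ^ m) + diff 3 s / fact 3 * 1 ^ 3"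
      using Maclaurin[of 1 3 diff "diff 0"] by auto
    have "diff 0 1 = p x" "diff 0 0 = p u" by (simp_all add: diff_def h_def)
    moreover have "diff 1 0 = grad p u \<bullet> h"
      by (simp add: diff_def D_def grad_def inner_vec_def mult.commute)
    moreover have "diff 2 0 = h \<bullet> (hess p u *v h)"
    proof -
      have "diff 2 0 = (\<Sum>j\<in>UNIV. \<Sum>i\<in>UNIV. h $ j * h $ i * partial (partial p i) j u)"
        by (simp add: diff_def numeral_2_eq_2 D2)
      also have "\<dots> = (\<Sum>i\<in>UNIV. \<Sum>j\<in>UNIV. h $ j * h $ i * partial (partial p i) j u)"
        by (rule sum.swap)
      finally show ?thesis
        by (simp add: inner_matrix_eq_sum hess_def mult_ac)
    qed
    moreover have "\<bar>diff 3 s\<bar> \<le> A * norm h ^ 3"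
    proof -
      have y: "u + s *\<^sub>R h \<in> cball u 1"
        using s x mult_mono[of s 1 "norm h" 1] by (simp add: dist_norm h_def)
      have "diff 3 s = (\<Sum>k\<in>UNIV. \<Sum>j\<in>UNIV. \<Sum>i\<in>UNIV. h $ k * h $ j * h $ i * partial (partial (partial p i) j) k (u + s *\<^sub>R h))"
        by (simp add: diff_def numeral_3_eq_3 D3)
      also have "\<bar>\<dots>\<bar> \<le> (\<Sum>k\<in>UNIV. \<Sum>j\<in>UNIV. \<Sum>i\<in>UNIV. norm h ^ 3 * C i j k)"
      proof (intro order_trans[OF sum_abs] sum_mono)
        fix i j k
        have "\<bar>h $ k\<bar> * \<bar>h $ j\<bar> * \<bar>h $ i\<bar> * \<bar>partial (partial (partial p i) j) k (u + s *\<^sub>R h)\<bar> \<le> norm h * norm h * norm h * C i j k"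
          by (intro mult_mono component_le_norm_cart C y) auto
        then show "\<bar>h $ k * h $ j * h $ i * partial (partial (partial p i) j) k (u + s *\<^sub>R h)\<bar> \<le> norm h ^ 3 * C i j k"
          by (simp add: abs_mult power3_eq_cube)
      qed
      finally show ?thesis by (simp add: A_def sum_distrib_left mult.commute)
    qed
    moreover have "A * norm h ^ 3 \<ge> 0"
      unfolding A_def using C(1) by (intro mult_nonneg_nonneg sum_nonneg) (auto intro: less_imp_le)
    moreover have "p x = p u + grad p u \<bullet> h + diff 2 0 / 2 + diff 3 s / 6"
      using s(3) calculation(1-3) by (simp add: numeral_3_eq_3 numeral_2_eq_2 lessThan_Suc fact_numeral)
    ultimately show ?thesis
      unfolding h_def[symmetric] by (simp add: abs_le_iff)
  qed
  moreover have "A \<ge> 0"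
    unfolding A_def using C(1) by (intro sum_nonneg) (auto intro: less_imp_le)
  ultimately show ?thesis
    unfolding ordO_def by blast
qed

lemma poly_taylor_1:
  fixes p :: "real^'n::finite \<Rightarrow> real"
  assumes p: "is_poly p"
  shows "ordO u 2 (\<lambda>x. p x - (p u + grad p u \<bullet> (x - u)))"
proof -
  have "ordO u (1 + 1 + 0) (\<lambda>x. (x $ i - u $ i) * (x $ j - u $ j) * (1 / 2 * hess p u $ i $ j))" for i j
    by (intro ordO_mult ordO_component ordO_const)
  then have "ordO u 2 (\<lambda>x. \<Sum>i\<in>UNIV. \<Sum>j\<in>UNIV. (x $ i - u $ i) * (x $ j - u $ j) * (1 / 2 * hess p u $ i $ j))"
    by (intro ordO_sum) (simp add: numeral_2_eq_2)
  then have "ordO u 2 (\<lambda>x. 1 / 2 * ((x - u) \<bullet> (hess p u *v (x - u))))"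
    by (simp add: inner_matrix_eq_sum sum_distrib_left mult_ac)
  from ordO_add[OF ordO_weaken[OF poly_taylor_2[OF p]] this] show ?thesis by (simp add: algebra_simps)
qed

section \<open>Pseudoinverses and multipliers\<close>

text \<open>From \<open>A ** X = (A ** Y) ** (A ** X)\<close>, transposition gives
  \<open>A ** X = (A ** X) ** (A ** Y) = A ** Y\<close>; likewise on the other side.\<close>

lemma moore_penrose_unique:
  fixes A X Y :: "real^'m::finite^'m"
  assumes X: "A ** X ** A = A" "X ** A ** X = X" "transpose (A ** X) = A ** X" "transpose (X ** A) = X ** A"
    and Y: "A ** Y ** A = A" "Y ** A ** Y = Y" "transpose (A ** Y) = A ** Y" "transpose (Y ** A) = Y ** A"
  shows "X = Y"
proof -
  have "A ** X = (A ** Y) ** (A ** X)"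
    by (metis Y(1) matrix_mul_assoc)
  then have "A ** X = transpose ((A ** X) ** (A ** Y))"
    by (simp only: matrix_transpose_mul[of "A ** X"] X(3) Y(3))
  then have AX: "A ** X = A ** Y"
    by (metis X(1) Y(3) matrix_mul_assoc)
  have "X ** A = (X ** A) ** (Y ** A)"
    by (metis Y(1) matrix_mul_assoc)
  then have "X ** A = transpose ((Y ** A) ** (X ** A))"
    by (simp only: matrix_transpose_mul[of "Y ** A"] X(4) Y(4))
  then have XA: "X ** A = Y ** A"
    by (metis X(1) Y(4) matrix_mul_assoc)
  have "X = X ** (A ** X)" using X(2) by (simp add: matrix_mul_assoc)
  also have "\<dots> = (Y ** A) ** Y" unfolding AX by (simp add: matrix_mul_assoc XA)
  finally show ?thesis using Y(2) by simp
qed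

text \<open>For symmetric \<open>A\<close> the orthogonal complement of the range is the kernel, so
  \<open>A\<close> and its square have the same range. This replaces a diagonalization.\<close>

lemma symmetric_range_square:
  fixes A :: "real^'m::finite^'m"
  assumes "symmat A"
  obtains C where "A ** A ** C = A"
proof -
  have "\<exists>c. A *v (A *v c) = A *v e" for e
  proof -
    obtain y z where yz: "y \<in> span (range ((*v) A))" "\<And>w. w \<in> span (range ((*v) A)) \<Longrightarrow> orthogonal z w" "e = y + z"
      using orthogonal_subspace_decomp_exists[of "range ((*v) A)" e] by blast
    have "subspace (range ((*v) A))"
      by (rule linear_subspace_image[OF matrix_vector_mul_linear subspace_UNIV])
    then have "y \<in> range ((*v) A)" using yz(1) by (simp add: span_eq_iff[THEN iffD2])
    then obtain c where c: "y = A *v c" by blast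
    have "z \<bullet> (A *v (A *v z)) = 0"
      using yz(2)[of "A *v (A *v z)"] by (simp add: span_base orthogonal_def)
    then have "A *v z = 0"
      using symmat_inner[OF assms, of z "A *v z"] by simp
    then show ?thesis using c yz(3) by (auto simp: matrix_vector_right_distrib)
  qed
  then obtain g where g: "\<And>e. A *v (A *v g e) = A *v e" by metis
  define C where "C = (\<chi> i j. g (axis j 1) $ i)"
  have "C *v axis j 1 = g (axis j 1)" for j
    by (simp add: matrix_vector_mul_component vec_eq_iff C_def inner_axis)
  then have "(A ** A ** C) *v axis j 1 = A *v axis j 1" for j
    by (simp add: matrix_vector_mul_assoc[symmetric] g)
  then have "A ** A ** C = A"
    by (metis (mono_tags, lifting) matrix_vector_mult_basis vec_eq_iff column_def vec_lambda_beta)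
  with that show ?thesis .
qed

text \<open>With \<open>A ** A ** C = A\<close>, the matrix \<open>P = A ** C\<close> is the
  orthogonal projection onto the range of \<open>A\<close>, and \<open>transpose C ** A ** C\<close>
  satisfies all four Penrose equations.\<close>

lemma pinv_symmetric:
  fixes A :: "real^'m::finite^'m"
  assumes A: "symmat A"
  shows "A ** pinv A ** A = A" "pinv A ** A ** pinv A = pinv A"
    "A ** pinv A = pinv A ** A" "symmat (pinv A)"
proof -
  obtain C where C: "A ** A ** C = A"
    using symmetric_range_square[OF A] by blast
  have tA: "transpose A = A" using A by (simp add: symmat_def)
  define P where "P = A ** C"
  have tP: "transpose P = transpose C ** A" by (simp add: P_def matrix_transpose_mul tA)
  have AP: "A ** P = A" using C by (simp add: P_def matrix_mul_assoc)
  have "transpose P ** P = (transpose P ** A) ** C" by (simp add: P_def matrix_mul_assoc)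
  also have "transpose P ** A = A"
    using arg_cong[OF AP, of transpose] by (simp add: matrix_transpose_mul tA)
  finally have "transpose P ** P = P" by (simp add: P_def)
  then have symP: "transpose P = P"
    by (metis matrix_transpose_mul transpose_transpose)
  have PA: "P ** A = A" using \<open>transpose P ** A = A\<close> symP by simp
  have PP: "P ** P = P" using \<open>transpose P ** P = P\<close> symP by simp
  have CA: "transpose C ** A = P" using tP symP by simp
  define X where "X = transpose C ** A ** C"
  have X1: "X = P ** C" by (simp add: X_def CA)
  have X2: "X = transpose C ** P" by (simp add: X_def P_def matrix_mul_assoc)
  have AX: "A ** X = P" by (simp add: X1 matrix_mul_assoc AP) (simp add: P_def)
  have XA: "X ** A = P" by (simp add: X2 matrix_mul_assoc[symmetric] PA CA)
  have XAX: "X ** A ** X = X" by (simp add: XA) (simp add: X1 matrix_mul_assoc PP)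
  have AXA: "A ** X ** A = A" by (simp add: AX PA)
  have "pinv A = X"
    unfolding pinv_def
  proof (rule the_equality)
    show "A ** X ** A = A \<and> X ** A ** X = X \<and> transpose (A ** X) = A ** X \<and> transpose (X ** A) = X ** A"
      using AXA XAX AX XA symP by simp
    show "Y = X" if "A ** Y ** A = A \<and> Y ** A ** Y = Y \<and> transpose (A ** Y) = A ** Y \<and> transpose (Y ** A) = Y ** A" for Y
      using that by (intro moore_penrose_unique[of A Y X]) (use AXA XAX AX XA symP in simp_all)
  qed
  moreover have "symmat X"
    by (simp add: symmat_def X_def matrix_transpose_mul tA matrix_mul_assoc)
  ultimately show "A ** pinv A ** A = A" "pinv A ** A ** pinv A = pinv A"
    "A ** pinv A = pinv A ** A" "symmat (pinv A)"
    using AXA XAX AX XA by simp_all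
qed

section \<open>Kernel bases, complementarity and uniqueness of multipliers\<close>

lemma ker_basis_exists:
  fixes A :: "real^'m::finite^'m"
  obtains es where "ker_basis A es"
proof -
  have sub: "subspace {v. A *v v = 0}"
    by (auto simp: subspace_def matrix_vector_right_distrib matrix_vector_mult_scaleR)
  obtain B where B: "B \<subseteq> {v. A *v v = 0}" "independent B" "{v. A *v v = 0} \<subseteq> span B"
    by (rule maximal_independent_subset[of "{v. A *v v = 0}"])
  have "finite B" using B(2) by (rule independent_imp_finite)
  then obtain es where es: "set es = B" "distinct es" using finite_distinct_list by blast
  have "span B = {v. A *v v = 0}"
    using B span_minimal[OF B(1) sub] by blast
  with es B that show ?thesis by (auto simp: ker_basis_def)
qed

text \<open>Bilinearity turns a condition on basis vectors into one on the kernel, so the choice of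
  basis in NDC and in the critical cone is immaterial.\<close>

lemma EtNE_zero_iff:
  assumes "ker_basis A es"
  shows "EtNE_zero es N \<longleftrightarrow> (\<forall>x y. A *v x = 0 \<longrightarrow> A *v y = 0 \<longrightarrow> x \<bullet> (N *v y) = 0)"
proof
  assume N: "EtNE_zero es N"
  have sp: "span (set es) = {v. A *v v = 0}" using assms by (simp add: ker_basis_def)
  have 1: "x \<bullet> (N *v y) = 0" if "x \<in> span (set es)" "y \<in> set es" for x y
    using that(1)
    by (induction rule: span_induct_alt) (use N that(2) in \<open>auto simp: EtNE_zero_def inner_add_left\<close>)
  have 2: "x \<bullet> (N *v y) = 0" if "x \<in> span (set es)" "y \<in> span (set es)" for x y
    using that(2)
    by (induction rule: span_induct_alt)
      (use 1 that(1) in \<open>auto simp: matrix_vector_right_distrib matrix_vector_mult_scaleR inner_add_right\<close>)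
  show "\<forall>x y. A *v x = 0 \<longrightarrow> A *v y = 0 \<longrightarrow> x \<bullet> (N *v y) = 0"
    using 2 sp by blast
next
  assume *: "\<forall>x y. A *v x = 0 \<longrightarrow> A *v y = 0 \<longrightarrow> x \<bullet> (N *v y) = 0"
  have "A *v e = 0" if "e \<in> set es" for e
    using assms that span_base[of e "set es"] by (auto simp: ker_basis_def)
  with * show "EtNE_zero es N" by (simp add: EtNE_zero_def)
qed

text \<open>Writing the multiplier through vectors makes the term \<open>matinner L (G x)\<close> of
  the Lagrangian a sum of generators \<open>v \<bullet> (G x *v v)\<close> of the quadratic
  module.\<close>

lemma matinner_sum_outer:
  assumes "\<And>x. L *v x = (\<Sum>v\<leftarrow>vs. (v \<bullet> x) *\<^sub>R v)"
  shows "matinner L X = (\<Sum>v\<leftarrow>vs. v \<bullet> (X *v v))"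
proof -
  have sl: "(\<Sum>v\<leftarrow>ws. h v) $ a = (\<Sum>v\<leftarrow>ws. h v $ a)" for ws :: "(real^'a) list" and h :: "real^'a \<Rightarrow> real^'a" and a
    by (induction ws) auto
  have L: "L $ a $ b = (\<Sum>v\<leftarrow>vs. v $ a * v $ b)" for a b
  proof -
    have "L $ a $ b = (L *v axis b 1) $ a"
      by (simp add: matrix_vector_mul_component inner_axis)
    also have "\<dots> = (\<Sum>v\<leftarrow>vs. v $ a * v $ b)"
      unfolding assms by (simp add: sl inner_axis mult.commute)
    finally show ?thesis .
  qed
  have "(\<Sum>a\<in>UNIV. \<Sum>b\<in>UNIV. (\<Sum>v\<leftarrow>ws. v $ a * v $ b) * X $ a $ b) = (\<Sum>v\<leftarrow>ws. v \<bullet> (X *v v))" for ws :: "(real^'a) list"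
    by (induction ws) (auto simp: distrib_right sum.distrib inner_matrix_eq_sum)
  then show ?thesis by (simp add: matinner_def L)
qed

lemma matinner_eq_inner: "matinner X Y = X \<bullet> Y"
  by (simp add: matinner_def inner_vec_def)

lemma matinner_add_right: "matinner L (X + Y) = matinner L X + matinner L Y"
  by (simp add: matinner_def distrib_left sum.distrib)

lemma matinner_sum_right: "matinner L (\<Sum>i\<in>I. c i *\<^sub>R X i) = (\<Sum>i\<in>I. c i * matinner L (X i))"
proof -
  have "matinner L (c *\<^sub>R Y) = c * matinner L Y" for c Y
    by (simp add: matinner_def sum_distrib_left mult_ac)
  moreover have "matinner L 0 = 0" by (simp add: matinner_def)
  ultimately show ?thesis
    by (induction I rule: infinite_finite_induct) (auto simp: matinner_add_right)
qed

text \<open>Complementarity is a vanishing sum of nonnegative terms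
  \<open>v \<bullet> (G u *v v)\<close>, so each of them vanishes, and semidefiniteness puts
  \<open>v\<close> into the kernel.\<close>

lemma KKT_kernel:
  assumes "KKT f G u L" "psd (G u)" "\<And>x. L *v x = (\<Sum>v\<leftarrow>vs. (v \<bullet> x) *\<^sub>R v)" "v \<in> set vs"
  shows "G u *v v = 0"
proof -
  have "(\<Sum>v\<leftarrow>vs. v \<bullet> (G u *v v)) = 0"
    using assms(1) matinner_sum_outer[OF assms(3)] by (simp add: KKT_def)
  then have "v \<bullet> (G u *v v) = 0"
    using assms(2,4) by (subst (asm) sum_list_nonneg_eq_0_iff) (auto simp: psd_def)
  then show ?thesis by (rule psd_inner_eq_0[OF assms(2)])
qed

lemma KKT_grad_inner:
  assumes "KKT f G u L"
  shows "grad f u \<bullet> d = matinner L (DG G u d)"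
proof -
  have sym: "matinner X Y = matinner Y X" for X Y :: "real^'b^'b"
    by (simp add: matinner_def mult.commute)
  have "grad f u = DG_adj G u L" using assms by (simp add: KKT_def)
  then show ?thesis
    by (simp add: DG_adj_def inner_vec_def DG_def matinner_sum_right sym[of L] mult.commute)
qed

lemma NDC_surjective:
  fixes G :: "real^'n::finite \<Rightarrow> real^'m::finite^'m"
  assumes "NDC G u" "symmat X"
  shows "\<exists>d B. X = DG G u d + B \<and> (\<forall>x y. G u *v x = 0 \<longrightarrow> G u *v y = 0 \<longrightarrow> x \<bullet> (B *v y) = 0)"
proof -
  obtain es where es: "ker_basis (G u) es" using ker_basis_exists by blast
  then have "X \<in> {A + B | A B. A \<in> range (DG G u) \<and> symmat B \<and> EtNE_zero es B}"
    using assms by (simp add: NDC_def)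
  then obtain d B where "X = DG G u d + B" "symmat B" "EtNE_zero es B" by blast
  then show ?thesis unfolding EtNE_zero_iff[OF es] by blast
qed

text \<open>Multiplier vectors lie in the kernel of \<open>G u\<close>, so a multiplier annihilates
  the part \<open>B\<close> in NDC and its pairing with \<open>X = DG G u d + B\<close> must be
  \<open>grad f u \<bullet> d\<close>. Testing with \<open>X = L - M\<close> gives the
  claim.\<close>

lemma KKT_unique:
  fixes G :: "real^'n::finite \<Rightarrow> real^'m::finite^'m"
  assumes "NDC G u" "psd (G u)" "KKT f G u L" "KKT f G u M"
  shows "L = M"
proof -
  have eq: "matinner K X = grad f u \<bullet> d"
    if "KKT f G u K" "X = DG G u d + B" "\<forall>x y. G u *v x = 0 \<longrightarrow> G u *v y = 0 \<longrightarrow> x \<bullet> (B *v y) = 0" for K X d B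
  proof -
    have "psd K" using that(1) by (simp add: KKT_def)
    then obtain vs where vs: "\<And>x. K *v x = (\<Sum>v\<leftarrow>vs. (v \<bullet> x) *\<^sub>R v)" using psd_sum_outer by blast
    have "map (\<lambda>v. v \<bullet> (B *v v)) vs = map (\<lambda>v. 0) vs"
      using KKT_kernel[OF that(1) assms(2) vs] that(3) by simp
    then have "matinner K B = 0"
      using matinner_sum_outer[OF vs, of B] by (metis sum_list_0)
    then show ?thesis
      using KKT_grad_inner[OF that(1)] by (simp add: that(2) matinner_add_right)
  qed
  have "symmat (L - M)"
    using assms(3,4) by (simp add: KKT_def symmat_def transpose_def vec_eq_iff)
  from NDC_surjective[OF assms(1) this] have "matinner L (L - M) = matinner M (L - M)"
    using eq[OF assms(3)] eq[OF assms(4)] by metis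
  then have "(L - M) \<bullet> (L - M) = 0"
    by (simp add: matinner_eq_inner inner_diff_left)
  then show ?thesis by simp
qed

section \<open>Existence of multipliers\<close>

lemma linear_DG: "linear (DG G u)"
  by (simp add: linear_iff DG_def scaleR_add_left sum.distrib scaleR_sum_right)

lemma DG_component: "DG G u d $ a $ b = grad (\<lambda>x. G x $ a $ b) u \<bullet> d"
  by (simp add: DG_def dG_def grad_def inner_vec_def mult.commute)

lemma DG_mult_vec: "DG G u h *v v = (\<Sum>i\<in>UNIV. h $ i *\<^sub>R (dG G i u *v v))"
proof -
  have "(\<Sum>i\<in>I. h $ i *\<^sub>R dG G i u) *v v = (\<Sum>i\<in>I. h $ i *\<^sub>R (dG G i u *v v))" for I
    by (induction I rule: infinite_finite_induct)
      (simp_all add: matrix_vector_mult_add_rdistrib scaleR_matrix_vector_assoc)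
  then show ?thesis by (simp add: DG_def)
qed

lemma symmat_dG:
  assumes "\<forall>x. symmat (G x)"
  shows "symmat (dG G i u)"
proof -
  have "G x $ a $ b = G x $ b $ a" for x a b
    using assms by (simp add: symmat_def transpose_def vec_eq_iff)
  then have "(\<lambda>x. G x $ a $ b) = (\<lambda>x. G x $ b $ a)" for a b by blast
  then show ?thesis by (simp add: symmat_def transpose_def dG_def vec_eq_iff)
qed

lemma polymat_taylor_1:
  assumes "polymat G"
  shows "ordO u 2 (\<lambda>x. (G x - G u - DG G u (x - u)) $ a $ b)"
  using poly_taylor_1[of "\<lambda>x. G x $ a $ b" u] assms by (simp add: polymat_def DG_component diff_diff_eq)

lemma ordO_abs: "ordO u k d \<Longrightarrow> ordO u k (\<lambda>x. \<bar>d x\<bar>)"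
  by (simp add: ordO_def)

lemma ordO_sum_list: "(\<And>v. v \<in> set vs \<Longrightarrow> ordO u k (d v)) \<Longrightarrow> ordO u k (\<lambda>x. \<Sum>v\<leftarrow>vs. d v x)"
  by (induction vs) (auto intro: ordO_0 ordO_add)

lemma ordO_bilinear:
  assumes "\<And>a. ordO u j (\<lambda>x. p x $ a)" "\<And>a b. ordO u k (\<lambda>x. M x $ a $ b)" "\<And>b. ordO u l (\<lambda>x. q x $ b)"
  shows "ordO u (j + k + l) (\<lambda>x. p x \<bullet> (M x *v q x))"
proof -
  have "p x \<bullet> (M x *v q x) = (\<Sum>a\<in>UNIV. \<Sum>b\<in>UNIV. p x $ a * M x $ a $ b * q x $ b)" for x
    by (simp add: inner_vec_def matrix_vector_mult_def sum_distrib_left mult_ac)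
  moreover have "ordO u (j + k + l) (\<lambda>x. \<Sum>a\<in>UNIV. \<Sum>b\<in>UNIV. p x $ a * M x $ a $ b * q x $ b)"
    by (intro ordO_sum ordO_mult assms)
  ultimately show ?thesis by presburger
qed

lemma unit_quad_form_le:
  fixes v :: "real^'m::finite"
  assumes "norm v = 1"
  shows "\<bar>v \<bullet> (M *v v)\<bar> \<le> (\<Sum>a\<in>UNIV. \<Sum>b\<in>UNIV. \<bar>M $ a $ b\<bar>)"
  unfolding inner_matrix_eq_sum
proof (intro order_trans[OF sum_abs] sum_mono)
  fix a b
  have "\<bar>v $ a\<bar> \<le> 1" "\<bar>v $ b\<bar> \<le> 1"
    using component_le_norm_cart[of v] assms by auto
  then have "\<bar>v $ a\<bar> * \<bar>v $ b\<bar> * \<bar>M $ a $ b\<bar> \<le> 1 * 1 * \<bar>M $ a $ b\<bar>"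
    by (intro mult_mono) auto
  then show "\<bar>v $ a * v $ b * M $ a $ b\<bar> \<le> \<bar>M $ a $ b\<bar>"
    by (simp add: abs_mult)
qed

lemma continuous_quad_form: "continuous_on S (\<lambda>v. v \<bullet> (M *v v))" for M :: "real^'m::finite^'m"
  by (intro continuous_intros linear_continuous_on matrix_vector_mul_bounded_linear)

text \<open>Although \<open>d\<close> is controlled only on the kernel of \<open>G u\<close>, adding
  a multiple of \<open>G u\<close> makes its derivative uniformly positive on the unit sphere. The
  gain \<open>t * \<delta>\<close> then beats the second order remainder of
  \<open>G\<close>.\<close>

lemma feasible_direction:
  fixes G :: "real^'n::finite \<Rightarrow> real^'m::finite^'m"
  assumes G: "polymat G" "\<forall>x. symmat (G x)" "psd (G u)"
    and pos: "\<And>y. y \<noteq> 0 \<Longrightarrow> G u *v y = 0 \<Longrightarrow> y \<bullet> (DG G u d *v y) > 0"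
  obtains t0 where "t0 > 0" "\<And>t. 0 < t \<Longrightarrow> t \<le> t0 \<Longrightarrow> u + t *\<^sub>R d \<in> feasible G"
proof -
  have "\<exists>l \<delta>. l \<ge> 0 \<and> \<delta> > 0 \<and> (\<forall>v\<in>sphere 0 1. v \<bullet> (DG G u d *v v) + l * (v \<bullet> (G u *v v)) \<ge> \<delta>)"
  proof (rule exact_penalty[OF compact_sphere continuous_quad_form continuous_quad_form])
    show "v \<bullet> (G u *v v) \<ge> 0" for v using G(3) by (simp add: psd_def)
    show "v \<bullet> (DG G u d *v v) > 0" if "v \<in> sphere 0 1" "v \<bullet> (G u *v v) = 0" for v
      using that by (intro pos psd_inner_eq_0[OF G(3)]) auto
  qed blast
  then obtain l \<delta> where l: "l \<ge> 0" "\<delta> > 0"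
    "\<And>v. norm v = 1 \<Longrightarrow> v \<bullet> (DG G u d *v v) + l * (v \<bullet> (G u *v v)) \<ge> \<delta>"
    by auto
  define R where "R x = G x - G u - DG G u (x - u)" for x
  have "ordO u 2 (\<lambda>x. \<Sum>a\<in>UNIV. \<Sum>b\<in>UNIV. \<bar>R x $ a $ b\<bar>)"
    unfolding R_def by (intro ordO_sum ordO_abs polymat_taylor_1 G)
  then obtain C where C: "C \<ge> 0" "\<And>x. norm (x - u) \<le> 1 \<Longrightarrow> (\<Sum>a\<in>UNIV. \<Sum>b\<in>UNIV. \<bar>R x $ a $ b\<bar>) \<le> C * (norm (x - u))\<^sup>2"
    unfolding ordO_def by (metis abs_le_iff)
  \<comment> \<open>The three bounds let \<open>G u\<close> pay for the penalty
    \<open>t * l\<close>, keep the point in the unit ball around \<open>u\<close>, and keep the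
    remainder below \<open>t * \<delta>\<close>.\<close>
  define t0 where "t0 = min (1 / (l + 1)) (min (1 / (norm d + 1)) (\<delta> / (C * (norm d)\<^sup>2 + 1)))"
  have den: "l + 1 > 0" "norm d + 1 > 0" "C * (norm d)\<^sup>2 + 1 > 0"
    using l(1) C(1) by (simp_all add: add_nonneg_pos)
  show ?thesis
  proof (rule that[of t0])
    show "t0 > 0" using den l(2) by (simp add: t0_def)
    fix t assume t: "0 < t" "t \<le> t0"
    have "t \<le> 1 / (l + 1)" "t \<le> 1 / (norm d + 1)" "t \<le> \<delta> / (C * (norm d)\<^sup>2 + 1)"
      using t(2) by (simp_all add: t0_def)
    then have t': "t * (l + 1) \<le> 1" "t * (norm d + 1) \<le> 1" "t * (C * (norm d)\<^sup>2 + 1) \<le> \<delta>"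
      using den by (simp_all add: pos_le_divide_eq)
    let ?x = "u + t *\<^sub>R d"
    have unit: "v \<bullet> (G ?x *v v) \<ge> 0" if v: "norm v = 1" for v
    proof -
      have "G ?x = G u + t *\<^sub>R DG G u d + R ?x"
        by (simp add: R_def linear_cmul[OF linear_DG])
      then have eq: "v \<bullet> (G ?x *v v) = v \<bullet> (G u *v v) + t * (v \<bullet> (DG G u d *v v)) + v \<bullet> (R ?x *v v)"
        by (simp add: matrix_vector_mult_add_rdistrib inner_add_right scaleR_matrix_vector_assoc[symmetric])
      have nx: "norm (?x - u) = t * norm d" using t by simp
      have "t * norm d \<le> 1" using t t' by (simp add: distrib_left)
      then have "\<bar>v \<bullet> (R ?x *v v)\<bar> \<le> C * (t * norm d)\<^sup>2"
        using unit_quad_form_le[OF v, of "R ?x"] C(2)[of ?x, unfolded nx] by linarith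
      then have 1: "v \<bullet> (R ?x *v v) \<ge> - (t * (t * (C * (norm d)\<^sup>2)))"
        by (simp add: abs_le_iff power2_eq_square mult_ac)
      have "t * \<delta> \<le> t * (v \<bullet> (DG G u d *v v) + l * (v \<bullet> (G u *v v)))"
        using l(3)[OF v] t by (intro mult_left_mono) auto
      moreover have "(t * l) * (v \<bullet> (G u *v v)) \<le> 1 * (v \<bullet> (G u *v v))"
        using t' t G(3) by (intro mult_right_mono) (auto simp: distrib_left psd_def)
      ultimately have 2: "v \<bullet> (G u *v v) + t * (v \<bullet> (DG G u d *v v)) \<ge> t * \<delta>"
        by (simp add: distrib_left mult_ac)
      have "t * (t * (C * (norm d)\<^sup>2)) \<le> t * \<delta>"
        using t' t by (intro mult_left_mono) (auto simp: distrib_left)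
      with 1 2 show ?thesis unfolding eq by linarith
    qed
    have "v \<bullet> (G ?x *v v) \<ge> 0" for v
    proof (cases "v = 0")
      case False
      define w where "w = (1 / norm v) *\<^sub>R v"
      have "norm w = 1" using False by (simp add: w_def)
      moreover have "w \<bullet> (G ?x *v w) = (1 / norm v)\<^sup>2 * (v \<bullet> (G ?x *v v))"
        by (simp add: w_def matrix_vector_mult_scaleR power2_eq_square)
      ultimately have "0 \<le> (1 / norm v)\<^sup>2 * (v \<bullet> (G ?x *v v))" using unit[of w] by simp
      moreover have "0 < (1 / norm v)\<^sup>2" using False by simp
      ultimately show ?thesis by (simp only: zero_le_mult_iff) auto
    qed simp
    then show "?x \<in> feasible G" using G(2) by (simp add: feasible_def psd_def)
  qed
qed

lemma minimizer_direction:
  fixes G :: "real^'n::finite \<Rightarrow> real^'m::finite^'m"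
  assumes G: "polymat G" "\<forall>x. symmat (G x)" and f: "is_poly f" and u: "minimizer f G u"
    and pos: "\<And>y. y \<noteq> 0 \<Longrightarrow> G u *v y = 0 \<Longrightarrow> y \<bullet> (DG G u d *v y) > 0"
  shows "grad f u \<bullet> d \<ge> 0"
proof (rule ccontr)
  assume neg: "\<not> grad f u \<bullet> d \<ge> 0"
  have psd: "psd (G u)" using u by (simp add: minimizer_def feasible_def)
  obtain t0 where t0: "t0 > 0" "\<And>t. 0 < t \<Longrightarrow> t \<le> t0 \<Longrightarrow> u + t *\<^sub>R d \<in> feasible G"
    using feasible_direction[OF G psd pos] by blast
  obtain C where C: "C \<ge> 0" "\<And>x. norm (x - u) \<le> 1 \<Longrightarrow> \<bar>f x - (f u + grad f u \<bullet> (x - u))\<bar> \<le> C * (norm (x - u))\<^sup>2"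
    using poly_taylor_1[OF f, of u] unfolding ordO_def by blast
  define s where "s = - (grad f u \<bullet> d)"
  have s: "s > 0" using neg by (simp add: s_def)
  define t where "t = min t0 (min (1 / (norm d + 1)) (s / (2 * (C * (norm d)\<^sup>2 + 1))))"
  have den: "norm d + 1 > 0" "C * (norm d)\<^sup>2 + 1 > 0"
    using C(1) by (simp_all add: add_nonneg_pos)
  have "t > 0" using den s t0 by (simp add: t_def)
  have "t \<le> t0" "t \<le> 1 / (norm d + 1)" "t \<le> s / (2 * (C * (norm d)\<^sup>2 + 1))"
    by (simp_all add: t_def)
  then have t: "t \<le> t0" "t * (norm d + 1) \<le> 1" "t * (2 * (C * (norm d)\<^sup>2 + 1)) \<le> s"
    using den by (simp_all add: pos_le_divide_eq)
  have "t * norm d \<le> 1" using t \<open>t > 0\<close> by (simp add: distrib_left)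
  then have "\<bar>f (u + t *\<^sub>R d) - (f u + grad f u \<bullet> (t *\<^sub>R d))\<bar> \<le> C * (norm (t *\<^sub>R d))\<^sup>2"
    using C(2)[of "u + t *\<^sub>R d"] \<open>t > 0\<close> by simp
  then have "f (u + t *\<^sub>R d) \<le> f u - t * s + t * (t * (C * (norm d)\<^sup>2))"
    using \<open>t > 0\<close> by (simp add: s_def abs_le_iff power2_eq_square mult_ac)
  moreover have "t * (t * (C * (norm d)\<^sup>2)) < t * s"
    using t(3) \<open>t > 0\<close> s by (intro mult_strict_left_mono) (auto simp: distrib_left)
  moreover have "f u \<le> f (u + t *\<^sub>R d)"
    using u t0(2)[OF \<open>t > 0\<close> t(1)] by (simp add: minimizer_def)
  ultimately show False by linarith
qed

text \<open>By NDC every symmetric \<open>X\<close> agrees on \<open>ker G(u)\<close> with the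
  derivative in some direction \<open>d\<close>. The value \<open>grad f u \<bullet> d\<close>
  depends on \<open>X\<close> only, because minimality makes \<open>f\<close> stationary along
  directions whose derivative vanishes on the kernel; the linear functional so obtained is
  represented by the multiplier. Axis directions then give stationarity, rank-one matrices
  semidefiniteness, and \<open>G u\<close>, which the direction 0 represents,
  complementarity.\<close>

lemma KKT_exists:
  fixes G :: "real^'n::finite \<Rightarrow> real^'m::finite^'m"
  assumes G: "polymat G" "\<forall>x. symmat (G x)" and f: "is_poly f" and u: "minimizer f G u" and ndc: "NDC G u"
  shows "\<exists>L. KKT f G u L"
proof -
  define rep where "rep d X \<longleftrightarrow> (\<forall>x y. G u *v x = 0 \<longrightarrow> G u *v y = 0 \<longrightarrow> x \<bullet> (DG G u d *v y) = x \<bullet> (X *v y))" for d X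
  have rep_ex: "\<exists>d. rep d X" if "symmat X" for X
  proof -
    obtain d B where "X = DG G u d + B" "\<forall>x y. G u *v x = 0 \<longrightarrow> G u *v y = 0 \<longrightarrow> x \<bullet> (B *v y) = 0"
      using NDC_surjective[OF ndc \<open>symmat X\<close>] by blast
    then have "rep d X" by (simp add: rep_def matrix_vector_mult_add_rdistrib inner_add_right)
    then show ?thesis ..
  qed
  have DG_add: "DG G u (d + e) *v y = DG G u d *v y + DG G u e *v y" for d e y
    by (simp add: linear_add[OF linear_DG] matrix_vector_mult_add_rdistrib)
  have DG_scale: "DG G u (c *\<^sub>R d) *v y = c *\<^sub>R (DG G u d *v y)" for c d y
    by (simp add: linear_cmul[OF linear_DG] scaleR_matrix_vector_assoc)
  obtain d0 where d0: "rep d0 (mat 1)"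
    using rep_ex[of "mat 1"] by (auto simp: symmat_def transpose_mat)
  \<comment> \<open>A small multiple of \<open>d0\<close>, whose derivative acts as the identity on
    the kernel, makes the hypothesis strict; \<open>e\<close> is so small that it can make up for at
    most half of a negative slope.\<close>
  have nonneg: "grad f u \<bullet> d \<ge> 0" if d: "\<And>y. G u *v y = 0 \<Longrightarrow> y \<bullet> (DG G u d *v y) \<ge> 0" for d
  proof (rule ccontr)
    assume neg: "\<not> grad f u \<bullet> d \<ge> 0"
    define e where "e = - (grad f u \<bullet> d) / (2 * (\<bar>grad f u \<bullet> d0\<bar> + 1))"
    have e: "e > 0" unfolding e_def using neg by (intro divide_pos_pos) auto
    have "grad f u \<bullet> (d + e *\<^sub>R d0) \<ge> 0"
    proof (rule minimizer_direction[OF G f u])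
      fix y assume y: "y \<noteq> 0" "G u *v y = 0"
      have "y \<bullet> (DG G u d0 *v y) > 0" using d0 y by (simp add: rep_def)
      then have "0 < e * (y \<bullet> (DG G u d0 *v y))" using e by simp
      then show "y \<bullet> (DG G u (d + e *\<^sub>R d0) *v y) > 0"
        using d[OF y(2)] by (simp add: DG_add DG_scale inner_add_right)
    qed
    moreover have "e * (grad f u \<bullet> d0) \<le> e * (\<bar>grad f u \<bullet> d0\<bar> + 1)"
      using e by (intro mult_left_mono) auto
    moreover have "e * (\<bar>grad f u \<bullet> d0\<bar> + 1) = - (grad f u \<bullet> d) / 2"
      by (simp add: e_def divide_simps add_nonneg_eq_0_iff)
    ultimately show False using neg by (simp add: inner_add_right)
  qed
  have unique: "grad f u \<bullet> d = grad f u \<bullet> e" if "rep d X" "rep e X" for d e X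
  proof -
    have "y \<bullet> (DG G u (d + (-1) *\<^sub>R e) *v y) = 0" "y \<bullet> (DG G u (e + (-1) *\<^sub>R d) *v y) = 0" if "G u *v y = 0" for y
      using \<open>rep d X\<close> \<open>rep e X\<close> that unfolding rep_def DG_add DG_scale by (simp_all add: inner_diff_right)
    then have "grad f u \<bullet> (d + (-1) *\<^sub>R e) \<ge> 0" "grad f u \<bullet> (e + (-1) *\<^sub>R d) \<ge> 0"
      by (auto intro!: nonneg)
    then show ?thesis by (simp add: inner_diff_right)
  qed
  have rep_lin: "rep (d + e) (X + Y)" "rep (c *\<^sub>R d) (c *\<^sub>R X)" if "rep d X" "rep e Y" for d e c X Y
    using that by (simp_all add: rep_def DG_add DG_scale matrix_vector_mult_add_rdistrib inner_add_right
        scaleR_matrix_vector_assoc[symmetric])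
  \<comment> \<open>Symmetrization extends the functional from symmetric matrices, where NDC
    provides directions, to all matrices, and makes its representer symmetric.\<close>
  define sp :: "real^'m^'m \<Rightarrow> real^'m^'m" where "sp M = (1 / 2) *\<^sub>R (M + transpose M)" for M
  have sp: "sp (M + N) = sp M + sp N" "sp (c *\<^sub>R M) = c *\<^sub>R sp M" "symmat (sp M)"
    "symmat M \<Longrightarrow> sp M = M" "sp (transpose M) = sp M" for M N c
    by (simp_all add: sp_def symmat_def transpose_def vec_eq_iff algebra_simps)
  define l where "l M = grad f u \<bullet> (SOME d. rep d (sp M))" for M
  have l_eq: "l M = grad f u \<bullet> d" if "rep d (sp M)" for M d
    unfolding l_def by (rule unique[OF someI that]) (rule that)
  have "linear l"
  proof (rule linearI)
    fix M N c
    obtain d e where de: "rep d (sp M)" "rep e (sp N)" using rep_ex sp(3) by metis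
    show "l (M + N) = l M + l N"
      using l_eq[of "d + e" "M + N"] l_eq[OF de(1)] l_eq[OF de(2)] rep_lin(1)[OF de] by (simp add: sp inner_add_right)
    show "l (c *\<^sub>R M) = c *\<^sub>R l M"
      using l_eq[of "c *\<^sub>R d" "c *\<^sub>R M"] l_eq[OF de(1)] rep_lin(2)[OF de] by (simp add: sp)
  qed
  define L where "L = adjoint l 1"
  have L: "L \<bullet> X = l X" for X
    using adjoint_works[OF \<open>linear l\<close>, of X 1] by (simp add: L_def inner_commute)
  have L_inner: "matinner L X = grad f u \<bullet> d" if "symmat X" "rep d X" for X d
    using that by (simp add: matinner_eq_inner L l_eq sp(4))
  have "KKT f G u L"
    unfolding KKT_def
  proof (intro conjI)
    show symL: "symmat L"
    proof -
      have "transpose L \<bullet> X = L \<bullet> transpose X" for X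
        unfolding inner_vec_def transpose_def by (simp, rule sum.swap)
      also have "L \<bullet> transpose X = L \<bullet> X" for X
        by (simp add: L l_def sp(5))
      finally show ?thesis
        unfolding symmat_def by (subst vector_eq_rdot[symmetric]) blast
    qed
    show "grad f u - DG_adj G u L = 0"
    proof -
      have "matinner (dG G i u) L = grad f u $ i" for i
      proof -
        have ax: "DG G u (axis i 1) = dG G i u"
        proof -
          have "DG G u (axis i 1) = (\<Sum>j\<in>UNIV. if j = i then dG G j u else 0)"
            unfolding DG_def by (rule sum.cong) (auto simp: axis_def)
          then show ?thesis by simp
        qed
        have "matinner L (dG G i u) = grad f u \<bullet> axis i 1"
          by (intro L_inner symmat_dG G) (simp add: rep_def ax)
        then show ?thesis by (simp add: matinner_def mult.commute inner_axis)
      qed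
      then show ?thesis by (simp add: DG_adj_def vec_eq_iff)
    qed
    show "psd L"
      unfolding psd_def
    proof (intro conjI allI symL)
      fix v :: "real^'m"
      define X :: "real^'m^'m" where "X = (\<chi> a b. v $ a * v $ b)"
      have X: "symmat X" by (simp add: symmat_def X_def transpose_def vec_eq_iff mult.commute)
      then obtain d where d: "rep d X" using rep_ex by blast
      have "X *v y = (v \<bullet> y) *\<^sub>R v" for y
        by (simp add: X_def matrix_vector_mult_def inner_vec_def vec_eq_iff sum_distrib_left mult_ac)
      then have "grad f u \<bullet> d \<ge> 0"
        using d by (intro nonneg) (simp add: rep_def inner_commute)
      also have "grad f u \<bullet> d = v \<bullet> (L *v v)"
        using L_inner[OF X d] by (simp add: inner_matrix_eq_sum matinner_def X_def mult_ac)
      finally show "v \<bullet> (L *v v) \<ge> 0" .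
    qed
    show "matinner L (G u) = 0"
      using L_inner[of "G u" 0] G(2) by (simp add: rep_def linear_0[OF linear_DG])
  qed
  then show ?thesis ..
qed

section \<open>Second order expansion of the constraints\<close>

lemma is_poly_linear_diff:
  fixes \<phi> :: "real^'n::finite \<Rightarrow> real"
  assumes "linear \<phi>"
  shows "is_poly (\<lambda>x. \<phi> (x - u))"
proof -
  have "is_poly \<phi>"
    unfolding is_poly_iff using assms by (intro real_polynomial_function.intros(1) linear_conv_bounded_linear[THEN iffD1])
  then show ?thesis
    using linear_diff[OF assms] by (simp add: is_poly_diff is_poly_const)
qed

lemma ordO_linear_diff:
  fixes \<phi> :: "real^'n::finite \<Rightarrow> real"
  assumes "linear \<phi>"
  shows "ordO u 1 (\<lambda>x. \<phi> (x - u))"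
  by (rule ordO_poly_vanishing[OF is_poly_linear_diff[OF assms]]) (simp add: linear_0[OF assms])

text \<open>The range of \<open>L\<close> lies in the span of \<open>vs\<close>, hence in the kernel
  of \<open>A\<close>. Strict complementarity says that range and kernel have equal dimension, so
  both coincide with the span.\<close>

lemma SCC_kernel_spanned:
  fixes A L :: "real^'m::finite^'m"
  assumes "symmat A" "rank A + rank L = CARD('m)"
    and L: "\<And>x. L *v x = (\<Sum>v\<leftarrow>vs. (v \<bullet> x) *\<^sub>R v)" and ker: "\<And>v. v \<in> set vs \<Longrightarrow> A *v v = 0"
    and k: "A *v k = 0"
  shows "k \<in> span (set vs)"
proof -
  have K: "{v. A *v v = 0} = {y \<in> UNIV. \<forall>x\<in>range ((*v) A). orthogonal x y}"
  proof -
    have "A *v y = 0 \<longleftrightarrow> (\<forall>x. orthogonal (A *v x) y)" for y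
    proof
      assume "\<forall>x. orthogonal (A *v x) y"
      then have "(A *v (A *v y)) \<bullet> y = 0" by (simp add: orthogonal_def)
      then show "A *v y = 0"
        using symmat_inner[OF assms(1), of "A *v y" y] by (simp add: inner_commute)
    next
      assume "A *v y = 0"
      then show "\<forall>x. orthogonal (A *v x) y"
        using symmat_inner[OF assms(1), of _ y] by (simp add: orthogonal_def)
    qed
    then show ?thesis by auto
  qed
  have subsp: "subspace (range ((*v) M))" for M :: "real^'m^'m"
    by (rule linear_subspace_image[OF matrix_vector_mul_linear subspace_UNIV])
  have "dim {v. A *v v = 0} + rank A = CARD('m)"
    using dim_subspace_orthogonal_to_vectors[OF subsp[of A] subspace_UNIV subset_UNIV]
    unfolding K rank_dim_range by simp
  then have dimK: "dim {v. A *v v = 0} = dim (range ((*v) L))"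
    using assms(2) by (simp add: rank_dim_range)
  have in_span: "(\<Sum>v\<leftarrow>ws. (v \<bullet> x) *\<^sub>R v) \<in> span (set ws)" for ws :: "(real^'m) list" and x
  proof (induction ws)
    case (Cons w ws)
    have "(\<Sum>v\<leftarrow>ws. (v \<bullet> x) *\<^sub>R v) \<in> span (set (w # ws))"
      using Cons span_mono[of "set ws" "set (w # ws)"] by auto
    then show ?case by (simp add: span_add span_scale span_base)
  qed (simp add: span_zero)
  have subK: "subspace {v. A *v v = 0}"
    by (auto simp: subspace_def matrix_vector_right_distrib matrix_vector_mult_scaleR)
  have "span (set vs) \<subseteq> {v. A *v v = 0}"
    using ker by (intro span_minimal subK) auto
  then have "range ((*v) L) \<subseteq> {v. A *v v = 0}"
    using in_span[where ws = vs] by (auto simp: L)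
  then have "range ((*v) L) = {v. A *v v = 0}"
    using subspace_dim_equal[OF subsp[of L] subK] dimK by simp
  then obtain x where "k = L *v x" using k by blast
  then show ?thesis using in_span[where ws = vs and x = x] by (simp add: L)
qed

lemma sum_list_sum_swap: "(\<Sum>v\<leftarrow>vs. \<Sum>i\<in>I. f v i) = (\<Sum>i\<in>I. \<Sum>v\<leftarrow>vs. (f v i :: real))"
  by (induction vs) (auto simp: sum.distrib)

text \<open>Stationarity removes the linear term of the Lagrangian at \<open>u\<close>, and
  complementarity makes its value there equal to \<open>f u\<close>.\<close>

lemma Lag_taylor:
  fixes G :: "real^'n::finite \<Rightarrow> real^'m::finite^'m"
  assumes G: "polymat G" and f: "is_poly f" and K: "KKT f G u L"
  shows "ordO u 3 (\<lambda>x. Lag f G L x - f u - 1 / 2 * ((x - u) \<bullet> (hess (Lag f G L) u *v (x - u))))"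
proof -
  have Gab: "is_poly (\<lambda>x. G x $ a $ b)" for a b using G by (simp add: polymat_def)
  have poly: "is_poly (Lag f G L)"
    unfolding Lag_def matinner_def by (intro is_poly_intros f Gab)
  have "partial (Lag f G L) i u = 0" for i
  proof -
    have inner: "is_poly (\<lambda>x. \<Sum>b\<in>UNIV. L $ a $ b * G x $ a $ b)" for a
      by (intro is_poly_intros Gab)
    have outer: "is_poly (\<lambda>x. \<Sum>a\<in>UNIV. 1 * (\<Sum>b\<in>UNIV. L $ a $ b * G x $ a $ b))"
      by (intro is_poly_intros Gab)
    have "Lag f G L = (\<lambda>x. f x - (\<Sum>a\<in>UNIV. 1 * (\<Sum>b\<in>UNIV. L $ a $ b * G x $ a $ b)))"
      by (simp add: Lag_def matinner_def fun_eq_iff)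
    then have "partial (Lag f G L) i u = partial f i u - (\<Sum>a\<in>UNIV. 1 * (\<Sum>b\<in>UNIV. L $ a $ b * partial (\<lambda>x. G x $ a $ b) i u))"
      by (simp only: partial_diff[OF f outer] partial_sum[OF inner] partial_sum[OF Gab])
    also have "\<dots> = (grad f u - DG_adj G u L) $ i"
      by (simp add: grad_def DG_adj_def matinner_def dG_def mult.commute)
    finally show ?thesis using K by (simp add: KKT_def)
  qed
  then have "grad (Lag f G L) u = 0" by (simp add: grad_def vec_eq_iff)
  moreover have "Lag f G L u = f u" using K by (simp add: Lag_def KKT_def)
  ultimately show ?thesis
    using poly_taylor_2[OF poly, of u] by (simp add: diff_diff_eq)
qed

text \<open>Expresses the curvature term by the multiplier vectors, the form in which perturbing
  those vectors produces it.\<close>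

lemma Hterm_quad_form:
  fixes G :: "real^'n::finite \<Rightarrow> real^'m::finite^'m"
  assumes G: "\<forall>x. symmat (G x)" and L: "\<And>x. L *v x = (\<Sum>v\<leftarrow>vs. (v \<bullet> x) *\<^sub>R v)"
  shows "h \<bullet> (Hterm G u L *v h) = 2 * (\<Sum>v\<leftarrow>vs. (DG G u h *v v) \<bullet> (pinv (G u) *v (DG G u h *v v)))"
proof -
  have "h $ i * h $ j * Hterm G u L $ i $ j
      = 2 * (\<Sum>v\<leftarrow>vs. h $ i * h $ j * ((dG G i u *v v) \<bullet> (pinv (G u) *v (dG G j u *v v))))" for i j
  proof -
    have "v \<bullet> ((dG G i u ** pinv (G u) ** dG G j u) *v v) = (dG G i u *v v) \<bullet> (pinv (G u) *v (dG G j u *v v))" for v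
      using symmat_inner[OF symmat_dG[OF G], of v i u] by (simp add: matrix_vector_mul_assoc[symmetric])
    then show ?thesis
      by (simp add: Hterm_def matinner_sum_outer[OF L] sum_list_const_mult)
  qed
  then have "h \<bullet> (Hterm G u L *v h)
      = (\<Sum>i\<in>UNIV. \<Sum>j\<in>UNIV. 2 * (\<Sum>v\<leftarrow>vs. h $ i * h $ j * ((dG G i u *v v) \<bullet> (pinv (G u) *v (dG G j u *v v)))))"
    by (simp only: inner_matrix_eq_sum)
  also have "\<dots> = 2 * (\<Sum>v\<leftarrow>vs. \<Sum>i\<in>UNIV. \<Sum>j\<in>UNIV. h $ i * h $ j * ((dG G i u *v v) \<bullet> (pinv (G u) *v (dG G j u *v v))))"
    by (simp only: sum_list_sum_swap sum_distrib_left)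
  also have "(\<lambda>v. \<Sum>i\<in>UNIV. \<Sum>j\<in>UNIV. h $ i * h $ j * ((dG G i u *v v) \<bullet> (pinv (G u) *v (dG G j u *v v))))
      = (\<lambda>v. (DG G u h *v v) \<bullet> (pinv (G u) *v (DG G u h *v v)))"
    by (rule ext, subst sum.swap) (simp add: DG_mult_vec linear_sum[OF matrix_vector_mul_linear] inner_sum_left
        inner_sum_right matrix_vector_mult_scaleR sum_distrib_left mult_ac)
  finally show ?thesis .
qed

text \<open>Perturbing each multiplier vector \<open>v\<close> by \<open>w = - (G(u)\<^sup>+ + \<kappa> P) a\<close> with
  \<open>a = DG(u)[h] v\<close> and \<open>P\<close> the projection onto the kernel of \<open>G(u)\<close>: the pseudoinverse part
  produces the H-term, the kernel part penalizes directions outside the critical cone.\<close>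

lemma perturbed_multiplier_expansion:
  fixes G :: "real^'n::finite \<Rightarrow> real^'m::finite^'m" and \<kappa> :: real
  assumes G: "polymat G" "\<forall>x. symmat (G x)" and v: "G u *v v = 0"
  defines "P \<equiv> mat 1 - G u ** pinv (G u)"
  defines "a \<equiv> \<lambda>h. DG G u h *v v"
  defines "w \<equiv> \<lambda>x. - ((pinv (G u) + \<kappa> *\<^sub>R P) *v a (x - u))"
  shows "polyvec (\<lambda>x. v + w x)"
    and "ordO u 3 (\<lambda>x. v \<bullet> (G x *v v) - (v + w x) \<bullet> (G x *v (v + w x))
        - (a (x - u) \<bullet> (pinv (G u) *v a (x - u)) + 2 * \<kappa> * (a (x - u) \<bullet> (P *v a (x - u)))))" (is ?goal)
proof -
  define A where "A = G u"
  define X where "X = pinv A"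
  have symA: "symmat A" using G by (simp add: A_def)
  note X = pinv_symmetric[OF symA, folded X_def]
  have P: "P = mat 1 - A ** X" by (simp add: P_def A_def X_def)
  have AP: "A *v (P *v y) = 0" for y
  proof -
    have "A *v (P *v y) = A *v y - (A ** (X ** A)) *v y"
      by (simp add: P X(3) matrix_vector_mult_diff_rdistrib matrix_vector_mult_diff_distrib matrix_vector_mul_assoc)
    then show ?thesis using X(1) by (simp add: matrix_mul_assoc)
  qed
  have lin: "linear (\<lambda>h. (- ((X + \<kappa> *\<^sub>R P) *v a h)) $ i)" for i
    by (simp add: linear_iff a_def linear_add[OF linear_DG] linear_cmul[OF linear_DG] matrix_vector_mult_add_rdistrib
        matrix_vector_right_distrib matrix_vector_mult_scaleR scaleR_matrix_vector_assoc[symmetric] algebra_simps)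
  have w_def': "w x = - ((X + \<kappa> *\<^sub>R P) *v a (x - u))" for x
    by (simp add: w_def X_def A_def)
  have w_poly: "is_poly (\<lambda>x. w x $ i)" and w_ord: "ordO u 1 (\<lambda>x. w x $ i)" for i
    unfolding w_def' by (rule is_poly_linear_diff[OF lin], rule ordO_linear_diff[OF lin])
  show "polyvec (\<lambda>x. v + w x)"
    unfolding polyvec_def by (simp add: is_poly_add is_poly_const w_poly)
  define R where "R x = G x - A - DG G u (x - u)" for x
  \<comment> \<open>A first order perturbation meets the second order remainder of \<open>G\<close>;
    with \<open>o2\<close> this accounts for everything beyond the main terms.\<close>
  have o1: "ordO u (1 + 2 + 0) (\<lambda>x. w x \<bullet> (R x *v v))"
    unfolding R_def A_def by (intro ordO_bilinear w_ord polymat_taylor_1 G ordO_const)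
  have "is_poly (\<lambda>x. (G x - A) $ i $ j)" for i j
    using G(1) by (simp add: polymat_def is_poly_diff is_poly_const)
  then have o2: "ordO u (1 + 1 + 1) (\<lambda>x. w x \<bullet> ((G x - A) *v w x))"
    by (intro ordO_bilinear w_ord ordO_poly_vanishing) (simp_all add: A_def)
  let ?T = "\<lambda>x. v \<bullet> (G x *v v) - (v + w x) \<bullet> (G x *v (v + w x))
        - (a (x - u) \<bullet> (X *v a (x - u)) + 2 * \<kappa> * (a (x - u) \<bullet> (P *v a (x - u))))"
  have eq: "?T x
      = - (2 * (w x \<bullet> (R x *v v)) + w x \<bullet> ((G x - A) *v w x))" for x
  proof -
    define b where "b = a (x - u)"
    have "G x = A + DG G u (x - u) + R x" by (simp add: R_def)
    then have wGv: "w x \<bullet> (G x *v v) = w x \<bullet> b + w x \<bullet> (R x *v v)"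
      using v by (simp add: b_def a_def A_def matrix_vector_mult_add_rdistrib inner_add_right)
    have Gx: "symmat (G x)" using G by simp
    have vw: "(v + w x) \<bullet> (G x *v (v + w x)) = v \<bullet> (G x *v v) + 2 * (w x \<bullet> (G x *v v)) + w x \<bullet> (G x *v w x)"
      using symmat_inner[OF Gx, of v "w x"]
      by (simp add: matrix_vector_right_distrib inner_add_left inner_add_right inner_commute)
    have wGw: "w x \<bullet> (G x *v w x) = w x \<bullet> (A *v w x) + w x \<bullet> ((G x - A) *v w x)"
      by (simp add: matrix_vector_mult_diff_rdistrib inner_diff_right)
    have wb: "w x \<bullet> b = - (b \<bullet> (X *v b)) - \<kappa> * (b \<bullet> (P *v b))"
      by (simp add: w_def' b_def[symmetric] matrix_vector_mult_add_rdistrib scaleR_matrix_vector_assoc[symmetric]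
          inner_add_left inner_diff_right inner_commute)
    \<comment> \<open>The cross term \<open>2 * (w x \<bullet> b)\<close> subtracts the
      pseudoinverse form twice; the present term gives it back once, because the kernel part of
      \<open>w\<close> is killed by \<open>A\<close> and \<open>X ** A ** X = X\<close>. One copy
      remains, as the H-term requires.\<close>
    have wAw: "w x \<bullet> (A *v w x) = b \<bullet> (X *v b)"
    proof -
      have Aw: "A *v w x = - (A *v (X *v b))"
      proof -
        have "w x = - (X *v b) - \<kappa> *\<^sub>R (P *v b)"
          by (simp add: w_def' b_def[symmetric] matrix_vector_mult_add_rdistrib scaleR_matrix_vector_assoc[symmetric])
        then show ?thesis
          by (simp add: matrix_vector_mult_diff_distrib matrix_vector_mult_scaleR AP)
            (metis matrix_vector_mult_scaleR scaleR_minus1_left)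
      qed
      have "w x \<bullet> (A *v w x) = (A *v w x) \<bullet> w x" by (simp add: inner_commute)
      also have "\<dots> = - ((A *v (X *v b)) \<bullet> w x)" by (simp add: Aw)
      also have "(A *v (X *v b)) \<bullet> w x = (X *v b) \<bullet> (A *v w x)"
        using symmat_inner[OF symA, of "X *v b" "w x"] by simp
      also have "\<dots> = - ((X *v b) \<bullet> (A *v (X *v b)))" by (simp add: Aw)
      also have "(X *v b) \<bullet> (A *v (X *v b)) = b \<bullet> (X *v (A *v (X *v b)))"
        using symmat_inner[OF X(4), of b] by simp
      also have "X *v (A *v (X *v b)) = X *v b"
        using X(2) by (simp add: matrix_vector_mul_assoc matrix_mul_assoc)
      finally show ?thesis by simp
    qed
    have arith: "s - (s + 2 * (\<beta> + \<rho>) + (\<xi> + \<tau>)) - (\<xi> + 2 * \<kappa> * \<pi>) = - (2 * \<rho> + \<tau>)"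
      if "\<beta> = - \<xi> - \<kappa> * \<pi>" for s \<beta> \<rho> \<xi> \<tau> \<pi> :: real
      using that by (simp add: algebra_simps)
    show ?thesis
      unfolding b_def[symmetric] vw wGw wAw wGv by (rule arith[OF wb])
  qed
  have o1': "ordO u 3 (\<lambda>x. w x \<bullet> (R x *v v))" using o1 by (simp add: numeral_3_eq_3)
  have o2': "ordO u 3 (\<lambda>x. w x \<bullet> ((G x - A) *v w x))" using o2 by (simp add: numeral_3_eq_3)
  have "ordO u 3 (\<lambda>x. ?T x)"
    unfolding eq by (rule ordO_minus[OF ordO_add[OF ordO_cmult[OF o1'] o2']])
  then show ?goal
    unfolding X_def A_def .
qed

section \<open>Local certificates and the main theorem\<close>

lemma QM_sum_list: "(\<And>v. v \<in> set vs \<Longrightarrow> QM G (p v)) \<Longrightarrow> QM G (\<lambda>x. \<Sum>v\<leftarrow>vs. p v x)"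
  by (induction vs) (auto intro: QM_sos sos_0 QM_add)

lemma sum_list_nonneg_zeroD: "(\<And>v. v \<in> set vs \<Longrightarrow> 0 \<le> f v) \<Longrightarrow> (\<Sum>v\<leftarrow>vs. f v) = (0::real) \<Longrightarrow> v \<in> set vs \<Longrightarrow> f v = 0"
  by (subst (asm) sum_list_nonneg_eq_0_iff) auto

text \<open>\<open>f - g\<close> is the Lagrangian plus the change of the generators under
  perturbation. Up to third order this is half of the SOSC form \<open>q\<close> plus a multiple of
  the penalty \<open>p\<close>, and a large enough penalty extends positivity from the critical cone
  to all directions.\<close>

lemma second_order_local_certificate:
  fixes G :: "real^'n::finite \<Rightarrow> real^'m::finite^'m"
  assumes G: "polymat G" "\<forall>x. symmat (G x)" "psd (G u)" and f: "is_poly f"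
    and K: "KKT f G u L" and rank: "rank (G u) + rank L = CARD('m)"
    and sosc: "\<And>h. h \<noteq> 0 \<Longrightarrow> (\<And>x y. G u *v x = 0 \<Longrightarrow> G u *v y = 0 \<Longrightarrow> x \<bullet> (DG G u h *v y) = 0)
      \<Longrightarrow> h \<bullet> ((hess (Lag f G L) u + Hterm G u L) *v h) > 0"
  shows "\<exists>g. QM G g \<and> quad_growth (\<lambda>x. f x - f u - g x) u"
proof -
  have symA: "symmat (G u)" using G by simp
  obtain vs where vs: "\<And>x. L *v x = (\<Sum>v\<leftarrow>vs. (v \<bullet> x) *\<^sub>R v)"
    using psd_sum_outer[of L] K unfolding KKT_def by blast
  have ker: "G u *v v = 0" if "v \<in> set vs" for v
    by (rule KKT_kernel[OF K G(3) vs that])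
  define X where "X = pinv (G u)"
  note X = pinv_symmetric[OF symA, folded X_def]
  define P where "P = mat 1 - G u ** X"
  have Py: "P *v y = y - G u *v (X *v y)" "P *v y = y - X *v (G u *v y)" for y
    unfolding P_def matrix_vector_mult_diff_rdistrib
    by (simp add: matrix_vector_mul_assoc, simp add: matrix_vector_mul_assoc X(3))
  have GXG: "G u *v (X *v (G u *v y)) = G u *v y" for y
    using X(1) by (simp add: matrix_vector_mul_assoc matrix_mul_assoc)
  have "G u *v (P *v y) = 0" for y
    by (simp add: Py(2) matrix_vector_mult_diff_distrib GXG)
  then have PP: "P *v (P *v y) = P *v y" for y
    by (simp add: Py(2)[of "P *v y"])
  have P_sym: "x \<bullet> (P *v y) = (P *v x) \<bullet> y" for x y
    using symmat_inner[OF symA, of x "X *v y"] symmat_inner[OF X(4), of "G u *v x" y]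
    by (simp add: Py(1)[of y] Py(2)[of x] inner_diff_left inner_diff_right)
  have P_nonneg: "y \<bullet> (P *v y) \<ge> 0" and P_zero: "y \<bullet> (P *v y) = 0 \<Longrightarrow> P *v y = 0" for y
  proof -
    have eq: "y \<bullet> (P *v y) = (P *v y) \<bullet> (P *v y)"
      using P_sym[of y "P *v y"] by (simp add: PP)
    show "y \<bullet> (P *v y) \<ge> 0" unfolding eq by simp
    show "P *v y = 0" if "y \<bullet> (P *v y) = 0" using that unfolding eq by simp
  qed
  define a where "a v h = DG G u h *v v" for v h
  have a_scale: "a v (c *\<^sub>R h) = c *\<^sub>R a v h" for v c h
    by (simp add: a_def linear_cmul[OF linear_DG] scaleR_matrix_vector_assoc)
  have lin_a: "linear (a v)" for v
    by (simp add: linear_iff a_scale) (simp add: a_def linear_add[OF linear_DG] matrix_vector_mult_add_rdistrib)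
  define M where "M = hess (Lag f G L) u + Hterm G u L"
  define q where "q h = h \<bullet> (M *v h)" for h
  \<comment> \<open>The penalty measures the kernel components of the vectors
    \<open>DG G u h *v v\<close>; \<open>P\<close> is the orthogonal projection onto
    \<open>ker G(u)\<close>.\<close>
  define p where "p h = (\<Sum>v\<leftarrow>vs. a v h \<bullet> (P *v a v h))" for h
  have p_nonneg: "p h \<ge> 0" for h
    unfolding p_def by (intro sum_list_nonneg) (auto simp: P_nonneg)
  have cont_p: "continuous_on S p" for S
  proof -
    have "continuous_on S (\<lambda>h. \<Sum>v\<leftarrow>ws. a v h \<bullet> (P *v a v h))" for ws
    proof (induction ws)
      case (Cons v ws)
      have "continuous_on S (\<lambda>h. a v h \<bullet> (P *v a v h))"
        by (intro continuous_intros linear_continuous_on_compose[of S "a v" "(*v) P"] linear_continuous_on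
            linear_conv_bounded_linear[THEN iffD1] lin_a matrix_vector_mul_linear)
      then show ?case using Cons by (auto intro: continuous_on_add)
    qed simp
    then show ?thesis unfolding p_def .
  qed
  have "\<exists>l \<delta>. l \<ge> 0 \<and> \<delta> > 0 \<and> (\<forall>h\<in>sphere 0 1. q h + l * p h \<ge> \<delta>)"
  proof (rule exact_penalty[OF compact_sphere, of 0 1 q p])
    show "continuous_on (sphere 0 1) q" unfolding q_def by (rule continuous_quad_form)
    show "q h > 0" if h: "h \<in> sphere 0 1" "p h = 0" for h
      unfolding q_def M_def
    proof (rule sosc)
      show "h \<noteq> 0" using h(1) by auto
      \<comment> \<open>Vanishing penalty only says that \<open>DG G u h *v v\<close> is orthogonal
        to the kernel for the multiplier vectors \<open>v\<close>. Strict complementarity, by which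
        these span the kernel, turns this into membership in the critical cone.\<close>
      have Pa: "P *v a v h = 0" if "v \<in> set vs" for v
        using h(2) that P_nonneg unfolding p_def
        by (intro P_zero sum_list_nonneg_zeroD[of vs "\<lambda>v. a v h \<bullet> (P *v a v h)"]) auto
      fix x y assume x: "G u *v x = 0" and y: "G u *v y = 0"
      have "P *v x = x" using x by (simp add: Py(2))
      then have xv: "x \<bullet> (DG G u h *v v) = 0" if "v \<in> set vs" for v
        using P_sym[of x "a v h"] Pa[OF that] by (simp add: a_def)
      have "y \<in> span (set vs)"
        by (rule SCC_kernel_spanned[OF symA rank vs ker y])
      then show "x \<bullet> (DG G u h *v y) = 0"
        by (induction rule: span_induct_alt)
          (use xv in \<open>auto simp: matrix_vector_right_distrib matrix_vector_mult_scaleR inner_add_right\<close>)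
    qed
    show "continuous_on (sphere 0 1) p" by (rule cont_p)
    show "p h \<ge> 0" for h by (rule p_nonneg)
  qed blast
  then obtain l \<delta> where l: "\<delta> > 0" "\<forall>h\<in>sphere 0 1. q h + l * p h \<ge> \<delta>"
    by blast
  have qp: "q h + l * p h \<ge> \<delta> * (norm h)\<^sup>2" for h
  proof (cases "h = 0")
    case True
    have "a v 0 = 0" for v using linear_0[OF lin_a] .
    then show ?thesis using True by (simp add: q_def p_def)
  next
    case False
    define e where "e = (1 / norm h) *\<^sub>R h"
    have e: "norm e = 1" "h = norm h *\<^sub>R e" using False by (simp_all add: e_def)
    have "q (c *\<^sub>R e) = c\<^sup>2 * q e" "p (c *\<^sub>R e) = c\<^sup>2 * p e" for c
      by (simp_all add: q_def p_def a_scale matrix_vector_mult_scaleR power2_eq_square mult.assoc sum_list_const_mult)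
    from this[of "norm h"] have "q h + l * p h = (norm h)\<^sup>2 * (q e + l * p e)"
      unfolding e(2)[symmetric] by (simp add: algebra_simps)
    also have "\<dots> \<ge> (norm h)\<^sup>2 * \<delta>" using l(2) e(1) by (intro mult_left_mono) auto
    finally show ?thesis by (simp add: mult.commute)
  qed
  \<comment> \<open>The choice \<open>\<kappa> = l / 4\<close> makes the penalty contribution
    \<open>2 * \<kappa> * p\<close> equal to \<open>l * p / 2\<close>, matching the factor 1/2 of
    the Hessian term.\<close>
  define w where "w v x = - ((X + (l / 4) *\<^sub>R P) *v a v (x - u))" for v x
  define g where "g x = (\<Sum>v\<leftarrow>vs. (v + w v x) \<bullet> (G x *v (v + w v x)))" for x
  note exp = perturbed_multiplier_expansion[OF G(1,2) ker, where \<kappa> = "l / 4",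
      folded X_def, folded P_def, folded a_def, folded w_def]
  have "QM G g"
    unfolding g_def by (intro QM_sum_list QM_quad exp(1))
  define d where "d x = f x - f u - g x - (q (x - u) + l * p (x - u)) / 2" for x
  let ?T = "\<lambda>v x. v \<bullet> (G x *v v) - (v + w v x) \<bullet> (G x *v (v + w v x))
        - (a v (x - u) \<bullet> (X *v a v (x - u)) + 2 * (l / 4) * (a v (x - u) \<bullet> (P *v a v (x - u))))"
  have d_eq: "d x = (Lag f G L x - f u - 1 / 2 * ((x - u) \<bullet> (hess (Lag f G L) u *v (x - u))))
      + (\<Sum>v\<leftarrow>vs. ?T v x)" for x
  proof -
    define B where "B = (\<Sum>v\<leftarrow>vs. a v (x - u) \<bullet> (X *v a v (x - u)))"
    have "f x = Lag f G L x + (\<Sum>v\<leftarrow>vs. v \<bullet> (G x *v v))"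
      by (simp add: Lag_def matinner_sum_outer[OF vs])
    moreover have "q (x - u) = (x - u) \<bullet> (hess (Lag f G L) u *v (x - u)) + 2 * B"
      unfolding q_def M_def B_def a_def X_def
      by (simp add: matrix_vector_mult_add_rdistrib inner_add_right Hterm_quad_form[OF G(2) vs])
    moreover have "(\<Sum>v\<leftarrow>vs. ?T v x)
      = (\<Sum>v\<leftarrow>vs. v \<bullet> (G x *v v)) - g x - (B + 2 * (l / 4) * p (x - u))"
      unfolding g_def B_def p_def by (simp only: sum_list_subtractf sum_list_addf sum_list_const_mult)
    ultimately show ?thesis unfolding d_def by (simp add: field_simps)
  qed
  have "ordO u 3 d"
    unfolding d_eq by (intro ordO_add Lag_taylor[OF G(1) f K] ordO_sum_list exp(2))
  moreover have "quad_growth (\<lambda>x. (q (x - u) + l * p (x - u)) / 2) u"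
  proof -
    have "q 0 = 0" "p 0 = 0"
      using linear_0[OF lin_a] by (simp_all add: q_def p_def)
    moreover have "\<delta> / 2 * (norm (x - u))\<^sup>2 \<le> (q (x - u) + l * p (x - u)) / 2" for x
      using qp[of "x - u"] by simp
    ultimately show ?thesis
      unfolding quad_growth_def using l(1)
      by (intro conjI exI[of _ "\<delta> / 2"]) (auto intro: exI[of _ 1])
  qed
  ultimately have "quad_growth (\<lambda>x. (q (x - u) + l * p (x - u)) / 2 + d x) u"
    by (intro quad_growth_perturb)
  then have "quad_growth (\<lambda>x. f x - f u - g x) u"
    by (simp add: d_def algebra_simps)
  with \<open>QM G g\<close> show ?thesis by blast
qed

text \<open>Existence and uniqueness together identify the definite description \<open>mult\<close>
  with an actual multiplier, so that SCC and SOSC become statements about it.\<close>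

lemma optimality_conditions_certificate:
  fixes G :: "real^'n::finite \<Rightarrow> real^'m::finite^'m"
  assumes G: "polymat G" "\<forall>x. symmat (G x)" and f: "is_poly f" and u: "minimizer f G u"
    and cond: "NDC G u" "SCC f G u" "SOSC f G u"
  shows "\<exists>g. QM G g \<and> quad_growth (\<lambda>x. f x - f u - g x) u"
proof -
  have psd: "psd (G u)" using u by (simp add: minimizer_def feasible_def)
  obtain L where K: "KKT f G u L" using KKT_exists[OF G f u cond(1)] by blast
  have L: "mult f G u = L"
    unfolding mult_def using K KKT_unique[OF cond(1) psd _ K] by (rule the_equality)
  obtain es where es: "ker_basis (G u) es" using ker_basis_exists by blast
  show ?thesis
  proof (rule second_order_local_certificate[OF G psd f K])
    show "rank (G u) + rank L = CARD('m)" using cond(2) by (simp add: SCC_def L)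
    fix h assume h: "h \<noteq> 0" "\<And>x y. G u *v x = 0 \<Longrightarrow> G u *v y = 0 \<Longrightarrow> x \<bullet> (DG G u h *v y) = 0"
    then have "h \<in> crit_cone G u es"
      by (simp add: crit_cone_def EtNE_zero_iff[OF es])
    then show "h \<bullet> ((hess (Lag f G L) u + Hterm G u L) *v h) > 0"
      using cond(3) es h(1) by (simp add: SOSC_def L)
  qed
qed

section \<open>Attainment, truncation and the two relaxation bounds\<close>

lemma minimizer_exists:
  fixes G :: "real^'n::finite \<Rightarrow> real^'m::finite^'m"
  assumes "polymat G" "\<forall>x. symmat (G x)" "archimedean G" "is_poly f" "feasible G \<noteq> {}"
  obtains u where "minimizer f G u" "f u = fmin f G" "\<And>x. x \<in> feasible G \<Longrightarrow> fmin f G \<le> f x"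
proof -
  obtain u where u: "u \<in> feasible G" "\<forall>x\<in>feasible G. f u \<le> f x"
    using continuous_attains_inf[OF compact_feasible[OF assms(1-3)] assms(5) is_poly_continuous[OF assms(4)]]
    by blast
  then have fmin: "fmin f G = f u"
    unfolding fmin_def by (intro cInf_eq_minimum) auto
  show ?thesis
    by (rule that[of u]) (use u in \<open>auto simp: minimizer_def fmin\<close>)
qed

lemma QM_imp_QMk:
  fixes G :: "real^'n::finite \<Rightarrow> real^'m::finite^'m"
  assumes "polymat G" "QM G p"
  obtains N where "\<And>k. k \<ge> N \<Longrightarrow> QMk k G p"
proof -
  obtain \<sigma> vs where *: "sos \<sigma>" "\<forall>v\<in>set vs. polyvec v"
    and p: "p = (\<lambda>x. \<sigma> x + (\<Sum>v\<leftarrow>vs. v x \<bullet> (G x *v v x)))"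
    using assms unfolding QM_def by blast
  obtain d where d: "poly_deg_le d \<sigma>" using sos_is_poly[OF *(1)] unfolding is_poly_def by blast
  have "\<exists>N. \<forall>v\<in>set vs. poly_deg_le N (\<lambda>x. v x \<bullet> (G x *v v x))"
    using *(2)
  proof (induction vs)
    case (Cons v vs)
    then obtain N where N: "\<forall>v\<in>set vs. poly_deg_le N (\<lambda>x. v x \<bullet> (G x *v v x))" by auto
    have "is_poly (\<lambda>x. v x \<bullet> (G x *v v x))"
      using is_poly_quad[OF assms(1)] Cons.prems by simp
    then obtain e where "poly_deg_le e (\<lambda>x. v x \<bullet> (G x *v v x))" unfolding is_poly_def by blast
    with N have "\<forall>v\<in>set (v # vs). poly_deg_le (max e N) (\<lambda>x. v x \<bullet> (G x *v v x))"
      by (auto intro: poly_deg_le_mono)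
    then show ?case by blast
  qed simp
  then obtain N where N: "\<forall>v\<in>set vs. poly_deg_le N (\<lambda>x. v x \<bullet> (G x *v v x))" by blast
  have "QMk k G p" if "k \<ge> max d N" for k
    unfolding QMk_def
  proof (intro exI conjI)
    show "poly_deg_le (2 * k) \<sigma>" using that by (intro poly_deg_le_mono[OF d]) simp
    show "\<forall>v\<in>set vs. polyvec v \<and> poly_deg_le (2 * k) (\<lambda>x. v x \<bullet> (G x *v v x))"
      using *(2) N that by (auto intro: poly_deg_le_mono)
  qed (use * p in auto)
  with that show ?thesis by blast
qed

lemma QMk_imp_QM: "QMk k G p \<Longrightarrow> QM G p"
  unfolding QMk_def QM_def by blast

lemma QMk_poly_deg_le:
  assumes "QMk k G p"
  shows "poly_deg_le (2 * k) p"
proof -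
  obtain \<sigma> vs where "poly_deg_le (2 * k) \<sigma>" "\<forall>v\<in>set vs. poly_deg_le (2 * k) (\<lambda>x. v x \<bullet> (G x *v v x))"
    and p: "p = (\<lambda>x. \<sigma> x + (\<Sum>v\<leftarrow>vs. v x \<bullet> (G x *v v x)))"
    using assms unfolding QMk_def by blast
  then show ?thesis
    unfolding p by (intro poly_deg_le_add poly_deg_le_sum_list) auto
qed

theorem theorem1p1:
  fixes f :: "real^'n::finite \<Rightarrow> real"
    and G :: "real^'n \<Rightarrow> real^'m::finite^'m"
  assumes f_poly: "is_poly f"
    and G_poly: "polymat G"
    and G_sym: "\<forall>x. symmat (G x)"
    and feas_ne: "feasible G \<noteq> {}"
    and arch: "archimedean G"
    and conds: "\<forall>u. minimizer f G u \<longrightarrow> NDC G u \<and> SCC f G u \<and> SOSC f G u"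
  shows "(\<exists>N>0. \<forall>k\<ge>N. f_sos k f G = ereal (fmin f G) \<and> f_mom k f G = ereal (fmin f G))
         \<and> QM G (\<lambda>x. f x - fmin f G)"
proof -
  obtain u0 where u0: "minimizer f G u0" "f u0 = fmin f G"
    and fmin_le: "\<And>x. x \<in> feasible G \<Longrightarrow> fmin f G \<le> f x"
    by (rule minimizer_exists[OF G_poly G_sym arch f_poly feas_ne]) blast
  have u0_feas: "u0 \<in> feasible G" using u0 by (simp add: minimizer_def)
  have QM: "QM G (\<lambda>x. f x - fmin f G)"
  proof (rule local_global[OF G_poly G_sym arch])
    show "is_poly (\<lambda>x. f x - fmin f G)" by (intro is_poly_intros f_poly)
    show "0 \<le> f x - fmin f G" if "x \<in> feasible G" for x using fmin_le[OF that] by simp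
    fix u assume u: "u \<in> feasible G" "f u - fmin f G = 0"
    then have min: "minimizer f G u" using fmin_le by (simp add: minimizer_def)
    show "\<exists>g. QM G g \<and> quad_growth (\<lambda>x. f x - fmin f G - g x) u"
      using optimality_conditions_certificate[OF G_poly G_sym f_poly min] conds min u(2) by auto
  qed
  obtain N where N: "\<And>k. k \<ge> N \<Longrightarrow> QMk k G (\<lambda>x. f x - fmin f G)"
    using QM_imp_QMk[OF G_poly QM] by blast
  obtain e where e: "poly_deg_le e f" using f_poly unfolding is_poly_def by blast
  \<comment> \<open>The summand \<open>e\<close> makes \<open>f\<close> of degree at most
    \<open>2 * k\<close>, so that \<open>riesz\<close> evaluates it correctly; the summand 1 makes
    the threshold positive.\<close>
  have "f_sos k f G = ereal (fmin f G) \<and> f_mom k f G = ereal (fmin f G)" if k: "k \<ge> N + e + 1" for k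
  proof
    have QMk: "QMk k G (\<lambda>x. f x - fmin f G)" using N k by simp
    have f_deg: "poly_deg_le (2 * k) f" by (rule poly_deg_le_mono[OF e]) (use k in simp)
    show "f_sos k f G = ereal (fmin f G)"
      unfolding f_sos_def
    proof (rule antisym[OF Sup_least Sup_upper])
      fix z assume "z \<in> ereal ` {\<gamma>. QMk k G (\<lambda>x. f x - \<gamma>)}"
      then obtain \<gamma> where "z = ereal \<gamma>" "QM G (\<lambda>x. f x - \<gamma>)" using QMk_imp_QM by blast
      then show "z \<le> ereal (fmin f G)" using QM_nonneg[OF _ u0_feas] u0(2) by fastforce
    qed (use QMk in blast)
    show "f_mom k f G = ereal (fmin f G)"
      unfolding f_mom_def
    proof (rule antisym[OF Inf_lower Inf_greatest])
      let ?Y = "{ereal (riesz k y f) | y. riesz k y (\<lambda>_. 1) = 1 \<and> (\<forall>p. QMk k G p \<longrightarrow> riesz k y p \<ge> 0)}"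
      \<comment> \<open>The moment bound is attained at the Dirac moments of the minimizer
        \<open>u0\<close>, which are feasible for every order.\<close>
      have "riesz k (\<lambda>\<alpha>. mono \<alpha> u0) p \<ge> 0" if "QMk k G p" for p
        using riesz_mono[OF QMk_poly_deg_le[OF that]] QM_nonneg[OF QMk_imp_QM[OF that] u0_feas] by simp
      moreover have "riesz k (\<lambda>\<alpha>. mono \<alpha> u0) (\<lambda>_. 1) = 1" by (rule riesz_mono[OF poly_deg_le_const])
      moreover have "ereal (fmin f G) = ereal (riesz k (\<lambda>\<alpha>. mono \<alpha> u0) f)"
        by (simp add: riesz_mono[OF f_deg] u0(2))
      ultimately show "ereal (fmin f G) \<in> ?Y"
        by blast
      fix z assume "z \<in> ?Y"
      then obtain y where y: "z = ereal (riesz k y f)" "riesz k y (\<lambda>_. 1) = 1" "\<And>p. QMk k G p \<Longrightarrow> riesz k y p \<ge> 0"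
        by blast
      \<comment> \<open>Weak duality: every feasible moment vector is nonnegative on the truncated
        certificate for \<open>f - fmin\<close>.\<close>
      have "riesz k y f - fmin f G \<ge> 0"
        using y(3)[OF QMk] riesz_diff_const[OF f_deg] y(2) by simp
      then show "ereal (fmin f G) \<le> z" by (simp add: y(1))
    qed
  qed
  then have "\<exists>N>0. \<forall>k\<ge>N. f_sos k f G = ereal (fmin f G) \<and> f_mom k f G = ereal (fmin f G)"
    by (intro exI[of _ "N + e + 1"]) simp
  with QM show ?thesis by blast
qed

end
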